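(* Let $k$ be an algebraically closed field of characteristic $p>0$, let $k\alpha_p=k[x]/(x^p)$ with $x$ primitive, and let $$\Phi:=1+\sum_{i=1}^{p-1}\frac1i\binom{p-1}{i-1}\,x\otimes x^i\otimes x^{p-i}\in (k\alpha_p)^{\otimes3}.$$ If $\Phi'$ is a non-trivial associator for $k\alpha_p$ then $(k\alpha_p,\Phi')$ is pseudotwist equivalent to $(k\alpha_p,\Phi)$. In particular, $(k\alpha_p,\Phi)$ is a local (cocommutative and commutative) quasi-Hopf algebra of dimension $p$ over $k$, which is not pseudotwist equivalent to a Hopf algebra.
   Context: $\alpha_p$ is the Frobenius kernel of the additive group $\mathbb{G}_a$; its group algebra $k\alpha_p=\mathcal{O}(\alpha_p)^*$ is isomorphic as a Hopf algebra to $k[x]/(x^p)$ with $x$ primitive. An associator for a commutative Hopf algebra $H$ is an invertible $\Phi\in H^{\otimes3}$ with $(\mathrm{id}\otimes\mathrm{id}\otimes\Delta)(\Phi)(\Delta\otimes\mathrm{id}\otimes\mathrm{id})(\Phi)=(1\otimes\Phi)(\mathrm{id}\otimes\Delta\otimes\mathrm{id})(\Phi)(\Phi\otimes1)$ and such that applying the counit to any tensor factor gives $1$; then $(H,\Phi)$ denotes $H$ with associator $\Phi$ viewed as a quasi-Hopf algebra. A pseudotwist for a quasi-Hopf algebra $H$ is an invertible $J\in H\otimes H$ with $(\varepsilon\otimes\mathrm{id})(J)=(\mathrm{id}\otimes\varepsilon)(J)=1$; it defines a quasi-Hopf algebra $H^J$ on the same algebra with $\Delta^J(h)=J^{-1}\Delta(h)J$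 and $\Phi^J=(1\otimes J^{-1})(\mathrm{id}\otimes\Delta)(J^{-1})\Phi(\Delta\otimes\mathrm{id})(J)(J\otimes1)$. Quasi-Hopf algebras $H,K$ are pseudotwist equivalent if $K\cong H^J$ as quasi-Hopf algebras for some pseudotwist $J$. An associator is trivial if the resulting quasi-Hopf algebra is pseudotwist equivalent to a Hopf algebra; for $k\alpha_p$ this means it is a coboundary. *)

theory Defs
  imports
    "HOL-Library.Poly_Mapping"
    "HOL-Computational_Algebra.Polynomial"
    "HOL-Algebra.RingHom"
begin

section \<open>Vector spaces and tensor products\<close>

text \<open>
  Since every vector space over a field has a basis, vector spaces are presented as spaces of
  finitely supported functions on a set \<open>B\<close>. In this presentation the tensor product of the
  spaces on \<open>B\<close> and \<open>C\<close> is the space on \<open>B \<times> C\<close>. Tensor powers are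
  nested to the right, and \<open>reassoc\<close> is the canonical isomorphism
  \<open>(U \<otimes> V) \<otimes> W \<rightarrow> U \<otimes> (V \<otimes> W)\<close>.
\<close>

definition free_space :: "'b set \<Rightarrow> ('b \<Rightarrow>\<^sub>0 'k::field) set" where
  "free_space B = {v. Poly_Mapping.keys v \<subseteq> B}"

definition scl :: "'k::field \<Rightarrow> ('b \<Rightarrow>\<^sub>0 'k) \<Rightarrow> ('b \<Rightarrow>\<^sub>0 'k)" where
  "scl c v = Poly_Mapping.map ((*) c) v"

lemma lookup_scl: "Poly_Mapping.lookup (scl c v) b = c * Poly_Mapping.lookup v b"
  unfolding scl_def by (simp add: Poly_Mapping.map.rep_eq when_def)

lemma vector_space_scl: "vector_space (scl :: 'k::field \<Rightarrow> ('b \<Rightarrow>\<^sub>0 'k) \<Rightarrow> ('b \<Rightarrow>\<^sub>0 'k))"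
  by unfold_locales (auto intro!: poly_mapping_eqI simp: lookup_scl lookup_add algebra_simps)

definition bvec :: "'b \<Rightarrow> ('b \<Rightarrow>\<^sub>0 'k::field)" where
  "bvec b = Poly_Mapping.single b 1"

definition lin_ext :: "('b \<Rightarrow> ('c \<Rightarrow>\<^sub>0 'k::field)) \<Rightarrow> ('b \<Rightarrow>\<^sub>0 'k) \<Rightarrow> ('c \<Rightarrow>\<^sub>0 'k)" where
  "lin_ext f v = (\<Sum>b\<in>Poly_Mapping.keys v. scl (Poly_Mapping.lookup v b) (f b))"

definition bil_ext ::
  "('a \<Rightarrow> 'b \<Rightarrow> ('c \<Rightarrow>\<^sub>0 'k::field)) \<Rightarrow> ('a \<Rightarrow>\<^sub>0 'k) \<Rightarrow> ('b \<Rightarrow>\<^sub>0 'k) \<Rightarrow> ('c \<Rightarrow>\<^sub>0 'k)" where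
  "bil_ext f u v = lin_ext (\<lambda>a. lin_ext (f a) v) u"

definition tens ::
  "('a \<Rightarrow>\<^sub>0 'k::field) \<Rightarrow> ('b \<Rightarrow>\<^sub>0 'k) \<Rightarrow> ('a \<times> 'b \<Rightarrow>\<^sub>0 'k)" (infixr \<open>\<boxtimes>\<close> 75) where
  "u \<boxtimes> v = bil_ext (\<lambda>a b. bvec (a, b)) u v"

definition tmap ::
  "(('a \<Rightarrow>\<^sub>0 'k::field) \<Rightarrow> ('c \<Rightarrow>\<^sub>0 'k)) \<Rightarrow> (('b \<Rightarrow>\<^sub>0 'k) \<Rightarrow> ('d \<Rightarrow>\<^sub>0 'k)) \<Rightarrow>
   ('a \<times> 'b \<Rightarrow>\<^sub>0 'k) \<Rightarrow> ('c \<times> 'd \<Rightarrow>\<^sub>0 'k)" where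
  "tmap f g = lin_ext (\<lambda>(a, b). f (bvec a) \<boxtimes> g (bvec b))"

definition reassoc :: "(('a \<times> 'b) \<times> 'c \<Rightarrow>\<^sub>0 'k::field) \<Rightarrow> ('a \<times> 'b \<times> 'c \<Rightarrow>\<^sub>0 'k)" where
  "reassoc = lin_ext (\<lambda>((a, b), c). bvec (a, b, c))"

definition flip :: "('a \<times> 'b \<Rightarrow>\<^sub>0 'k::field) \<Rightarrow> ('b \<times> 'a \<Rightarrow>\<^sub>0 'k)" where
  "flip = lin_ext (\<lambda>(a, b). bvec (b, a))"

text \<open>
  For a functional \<open>\<epsilon>\<close>, these are \<open>\<epsilon> \<otimes> id\<close> and
  \<open>id \<otimes> \<epsilon>\<close>, with \<open>k \<otimes> V\<close> and \<open>V \<otimes> k\<close>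
  identified with \<open>V\<close>.
\<close>

definition contr_left :: "(('a \<Rightarrow>\<^sub>0 'k::field) \<Rightarrow> 'k) \<Rightarrow> ('a \<times> 'b \<Rightarrow>\<^sub>0 'k) \<Rightarrow> ('b \<Rightarrow>\<^sub>0 'k)" where
  "contr_left \<epsilon> = lin_ext (\<lambda>(a, b). scl (\<epsilon> (bvec a)) (bvec b))"

definition contr_right :: "(('b \<Rightarrow>\<^sub>0 'k::field) \<Rightarrow> 'k) \<Rightarrow> ('a \<times> 'b \<Rightarrow>\<^sub>0 'k) \<Rightarrow> ('a \<Rightarrow>\<^sub>0 'k)" where
  "contr_right \<epsilon> = lin_ext (\<lambda>(a, b). scl (\<epsilon> (bvec b)) (bvec a))"

definition linear_between ::
  "'b set \<Rightarrow> 'c set \<Rightarrow> (('b \<Rightarrow>\<^sub>0 'k::field) \<Rightarrow> ('c \<Rightarrow>\<^sub>0 'k)) \<Rightarrow> bool" where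
  "linear_between B C f \<longleftrightarrow>
     (\<forall>u\<in>free_space B. f u \<in> free_space C) \<and>
     (\<forall>u\<in>free_space B. \<forall>v\<in>free_space B. f (u + v) = f u + f v) \<and>
     (\<forall>c. \<forall>u\<in>free_space B. f (scl c u) = scl c (f u))"


section \<open>Algebras\<close>

record (overloaded) ('b, 'k::zero) based_alg =
  basis :: "'b set"
  amult :: "('b \<Rightarrow>\<^sub>0 'k) \<Rightarrow> ('b \<Rightarrow>\<^sub>0 'k) \<Rightarrow> ('b \<Rightarrow>\<^sub>0 'k)"
  aone :: "'b \<Rightarrow>\<^sub>0 'k"

definition alg_ring :: "('b, 'k::field, 'z) based_alg_scheme \<Rightarrow> ('b \<Rightarrow>\<^sub>0 'k) ring" where
  "alg_ring A = \<lparr>carrier = free_space (basis A), mult = amult A, one = aone A,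
                  zero = 0, add = (+)\<rparr>"

definition k_algebra :: "('b, 'k::field, 'z) based_alg_scheme \<Rightarrow> bool" where
  "k_algebra A \<longleftrightarrow> ring (alg_ring A) \<and>
     (\<forall>c. \<forall>u\<in>free_space (basis A). \<forall>v\<in>free_space (basis A).
        amult A (scl c u) v = scl c (amult A u v) \<and>
        amult A u (scl c v) = scl c (amult A u v))"

definition alg_hom ::
  "('b, 'k::field, 'z) based_alg_scheme \<Rightarrow> ('c, 'k, 'y) based_alg_scheme \<Rightarrow>
   (('b \<Rightarrow>\<^sub>0 'k) \<Rightarrow> ('c \<Rightarrow>\<^sub>0 'k)) \<Rightarrow> bool" where
  "alg_hom A C f \<longleftrightarrow> linear_between (basis A) (basis C) f \<and>
     f \<in> ring_hom (alg_ring A) (alg_ring C)"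

definition alg_character ::
  "('b, 'k::field, 'z) based_alg_scheme \<Rightarrow> (('b \<Rightarrow>\<^sub>0 'k) \<Rightarrow> 'k) \<Rightarrow> bool" where
  "alg_character A \<epsilon> \<longleftrightarrow> \<epsilon> (aone A) = 1 \<and>
     (\<forall>u\<in>free_space (basis A). \<forall>v\<in>free_space (basis A).
        \<epsilon> (u + v) = \<epsilon> u + \<epsilon> v \<and> \<epsilon> (amult A u v) = \<epsilon> u * \<epsilon> v) \<and>
     (\<forall>c. \<forall>u\<in>free_space (basis A). \<epsilon> (scl c u) = c * \<epsilon> u)"

definition tensor_alg ::
  "('b, 'k::field, 'z) based_alg_scheme \<Rightarrow> ('c, 'k, 'y) based_alg_scheme \<Rightarrow>
   ('b \<times> 'c, 'k) based_alg" where
  "tensor_alg A C =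
     \<lparr>basis = basis A \<times> basis C,
      amult = bil_ext (\<lambda>(a, c) (a', c').
                amult A (bvec a) (bvec a') \<boxtimes> amult C (bvec c) (bvec c')),
      aone = aone A \<boxtimes> aone C\<rparr>"

abbreviation alg2 :: "('b, 'k::field, 'z) based_alg_scheme \<Rightarrow> ('b \<times> 'b, 'k) based_alg" where
  "alg2 A \<equiv> tensor_alg A A"

abbreviation alg3 :: "('b, 'k::field, 'z) based_alg_scheme \<Rightarrow> ('b \<times> 'b \<times> 'b, 'k) based_alg" where
  "alg3 A \<equiv> tensor_alg A (alg2 A)"

abbreviation alg4 ::
  "('b, 'k::field, 'z) based_alg_scheme \<Rightarrow> ('b \<times> 'b \<times> 'b \<times> 'b, 'k) based_alg" where
  "alg4 A \<equiv> tensor_alg A (alg3 A)"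

abbreviation ainv :: "('b, 'k::field, 'z) based_alg_scheme \<Rightarrow> ('b \<Rightarrow>\<^sub>0 'k) \<Rightarrow> ('b \<Rightarrow>\<^sub>0 'k)" where
  "ainv A u \<equiv> inv\<^bsub>alg_ring A\<^esub> u"

definition alg_dim :: "('b, 'k::field, 'z) based_alg_scheme \<Rightarrow> nat" where
  "alg_dim A = vector_space.dim scl (free_space (basis A) :: ('b \<Rightarrow>\<^sub>0 'k) set)"

definition left_ideal :: "'a set \<Rightarrow> ('a, 'm) ring_scheme \<Rightarrow> bool" where
  "left_ideal I R \<longleftrightarrow> additive_subgroup I R \<and>
     (\<forall>r\<in>carrier R. \<forall>x\<in>I. r \<otimes>\<^bsub>R\<^esub> x \<in> I)"

definition maximal_left_ideal :: "'a set \<Rightarrow> ('a, 'm) ring_scheme \<Rightarrow> bool" where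
  "maximal_left_ideal I R \<longleftrightarrow> left_ideal I R \<and> I \<noteq> carrier R \<and>
     (\<forall>L. left_ideal L R \<and> I \<subseteq> L \<longrightarrow> L = I \<or> L = carrier R)"

definition local_algebra :: "('b, 'k::field, 'z) based_alg_scheme \<Rightarrow> bool" where
  "local_algebra A \<longleftrightarrow> (\<exists>!I. maximal_left_ideal I (alg_ring A))"


section \<open>Quasi-Hopf algebras\<close>

text \<open>A Hopf algebra is such a record with \<open>assoc_elt = 1 \<otimes> 1 \<otimes> 1\<close>.\<close>

record (overloaded) ('b, 'k::zero) quasi_alg = "('b, 'k) based_alg" +
  comult :: "('b \<Rightarrow>\<^sub>0 'k) \<Rightarrow> ('b \<times> 'b \<Rightarrow>\<^sub>0 'k)"
  counit :: "('b \<Rightarrow>\<^sub>0 'k) \<Rightarrow> 'k"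
  assoc_elt :: "'b \<times> 'b \<times> 'b \<Rightarrow>\<^sub>0 'k"

text \<open>
  The map \<open>\<Delta> \<otimes> id\<close> on \<open>H \<otimes> V\<close>; for
  \<open>V = H \<otimes> H\<close> it is \<open>\<Delta> \<otimes> id \<otimes> id\<close>.
\<close>

definition comult_id ::
  "('b, 'k::field) quasi_alg \<Rightarrow> ('b \<times> 'c \<Rightarrow>\<^sub>0 'k) \<Rightarrow> ('b \<times> 'b \<times> 'c \<Rightarrow>\<^sub>0 'k)" where
  "comult_id H u = reassoc (tmap (comult H) id u)"

definition pentagon :: "('b, 'k::field) quasi_alg \<Rightarrow> ('b \<times> 'b \<times> 'b \<Rightarrow>\<^sub>0 'k) \<Rightarrow> bool" where
  "pentagon H \<Phi> \<longleftrightarrow>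
     amult (alg4 H) (tmap id (tmap id (comult H)) \<Phi>) (comult_id H \<Phi>) =
     amult (alg4 H) (amult (alg4 H) (aone H \<boxtimes> \<Phi>) (tmap id (comult_id H) \<Phi>))
                    (tmap id reassoc (reassoc (\<Phi> \<boxtimes> aone H)))"

definition quasi_bialgebra :: "('b, 'k::field) quasi_alg \<Rightarrow> bool" where
  "quasi_bialgebra H \<longleftrightarrow>
     k_algebra H \<and> alg_hom H (alg2 H) (comult H) \<and> alg_character H (counit H) \<and>
     (\<forall>h\<in>free_space (basis H).
        contr_left (counit H) (comult H h) = h \<and> contr_right (counit H) (comult H h) = h) \<and>
     assoc_elt H \<in> Units (alg_ring (alg3 H)) \<and>
     (\<forall>h\<in>free_space (basis H).
        tmap id (comult H) (comult H h) =
        amult (alg3 H) (amult (alg3 H) (assoc_elt H) (comult_id H (comult H h)))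
                       (ainv (alg3 H) (assoc_elt H))) \<and>
     pentagon H (assoc_elt H) \<and>
     tmap id (contr_left (counit H)) (assoc_elt H) = aone (alg2 H)"

definition quasi_antipode ::
  "('b, 'k::field) quasi_alg \<Rightarrow> (('b \<Rightarrow>\<^sub>0 'k) \<Rightarrow> ('b \<Rightarrow>\<^sub>0 'k)) \<Rightarrow>
   ('b \<Rightarrow>\<^sub>0 'k) \<Rightarrow> ('b \<Rightarrow>\<^sub>0 'k) \<Rightarrow> bool" where
  "quasi_antipode H S \<alpha> \<beta> \<longleftrightarrow>
     linear_between (basis H) (basis H) S \<and> S (aone H) = aone H \<and>
     (\<forall>u\<in>free_space (basis H). \<forall>v\<in>free_space (basis H).
        S (amult H u v) = amult H (S v) (S u)) \<and>
     \<alpha> \<in> free_space (basis H) \<and> \<beta> \<in> free_space (basis H) \<and>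
     (\<forall>h\<in>free_space (basis H).
        lin_ext (\<lambda>(a, b). amult H (amult H (S (bvec a)) \<alpha>) (bvec b)) (comult H h) =
          scl (counit H h) \<alpha> \<and>
        lin_ext (\<lambda>(a, b). amult H (amult H (bvec a) \<beta>) (S (bvec b))) (comult H h) =
          scl (counit H h) \<beta>) \<and>
     lin_ext (\<lambda>(a, b, c). amult H (amult H (amult H (amult H
         (bvec a) \<beta>) (S (bvec b))) \<alpha>) (bvec c)) (assoc_elt H) = aone H \<and>
     lin_ext (\<lambda>(a, b, c). amult H (amult H (amult H (amult H
         (S (bvec a)) \<alpha>) (bvec b)) \<beta>) (S (bvec c))) (ainv (alg3 H) (assoc_elt H)) = aone H"

text \<open>
  The antipode \<open>(S, \<alpha>, \<beta>)\<close> is determined by the remaining data up to an invertible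
  element of \<open>H\<close>; its existence is a property, and isomorphisms are those of
  quasi-bialgebras.
\<close>

definition quasi_hopf_algebra :: "('b, 'k::field) quasi_alg \<Rightarrow> bool" where
  "quasi_hopf_algebra H \<longleftrightarrow> quasi_bialgebra H \<and>
     (\<exists>S \<alpha> \<beta>. quasi_antipode H S \<alpha> \<beta> \<and>
        bij_betw S (free_space (basis H)) (free_space (basis H)))"

definition hopf_algebra :: "('b, 'k::field) quasi_alg \<Rightarrow> bool" where
  "hopf_algebra H \<longleftrightarrow> quasi_bialgebra H \<and> assoc_elt H = aone (alg3 H) \<and>
     (\<exists>S. linear_between (basis H) (basis H) S \<and>
        (\<forall>h\<in>free_space (basis H).
           lin_ext (\<lambda>(a, b). amult H (S (bvec a)) (bvec b)) (comult H h) =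
             scl (counit H h) (aone H) \<and>
           lin_ext (\<lambda>(a, b). amult H (bvec a) (S (bvec b))) (comult H h) =
             scl (counit H h) (aone H)))"

definition commutative_alg :: "('b, 'k::field, 'z) based_alg_scheme \<Rightarrow> bool" where
  "commutative_alg A \<longleftrightarrow>
     (\<forall>u\<in>free_space (basis A). \<forall>v\<in>free_space (basis A). amult A u v = amult A v u)"

definition cocommutative :: "('b, 'k::field) quasi_alg \<Rightarrow> bool" where
  "cocommutative H \<longleftrightarrow> (\<forall>h\<in>free_space (basis H). flip (comult H h) = comult H h)"

definition quasi_hopf_iso ::
  "('b, 'k::field) quasi_alg \<Rightarrow> ('c, 'k) quasi_alg \<Rightarrow> (('b \<Rightarrow>\<^sub>0 'k) \<Rightarrow> ('c \<Rightarrow>\<^sub>0 'k)) \<Rightarrow> bool" where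
  "quasi_hopf_iso H K f \<longleftrightarrow> alg_hom H K f \<and>
     bij_betw f (free_space (basis H)) (free_space (basis K)) \<and>
     (\<forall>h\<in>free_space (basis H).
        comult K (f h) = tmap f f (comult H h) \<and> counit K (f h) = counit H h) \<and>
     tmap f (tmap f f) (assoc_elt H) = assoc_elt K"

definition pseudotwist :: "('b, 'k::field) quasi_alg \<Rightarrow> ('b \<times> 'b \<Rightarrow>\<^sub>0 'k) \<Rightarrow> bool" where
  "pseudotwist H J \<longleftrightarrow> J \<in> Units (alg_ring (alg2 H)) \<and>
     contr_left (counit H) J = aone H \<and> contr_right (counit H) J = aone H"

definition twist :: "('b, 'k::field) quasi_alg \<Rightarrow> ('b \<times> 'b \<Rightarrow>\<^sub>0 'k) \<Rightarrow> ('b, 'k) quasi_alg" where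
  "twist H J = (let J' = ainv (alg2 H) J; m2 = amult (alg2 H); m3 = amult (alg3 H) in
     H\<lparr>comult := (\<lambda>h. m2 (m2 J' (comult H h)) J),
       assoc_elt :=
         m3 (m3 (m3 (m3 (aone H \<boxtimes> J') (tmap id (comult H) J')) (assoc_elt H))
                (comult_id H J)) (reassoc (J \<boxtimes> aone H))\<rparr>)"

definition pseudotwist_equivalent ::
  "('b, 'k::field) quasi_alg \<Rightarrow> ('c, 'k) quasi_alg \<Rightarrow> bool" where
  "pseudotwist_equivalent H K \<longleftrightarrow>
     (\<exists>J f. pseudotwist H J \<and> quasi_hopf_iso K (twist H J) f)"

text \<open>The following three notions are meant for a commutative Hopf algebra \<open>H\<close>.\<close>

definition associator :: "('b, 'k::field) quasi_alg \<Rightarrow> ('b \<times> 'b \<times> 'b \<Rightarrow>\<^sub>0 'k) \<Rightarrow> bool" where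
  "associator H \<Phi> \<longleftrightarrow> \<Phi> \<in> Units (alg_ring (alg3 H)) \<and> pentagon H \<Phi> \<and>
     contr_left (counit H) \<Phi> = aone (alg2 H) \<and>
     tmap id (contr_left (counit H)) \<Phi> = aone (alg2 H) \<and>
     tmap id (contr_right (counit H)) \<Phi> = aone (alg2 H)"

definition with_associator ::
  "('b, 'k::field) quasi_alg \<Rightarrow> ('b \<times> 'b \<times> 'b \<Rightarrow>\<^sub>0 'k) \<Rightarrow> ('b, 'k) quasi_alg" where
  "with_associator H \<Phi> = H\<lparr>assoc_elt := \<Phi>\<rparr>"

text \<open>
  A Hopf algebra equivalent to \<open>(H, \<Phi>)\<close> is linearly isomorphic to \<open>H\<close>, so it can be
  transported to the basis of \<open>H\<close>; hence it suffices to let \<open>K\<close> range over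
  the Hopf algebras with basis elements of the same type.
\<close>

definition trivial_associator ::
  "('b, 'k::field) quasi_alg \<Rightarrow> ('b \<times> 'b \<times> 'b \<Rightarrow>\<^sub>0 'k) \<Rightarrow> bool" where
  "trivial_associator H \<Phi> \<longleftrightarrow>
     (\<exists>K :: ('b, 'k) quasi_alg. hopf_algebra K \<and>
        pseudotwist_equivalent (with_associator H \<Phi>) K)"


section \<open>The group algebra of \<open>\<alpha>\<^sub>p\<close>\<close>

text \<open>
  The basis vector \<open>bvec i\<close> is \<open>x\<^sup>i\<close> in \<open>k[x]/(x\<^sup>p)\<close>. As \<open>x\<close> is primitive,
  the coproduct of \<open>x\<^sup>n\<close> is \<open>(x \<otimes> 1 + 1 \<otimes> x)\<^sup>n\<close>.
\<close>

definition kalpha :: "nat \<Rightarrow> (nat, 'k::field) quasi_alg" where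
  "kalpha p =
     \<lparr>basis = {..<p},
      amult = bil_ext (\<lambda>i j. if i + j < p then bvec (i + j) else 0),
      aone = bvec 0,
      comult = lin_ext (\<lambda>n. \<Sum>i\<le>n. scl (of_nat (n choose i)) (bvec i \<boxtimes> bvec (n - i))),
      counit = (\<lambda>v. Poly_Mapping.lookup v 0),
      assoc_elt = bvec 0 \<boxtimes> bvec 0 \<boxtimes> bvec 0\<rparr>"

lemma kalpha_x_primitive:
  "comult (kalpha p) (bvec 1) = bvec 1 \<boxtimes> aone (kalpha p) + aone (kalpha p) \<boxtimes> bvec 1"
  by (simp add: kalpha_def lin_ext_def bvec_def add.commute
      vector_space.vector_space_assms(4)[OF vector_space_scl])

definition Phi :: "nat \<Rightarrow> (nat \<times> nat \<times> nat \<Rightarrow>\<^sub>0 'k::field)" where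
  "Phi p = bvec 0 \<boxtimes> bvec 0 \<boxtimes> bvec 0 +
     (\<Sum>i = 1..p - 1. scl (1 / of_nat i * of_nat ((p - 1) choose (i - 1)))
        (bvec 1 \<boxtimes> bvec i \<boxtimes> bvec (p - i)))"

end

theory Submission
  imports Defs "HOL-Library.Product_Plus"
begin

text \<open>
  Tensor powers of \<open>k\<alpha>\<^sub>p\<close> are truncated polynomial rings, on which the coproduct is the substitution
  \<open>x \<mapsto> x + y\<close>; an associator is then a normalized multiplicative 3-cocycle \<open>\<Phi>(x, y, z)\<close>, and the
  pseudotwist by \<open>J\<close> multiplies it by the coboundary of \<open>J\<close>. The class of a cocycle is its coefficient
  at \<open>x y\<^bsup>p-1\<^esup> z\<close>. It is invariant: modulo \<open>x\<^sup>2\<close> and \<open>z\<^sup>2\<close> a coboundary changes \<open>\<Phi>\<close> by \<open>x z u(y)\<close> with \<open>u\<close>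
  a derivative, and \<open>y\<^bsup>p-1\<^esup>\<close> is not a derivative in characteristic \<open>p\<close>. It is complete: if two
  cocycles with the same coefficient agree up to a coboundary below degree \<open>d\<close>, then the degree \<open>d\<close> part \<open>e\<close>
  of their difference is an additive cocycle, which is the coboundary of the cochain whose coefficient at
  \<open>x\<^sup>a y\<^sup>c\<close> is \<open>e(1, a-1, c) / a\<close>. The automorphism \<open>x \<mapsto> l x\<close> multiplies the
  coefficient of \<open>\<Phi>\<close> by \<open>l\<^bsup>p+1\<^esup>\<close>, so that over an algebraically closed field all non-trivial
  classes are equivalent.
\<close>

section \<open>Linear maps and polynomial rings\<close>

text \<open>Truncation is postponed: computations take place in honest polynomial rings modulo
  monomial ideals, where the structure maps become substitutions that compose freely. This is
  legitimate because x -> x + y preserves the truncation ideal: binom(a+b, a) vanishes mod p when a,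
  b < p <= a + b. Inverses are cleared from the twist relation, leaving products of polynomials with
  constant term 1. To lowest order in total degree such products behave additively, so the
  multiplicative problem becomes linear, one degree at a time. The correcting cochain divides by a,
  which fails exactly at a = p, that is at the coefficients of x y^(p-1) z^c. The cocycle identity
  kills these for 1 < c < p; for c = 1 the coefficient is the invariant itself. The pentagon for
  \<open>Phi p\<close> does not follow formally from x sigma(y, z) being an additive cocycle: terms
  quadratic in sigma have degree 2p + 2 and can survive truncation in four variables. They cancel
  because sigma(x, y+z) sigma(y, z) = sigma(x+y, z) sigma(x, y), which comes down to Vandermonde's
  identity.\<close>

abbreviation coef :: "('b \<Rightarrow>\<^sub>0 'k::zero) \<Rightarrow> 'b \<Rightarrow> 'k" where
  "coef \<equiv> Poly_Mapping.lookup"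

definition lin :: "(('b \<Rightarrow>\<^sub>0 'k::field) \<Rightarrow> ('c \<Rightarrow>\<^sub>0 'k)) \<Rightarrow> bool" where
  "lin f \<longleftrightarrow> (\<forall>u v. f (u + v) = f u + f v) \<and> (\<forall>c u. f (scl c u) = scl c (f u))"

lemma coef_bvec: "coef (bvec b) c = (if b = c then 1 else 0)"
  by (simp add: bvec_def lookup_single when_def)

lemma scl_0 [simp]: "scl c 0 = 0" "scl 0 v = 0"
  by (auto intro!: poly_mapping_eqI simp: lookup_scl)

lemma scl_1 [simp]: "scl 1 v = v"
  by (auto intro!: poly_mapping_eqI simp: lookup_scl)

lemma scl_scl: "scl c (scl d v) = scl (c * d) v"
  by (auto intro!: poly_mapping_eqI simp: lookup_scl)

lemma scl_add: "scl c (u + v) = scl c u + scl c v"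
  by (auto intro!: poly_mapping_eqI simp: lookup_scl lookup_add algebra_simps)

lemma scl_add_left: "scl (c + d) v = scl c v + scl d v"
  by (auto intro!: poly_mapping_eqI simp: lookup_scl lookup_add algebra_simps)

lemma scl_sum: "scl c (sum f A) = (\<Sum>a\<in>A. scl c (f a))"
  by (auto intro!: poly_mapping_eqI simp: lookup_scl lookup_sum sum_distrib_left)

lemma scl_mult_left: "scl c (u :: 'b::comm_monoid_add \<Rightarrow>\<^sub>0 'k::field) * v = scl c (u * v)"
  by (simp add: scl_def mult_map_scale_conv_mult mult.assoc)

lemma scl_mult_right: "(u :: 'b::comm_monoid_add \<Rightarrow>\<^sub>0 'k::field) * scl c v = scl c (u * v)"
  by (simp add: scl_def mult_map_scale_conv_mult mult.left_commute)

lemma expand_bvec: "v = (\<Sum>b\<in>Poly_Mapping.keys v. scl (coef v b) (bvec b))"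
  by (rule poly_mapping_eqI)
     (auto simp: lookup_sum lookup_scl coef_bvec if_distrib in_keys_iff cong: if_cong)

lemma lin_ext_superset:
  assumes "finite A" "Poly_Mapping.keys v \<subseteq> A"
  shows "lin_ext f v = (\<Sum>b\<in>A. scl (coef v b) (f b))"
  unfolding lin_ext_def
  by (rule sum.mono_neutral_left) (use assms in \<open>auto simp: in_keys_iff\<close>)

lemma lin_lin_ext [simp]: "lin (lin_ext f)"
  unfolding lin_def
proof safe
  fix u v :: "'a \<Rightarrow>\<^sub>0 'b"
  let ?A = "Poly_Mapping.keys u \<union> Poly_Mapping.keys v"
  have "lin_ext f (u + v) = (\<Sum>b\<in>?A. scl (coef (u + v) b) (f b))"
    by (rule lin_ext_superset) (use keys_add[of u v] in auto)
  also have "\<dots> = lin_ext f u + lin_ext f v"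
    by (simp add: lin_ext_superset[of ?A u] lin_ext_superset[of ?A v] lookup_add scl_add_left
        sum.distrib)
  finally show "lin_ext f (u + v) = lin_ext f u + lin_ext f v" .
next
  fix c and u :: "'a \<Rightarrow>\<^sub>0 'b"
  have "lin_ext f (scl c u) = (\<Sum>b\<in>Poly_Mapping.keys u. scl (coef (scl c u) b) (f b))"
    by (rule lin_ext_superset) (auto simp: in_keys_iff lookup_scl)
  thus "lin_ext f (scl c u) = scl c (lin_ext f u)"
    by (simp add: lin_ext_def scl_sum scl_scl lookup_scl)
qed

lemma lin_add: "lin f \<Longrightarrow> f (u + v) = f u + f v"
  and lin_scl: "lin f \<Longrightarrow> f (scl c u) = scl c (f u)"
  by (simp_all add: lin_def)

lemma lin_0: "lin f \<Longrightarrow> f 0 = 0"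
  using lin_scl[of f 0 0] by simp

lemma lin_minus: "lin f \<Longrightarrow> f (- u) = - f u"
  using lin_add[of f u "- u"] by (simp add: lin_0 eq_neg_iff_add_eq_0 add.commute)

lemma lin_diff: "lin f \<Longrightarrow> f (u - v) = f u - f v"
  using lin_add[of f u "- v"] by (simp add: lin_minus)

lemma lin_sum: "lin f \<Longrightarrow> f (sum g A) = (\<Sum>a\<in>A. f (g a))"
  by (induction A rule: infinite_finite_induct) (auto simp: lin_0 lin_add)

lemma lin_expand: "lin f \<Longrightarrow> f v = lin_ext (\<lambda>b. f (bvec b)) v"
  using arg_cong[OF expand_bvec[of v], of f] by (simp add: lin_sum lin_scl lin_ext_def)

lemma lin_eqI: "lin f \<Longrightarrow> lin g \<Longrightarrow> (\<And>b. f (bvec b) = g (bvec b)) \<Longrightarrow> f v = g v"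
  using lin_expand[of f v] lin_expand[of g v] by simp

lemma lin_ext_bvec [simp]: "lin_ext f (bvec b) = f b"
  by (simp add: lin_ext_def bvec_def)

lemma lin_id [simp]: "lin id" "lin (\<lambda>v. v)"
  by (auto simp: lin_def)

lemma lin_comp: "lin f \<Longrightarrow> lin g \<Longrightarrow> lin (\<lambda>v. f (g v))"
  by (auto simp: lin_def)

lemma lin_times [simp]:
  "lin (\<lambda>v. (u :: 'b::comm_monoid_add \<Rightarrow>\<^sub>0 'k::field) * v)"
  "lin (\<lambda>v. v * (u :: 'b::comm_monoid_add \<Rightarrow>\<^sub>0 'k::field))"
  by (auto simp: lin_def algebra_simps scl_mult_left scl_mult_right)

lemma lin_ext_cong: "(\<And>b. b \<in> Poly_Mapping.keys v \<Longrightarrow> f b = g b) \<Longrightarrow> lin_ext f v = lin_ext g v"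
  by (simp add: lin_ext_def)

lemma coef_lin_ext: "coef (lin_ext f v) c = (\<Sum>b\<in>Poly_Mapping.keys v. coef v b * coef (f b) c)"
  by (simp add: lin_ext_def lookup_sum lookup_scl)

lemma lin_ext_id: "lin_ext bvec v = v"
  using lin_expand[of id v] by simp

lemma bvec_mult: "bvec a * bvec b = bvec (a + b)"
  by (simp add: bvec_def mult_single)

lemma bvec_0: "bvec 0 = 1"
  by (simp add: bvec_def)

text \<open>Links the products of the algebras, given on basis vectors, to the monoid algebra
  product of \<open>poly_mapping\<close>; in the applications \<open>T\<close> is
  truncation.\<close>

lemma bil_ext_eqI:
  fixes u v :: "'b::comm_monoid_add \<Rightarrow>\<^sub>0 'k::field"
  assumes "\<And>a b. f a b = T (bvec (a + b))" "lin T"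
  shows "bil_ext f u v = T (u * v)"
proof -
  have "bil_ext f u v = lin_ext (\<lambda>a. T (bvec a * v)) u"
    unfolding bil_ext_def
  proof (rule lin_ext_cong)
    fix a
    show "lin_ext (f a) v = T (bvec a * v)"
      by (rule lin_eqI[of _ "\<lambda>v. T (bvec a * v)"])
         (simp_all add: assms(1) bvec_mult lin_comp[OF assms(2) lin_times(1)])
  qed
  also have "\<dots> = T (u * v)"
    by (rule lin_eqI[of _ "\<lambda>u. T (u * v)"]) (simp_all add: lin_comp[OF assms(2) lin_times(2)])
  finally show ?thesis .
qed

section \<open>Homomorphisms and coefficients in polynomial rings\<close>

definition poly_hom ::
  "(('b::comm_monoid_add \<Rightarrow>\<^sub>0 'k::field) \<Rightarrow> ('c::comm_monoid_add \<Rightarrow>\<^sub>0 'k)) \<Rightarrow> bool" where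
  "poly_hom f \<longleftrightarrow> lin f \<and> (\<forall>u v. f (u * v) = f u * f v) \<and> f 1 = 1"

lemma poly_homD:
  assumes "poly_hom f"
  shows "lin f" "f (u * v) = f u * f v" "f 1 = 1" "f (u ^ n) = f u ^ n"
    "f (u + v) = f u + f v" "f (u - v) = f u - f v" "f (scl c u) = scl c (f u)" "f 0 = 0"
proof -
  show f: "lin f" "f (u * v) = f u * f v" "f 1 = 1" for u v
    using assms by (auto simp: poly_hom_def)
  show "f (u ^ n) = f u ^ n" by (induction n) (auto simp: f)
  show "f (u + v) = f u + f v" "f (u - v) = f u - f v" "f (scl c u) = scl c (f u)" "f 0 = 0"
    using f(1) by (auto simp: lin_add lin_diff lin_scl lin_0)
qed

lemma poly_hom_lin_ext:
  assumes "\<And>a b. F (a + b) = F a * F b" "F 0 = 1"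
  shows "poly_hom (lin_ext F)"
proof -
  have "lin_ext F (u * v) = lin_ext F u * lin_ext F v" for u v
  proof (rule lin_eqI[of "\<lambda>u. lin_ext F (u * v)" "\<lambda>u. lin_ext F u * lin_ext F v"])
    fix a show "lin_ext F (bvec a * v) = lin_ext F (bvec a) * lin_ext F v"
      by (rule lin_eqI[of "\<lambda>v. lin_ext F (bvec a * v)" "\<lambda>v. lin_ext F (bvec a) * lin_ext F v"])
         (simp_all add: bvec_mult assms lin_comp[OF lin_lin_ext lin_times(1)]
           lin_comp[OF lin_times(1) lin_lin_ext])
  qed (simp_all add: lin_comp[OF lin_lin_ext lin_times(2)] lin_comp[OF lin_times(2) lin_lin_ext])
  moreover have "lin_ext F 1 = 1"
    using lin_ext_bvec[of F 0] assms by (simp add: bvec_0)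
  ultimately show ?thesis by (simp add: poly_hom_def)
qed

lemma coef_times:
  fixes k :: "'b::comm_monoid_add" and f g :: "'b \<Rightarrow>\<^sub>0 'k::field"
  assumes "finite D" and D: "\<And>a b. (a, b) \<in> D \<longleftrightarrow> a + b = k"
  shows "coef (f * g) k = (\<Sum>(a, b)\<in>D. coef f a * coef g b)"
proof -
  \<comment> \<open>Both coefficient functionals are packed as vectors over the one-point basis, so
    that \<open>lin_eqI\<close> reduces their equality to basis vectors.\<close>
  define S where "S f g = Poly_Mapping.single () (\<Sum>(a, b)\<in>D. coef f a * coef g b)"
    for f g :: "'b \<Rightarrow>\<^sub>0 'k"
  define L where "L f = Poly_Mapping.single () (coef f k)" for f :: "'b \<Rightarrow>\<^sub>0 'k"
  have L: "lin L"
    unfolding lin_def L_def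
    by (auto intro!: poly_mapping_eqI simp: lookup_add lookup_scl lookup_single)
  have S1: "lin (\<lambda>f. S f g)" for g
    unfolding lin_def S_def
    by (auto intro!: poly_mapping_eqI simp: lookup_add lookup_scl lookup_single algebra_simps
        sum.distrib sum_distrib_left case_prod_beta)
  have S2: "lin (\<lambda>g. S f g)" for f
    unfolding lin_def S_def
    by (auto intro!: poly_mapping_eqI simp: lookup_add lookup_scl lookup_single algebra_simps
        sum.distrib sum_distrib_left case_prod_beta)
  have "L (f * g) = S f g"
  proof (rule lin_eqI[of "\<lambda>f. L (f * g)" "\<lambda>f. S f g"])
    fix a
    show "L (bvec a * g) = S (bvec a) g"
    proof (rule lin_eqI[of "\<lambda>g. L (bvec a * g)" "\<lambda>g. S (bvec a) g"])
      fix b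
      have "(\<Sum>(a', b')\<in>D. coef (bvec a) a' * coef (bvec b) b') =
            (\<Sum>x\<in>D. if x = (a, b) then 1 else (0 :: 'k))"
        by (rule sum.cong) (auto simp: coef_bvec split: if_splits)
      also have "\<dots> = (if a + b = k then 1 else 0)"
        using assms(1) D[of a b] by simp
      finally show "L (bvec a * bvec b) = S (bvec a) (bvec b)"
        by (simp add: L_def S_def bvec_mult coef_bvec)
    qed (simp_all add: lin_comp[OF L lin_times(1)] S2)
  qed (simp_all add: lin_comp[OF L lin_times(2)] S1)
  from arg_cong[OF this, of "\<lambda>h. coef h ()"] show ?thesis by (simp add: L_def S_def)
qed

lemma coef_times_nat:
  "coef (f * g) n = (\<Sum>i\<le>n. coef f i * coef g (n - i))" for f g :: "nat \<Rightarrow>\<^sub>0 'k::field"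
proof -
  have "coef (f * g) n = (\<Sum>(a, b)\<in>(\<lambda>i. (i, n - i)) ` {..n}. coef f a * coef g b)"
    by (rule coef_times) (auto simp: image_iff)
  thus ?thesis by (subst (asm) sum.reindex) (auto simp: inj_on_def)
qed

lemma coef_times_triple:
  fixes f g :: "nat \<times> nat \<times> nat \<Rightarrow>\<^sub>0 'k::field"
  shows "coef (f * g) (a, b, c) =
    (\<Sum>i\<le>a. \<Sum>j\<le>b. \<Sum>l\<le>c. coef f (i, j, l) * coef g (a - i, b - j, c - l))"
proof -
  let ?h = "\<lambda>(i, j, l). ((i, j, l), (a - i, b - j, c - l))"
  have "coef (f * g) (a, b, c) = (\<Sum>(u, v)\<in>?h ` ({..a} \<times> {..b} \<times> {..c}). coef f u * coef g v)"
    by (rule coef_times) (auto simp: image_iff)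
  also have "\<dots> = (\<Sum>(i, j, l)\<in>{..a} \<times> {..b} \<times> {..c}. coef f (i, j, l) * coef g (a - i, b - j, c - l))"
    by (subst sum.reindex) (auto simp: inj_on_def case_prod_beta)
  finally show ?thesis by (simp add: sum.cartesian_product)
qed

lemma coef_tens [simp]: "coef (u \<boxtimes> v) (a, b) = coef u a * coef v b"
  unfolding tens_def bil_ext_def
proof -
  have "coef (lin_ext (\<lambda>a. lin_ext (\<lambda>b. bvec (a, b)) v) u) (a, b) =
        (\<Sum>i\<in>Poly_Mapping.keys u. \<Sum>j\<in>Poly_Mapping.keys v.
           if i = a then if j = b then coef u i * coef v j else 0 else 0)"
    unfolding coef_lin_ext sum_distrib_left by (intro sum.cong) (auto simp: coef_bvec)
  also have "\<dots> = (\<Sum>i\<in>Poly_Mapping.keys u. if i = a then coef u a * coef v b else 0)"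
    by (intro sum.cong) (auto simp: in_keys_iff)
  also have "\<dots> = coef u a * coef v b" by (auto simp: in_keys_iff)
  finally show "coef (lin_ext (\<lambda>a. lin_ext (\<lambda>b. bvec (a, b)) v) u) (a, b) = coef u a * coef v b" .
qed

lemma tens_bvec: "bvec a \<boxtimes> bvec b = bvec (a, b)"
  by (rule poly_mapping_eqI) (auto simp: coef_bvec split: prod.splits if_splits)

lemma lin_tens [simp]: "lin (\<lambda>u. u \<boxtimes> v)" "lin (\<lambda>v. u \<boxtimes> v)"
  unfolding lin_def
  by (auto intro!: poly_mapping_eqI simp: lookup_add lookup_scl algebra_simps)

lemma tens_mult:
  fixes u u' :: "'a::comm_monoid_add \<Rightarrow>\<^sub>0 'c::field" and v v' :: "'b::comm_monoid_add \<Rightarrow>\<^sub>0 'c"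
  shows "(u \<boxtimes> v) * (u' \<boxtimes> v') = (u * u') \<boxtimes> (v * v')"
proof -
  \<comment> \<open>The embeddings \<open>u \<boxtimes> 1\<close> and
    \<open>1 \<boxtimes> v\<close>: a pure tensor is the product of their images, and commutativity
    of the big polynomial ring gives the rule.\<close>
  define F where "F = lin_ext (\<lambda>a::'a. bvec (a, 0::'b) :: _ \<Rightarrow>\<^sub>0 'c)"
  define G where "G = lin_ext (\<lambda>b::'b. bvec (0::'a, b) :: _ \<Rightarrow>\<^sub>0 'c)"
  have F: "poly_hom F" unfolding F_def by (rule poly_hom_lin_ext) (auto simp: bvec_mult bvec_0 zero_prod_def[symmetric])
  have G: "poly_hom G" unfolding G_def by (rule poly_hom_lin_ext) (auto simp: bvec_mult bvec_0 zero_prod_def[symmetric])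
  have *: "u \<boxtimes> v = F u * G v" for u :: "'a \<Rightarrow>\<^sub>0 'c" and v
  proof (rule lin_eqI[of "\<lambda>u. u \<boxtimes> v" "\<lambda>u. F u * G v"])
    fix a
    show "bvec a \<boxtimes> v = F (bvec a) * G v"
      by (rule lin_eqI[of "\<lambda>v. bvec a \<boxtimes> v" "\<lambda>v. F (bvec a) * G v"])
         (simp_all add: F_def G_def tens_bvec bvec_mult lin_comp[OF lin_times(1) lin_lin_ext])
  qed (simp_all add: F_def lin_comp[OF lin_times(2) lin_lin_ext])
  show ?thesis by (simp add: * poly_homD(2)[OF F] poly_homD(2)[OF G] algebra_simps)
qed

section \<open>Truncation\<close>

text \<open>One truncation theory for all tensor powers: \<open>wt\<close> is the total degree and
  \<open>mx\<close> the largest exponent of a monomial. The axiom \<open>wt_large\<close> is the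
  pigeonhole principle behind nilpotency of the augmentation ideal after truncation.\<close>

class monomial = comm_monoid_add +
  fixes wt :: "'a \<Rightarrow> nat" and mx :: "'a \<Rightarrow> nat"
  assumes wt_add: "wt (a + b) = wt a + wt b"
    and mx_add: "mx a \<le> mx (a + b)"
    and mx_0: "mx 0 = 0"
    and wt_eq_0: "wt a = 0 \<Longrightarrow> a = 0"
    and wt_large: "\<exists>N. \<forall>a. N \<le> wt a \<longrightarrow> p \<le> mx a"
begin

lemma wt_0: "wt 0 = 0"
  using wt_add[of 0 0] by simp

end

instantiation nat :: monomial
begin
definition "wt_nat (n :: nat) = n"
definition "mx_nat (n :: nat) = n"
instance by standard (auto simp: wt_nat_def mx_nat_def)
end

instantiation prod :: (monomial, monomial) monomial
begin
definition "wt_prod k = wt (fst k) + wt (snd k)"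
definition "mx_prod k = max (mx (fst k)) (mx (snd k))"
instance
proof
  fix p
  obtain N M where NM: "\<forall>a::'a. N \<le> wt a \<longrightarrow> p \<le> mx a" "\<forall>a::'b. M \<le> wt a \<longrightarrow> p \<le> mx a"
    using wt_large by metis
  have "p \<le> mx a" if "N + M \<le> wt a" for a :: "'a \<times> 'b"
  proof (cases "N \<le> wt (fst a)")
    case False
    hence "M \<le> wt (snd a)" using that unfolding wt_prod_def by linarith
    thus ?thesis using NM(2) by (simp add: mx_prod_def le_max_iff_disj)
  qed (use NM(1) in \<open>simp add: mx_prod_def le_max_iff_disj\<close>)
  thus "\<exists>N. \<forall>a::'a \<times> 'b. N \<le> wt a \<longrightarrow> p \<le> mx a" by blast
next
  fix a b :: "'a \<times> 'b"
  show "mx a \<le> mx (a + b)"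
    using mx_add[of "fst a" "fst b"] mx_add[of "snd a" "snd b"] by (auto simp: mx_prod_def max_def)
qed (auto simp: wt_prod_def mx_prod_def wt_add mx_0 wt_eq_0 prod_eq_iff)
end

lemma wt_Pair [simp]: "wt (a, b) = wt a + wt b" and mx_Pair [simp]: "mx (a, b) = max (mx a) (mx b)"
  and wt_nat [simp]: "wt (n :: nat) = n" and mx_nat [simp]: "mx (n :: nat) = n"
  by (auto simp: wt_prod_def mx_prod_def wt_nat_def mx_nat_def)

definition box :: "nat \<Rightarrow> 'a::monomial set" where
  "box p = {k. mx k < p}"

lemma box_nat: "box p = {..<p}" and box_Times: "box p = box p \<times> box p"
  by (auto simp: box_def)

definition trunc :: "nat \<Rightarrow> ('a::monomial \<Rightarrow>\<^sub>0 'k::field) \<Rightarrow> ('a \<Rightarrow>\<^sub>0 'k)" where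
  "trunc p = lin_ext (\<lambda>b. if mx b < p then bvec b else 0)"

lemma lin_trunc [simp]: "lin (trunc p)"
  by (simp add: trunc_def)

lemma trunc_bvec: "trunc p (bvec b) = (if mx b < p then bvec b else 0)"
  by (simp add: trunc_def)

text \<open>For linear maps in which a given output coefficient depends on a single input
  coefficient; truncation, coproduct, contractions and scalings are all of this kind.\<close>

lemma coef_lin:
  assumes "lin L" "\<And>b. coef (L (bvec b)) k = (if b = m then c else 0)"
  shows "coef (L f) k = c * coef f m"
proof -
  have "coef (L f) k = (\<Sum>b\<in>Poly_Mapping.keys f. coef f b * (if b = m then c else 0))"
    by (subst lin_expand[OF assms(1)]) (simp add: coef_lin_ext assms(2))
  also have "\<dots> = c * coef f m"
    by (auto simp: if_distrib in_keys_iff cong: if_cong)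
  finally show ?thesis .
qed

lemma coef_trunc: "coef (trunc p v) b = (if mx b < p then coef v b else 0)"
  using coef_lin[OF lin_trunc, of p b b "if mx b < p then 1 else 0" v]
  by (auto simp: trunc_bvec coef_bvec split: if_splits)

lemma trunc_id: "v \<in> free_space (box p) \<Longrightarrow> trunc p v = v"
  by (rule poly_mapping_eqI) (auto simp: coef_trunc free_space_def box_def in_keys_iff)

lemma trunc_in_free_space [simp]: "trunc p v \<in> free_space (box p)"
  by (auto simp: free_space_def box_def in_keys_iff coef_trunc split: if_splits)

section \<open>Congruence modulo monomial ideals\<close>

definition eqm :: "'a set \<Rightarrow> ('a \<Rightarrow>\<^sub>0 'k::field) \<Rightarrow> ('a \<Rightarrow>\<^sub>0 'k) \<Rightarrow> bool" where
  "eqm S u v \<longleftrightarrow> (\<forall>k. k \<notin> S \<longrightarrow> coef u k = coef v k)"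

text \<open>The ideal generated by the \<open>p\<close>-th powers of the variables and all monomials
  of degree at least \<open>d\<close>: the filtration along which approximate solutions are
  improved.\<close>

definition hi :: "nat \<Rightarrow> nat \<Rightarrow> 'a::monomial set" where
  "hi p d = {k. p \<le> mx k \<or> d \<le> wt k}"

abbreviation out :: "nat \<Rightarrow> 'a::monomial set" where
  "out p \<equiv> - box p"

lemma eqm_refl [simp]: "eqm S u u"
  and eqm_sym: "eqm S u v \<Longrightarrow> eqm S v u"
  and eqm_trans [trans]: "eqm S u v \<Longrightarrow> eqm S v w \<Longrightarrow> eqm S u w"
  and eqm_add: "eqm S u v \<Longrightarrow> eqm S u' v' \<Longrightarrow> eqm S (u + u') (v + v')"
  and eqm_diff: "eqm S u v \<Longrightarrow> eqm S u' v' \<Longrightarrow> eqm S (u - u') (v - v')"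
  and eqm_mono: "eqm S u v \<Longrightarrow> S \<subseteq> S' \<Longrightarrow> eqm S' u v"
  by (auto simp: eqm_def lookup_add lookup_minus lookup_scl)

lemma eqm_iff_diff: "eqm S u v \<longleftrightarrow> eqm S (u - v) 0"
  by (auto simp: eqm_def lookup_minus)

lemma eqm_0_keys: "eqm S u 0 \<longleftrightarrow> Poly_Mapping.keys u \<subseteq> S"
  by (auto simp: eqm_def in_keys_iff)

lemma eqm_0_mult:
  fixes u v :: "'a::comm_monoid_add \<Rightarrow>\<^sub>0 'k::field"
  assumes "eqm S u 0" "eqm S' v 0" "\<And>a b. a \<in> S \<Longrightarrow> b \<in> S' \<Longrightarrow> a + b \<in> S''"
  shows "eqm S'' (u * v) 0"
  using assms keys_mult[of u v] unfolding eqm_0_keys by blast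

lemma eqm_0_mult_left:
  fixes u v :: "'a::comm_monoid_add \<Rightarrow>\<^sub>0 'k::field"
  assumes "eqm S u 0" "\<And>a b. a \<in> S \<Longrightarrow> a + b \<in> S"
  shows "eqm S (u * v) 0"
  by (rule eqm_0_mult[OF assms(1), of UNIV]) (auto simp: eqm_def assms)

lemma eqm_mult_gen:
  fixes u v :: "'a::comm_monoid_add \<Rightarrow>\<^sub>0 'k::field"
  assumes "eqm S u v" "eqm S u' v'" "\<And>a b. a \<in> S \<Longrightarrow> a + b \<in> S"
  shows "eqm S (u * u') (v * v')"
proof -
  have "eqm S ((u - v) * u' + (u' - v') * v) (0 + 0)"
    by (intro eqm_add eqm_0_mult_left) (use assms in \<open>auto simp: eqm_iff_diff[symmetric]\<close>)
  moreover have "u * u' - v * v' = (u - v) * u' + (u' - v') * v" by (simp add: algebra_simps)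
  ultimately show ?thesis by (subst eqm_iff_diff) simp
qed

lemma out_upper: "a \<in> out p \<Longrightarrow> a + b \<in> out p" and hi_upper: "a \<in> hi p d \<Longrightarrow> a + b \<in> hi p d"
  using mx_add[of a b] by (auto simp: box_def hi_def wt_add)

lemmas eqm_mult = eqm_mult_gen[OF _ _ out_upper] and eqm_hi_mult = eqm_mult_gen[OF _ _ hi_upper]

lemma eqm_hi_0_mult:
  fixes u v :: "'a::monomial \<Rightarrow>\<^sub>0 'k::field"
  shows "eqm (hi p d) u 0 \<Longrightarrow> eqm (hi p e) v 0 \<Longrightarrow> eqm (hi p (d + e)) (u * v) 0"
proof (erule (1) eqm_0_mult)
  fix a b :: 'a assume "a \<in> hi p d" "b \<in> hi p e"
  thus "a + b \<in> hi p (d + e)"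
    using mx_add[of a b] mx_add[of b a] by (auto simp: hi_def wt_add add.commute)
qed

lemma eqm_hi_power: "eqm (hi p 1) u 0 \<Longrightarrow> eqm (hi p n) (u ^ n) 0"
proof (induction n)
  case 0 show ?case by (auto simp: eqm_def hi_def)
next
  case (Suc n)
  from eqm_hi_0_mult[OF Suc.prems Suc.IH[OF Suc.prems]] show ?case by simp
qed

text \<open>Only the constant monomial has weight 0, so modulo \<open>hi p 1\<close> nothing but the
  constant term is seen; for \<open>p = 0\<close> even that monomial lies in the ideal.\<close>

lemma eqm_hi_1: "eqm (hi p (Suc 0)) u v \<longleftrightarrow> (p > 0 \<longrightarrow> coef u 0 = coef v 0)"
  using wt_eq_0 by (auto simp: eqm_def hi_def wt_0 mx_0 not_le)

lemma eqm_out_iff: "eqm (out p) u v \<longleftrightarrow> trunc p u = trunc p v"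
  by (auto simp: eqm_def box_def coef_trunc poly_mapping_eq_iff fun_eq_iff)

lemma trunc_eqm: "eqm (out p) (trunc p u) u"
  by (auto simp: eqm_def box_def coef_trunc)

lemma trunc_mult: "trunc p (trunc p u * v) = trunc p (u * v)" "trunc p (u * trunc p v) = trunc p (u * v)"
  by (auto simp: eqm_out_iff[symmetric] intro!: eqm_mult trunc_eqm)

lemma out_subset_hi: "out p \<subseteq> hi p d"
  by (auto simp: box_def hi_def)

text \<open>Once \<open>d\<close> exceeds the largest degree of a truncated monomial, the filtration
  has reached the truncation ideal, so induction on the degree ends after finitely many
  steps.\<close>

lemma hi_large: "\<exists>N. \<forall>d\<ge>N. hi p d = (out p :: 'a::monomial set)"
proof -
  obtain N where "\<forall>a::'a. N \<le> wt a \<longrightarrow> p \<le> mx a" using wt_large by blast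
  hence "hi p d = (out p :: 'a set)" if "N \<le> d" for d
    using that order.trans[OF that] by (auto simp: hi_def box_def not_less dest: leD)
  thus ?thesis by blast
qed

text \<open>After division by its constant term, \<open>u\<close> is 1 - n with n nilpotent modulo
  truncation, so a finite geometric series inverts it.\<close>

lemma eqm_inverse:
  fixes u :: "'a::monomial \<Rightarrow>\<^sub>0 'k::field"
  assumes "coef u 0 \<noteq> 0"
  obtains v where "v \<in> free_space (box p)" "eqm (out p) (u * v) 1"
proof -
  obtain N where N: "hi p N = (out p :: 'a set)" using hi_large[of p] by blast
  define n where "n = 1 - scl (1 / coef u 0) u"
  define w where "w = scl (1 / coef u 0) (\<Sum>i<N. n ^ i)"
  have "eqm (hi p 1) n 0"
    using assms by (auto simp: eqm_hi_1 n_def lookup_minus lookup_scl)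
  hence "eqm (out p) (n ^ N) 0" using eqm_hi_power[of p n N] N by simp
  hence "eqm (out p) (1 - n ^ N) (1 - 0)" by (intro eqm_diff) auto
  moreover have "1 - n ^ N = u * w"
    by (subst one_diff_power_eq) (simp add: n_def w_def scl_mult_left scl_mult_right)
  ultimately have "eqm (out p) (u * trunc p w) 1"
    by (metis diff_zero eqm_out_iff trunc_mult(2))
  thus thesis using that trunc_in_free_space by blast
qed

section \<open>Substitution\<close>

definition ev1 :: "(nat \<Rightarrow>\<^sub>0 'k::field) \<Rightarrow> ('c::comm_monoid_add \<Rightarrow>\<^sub>0 'k) \<Rightarrow> ('c \<Rightarrow>\<^sub>0 'k)" where
  "ev1 f s = lin_ext (\<lambda>a. s ^ a) f"

definition ev2 :: "(nat \<times> nat \<Rightarrow>\<^sub>0 'k::field) \<Rightarrow> ('c::comm_monoid_add \<Rightarrow>\<^sub>0 'k) \<Rightarrow> ('c \<Rightarrow>\<^sub>0 'k) \<Rightarrow> ('c \<Rightarrow>\<^sub>0 'k)" where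
  "ev2 f s t = lin_ext (\<lambda>(a, b). s ^ a * t ^ b) f"

definition ev3 :: "(nat \<times> nat \<times> nat \<Rightarrow>\<^sub>0 'k::field) \<Rightarrow> ('c::comm_monoid_add \<Rightarrow>\<^sub>0 'k) \<Rightarrow> ('c \<Rightarrow>\<^sub>0 'k) \<Rightarrow> ('c \<Rightarrow>\<^sub>0 'k) \<Rightarrow> ('c \<Rightarrow>\<^sub>0 'k)" where
  "ev3 f s t r = lin_ext (\<lambda>(a, b, c). s ^ a * t ^ b * r ^ c) f"

lemma ev_bvec:
  "ev1 (bvec a) s = s ^ a"
  "ev2 (bvec (a, b)) s t = s ^ a * t ^ b"
  "ev3 (bvec (a, b, c)) s t r = s ^ a * t ^ b * r ^ c"
  by (simp_all add: ev1_def ev2_def ev3_def)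

lemma poly_hom_ev:
  "poly_hom (\<lambda>f. ev1 f s)" "poly_hom (\<lambda>f. ev2 f s t)" "poly_hom (\<lambda>f. ev3 f s t r)"
  unfolding ev1_def ev2_def ev3_def
  by (rule poly_hom_lin_ext; auto simp: power_add zero_prod_def algebra_simps)+

lemmas ev1_hom = poly_homD[OF poly_hom_ev(1)]
lemmas ev2_hom = poly_homD[OF poly_hom_ev(2)]
lemmas ev3_hom = poly_homD[OF poly_hom_ev(3)]

text \<open>Combined with \<open>ev_self\<close>, this determines a homomorphism by its values on
  the variables: apply it to a polynomial written as its own value at the variables.\<close>

lemma hom_ev:
  assumes "poly_hom h"
  shows "h (ev1 f s) = ev1 f (h s)" "h (ev2 g s t) = ev2 g (h s) (h t)"
    "h (ev3 e s t r) = ev3 e (h s) (h t) (h r)"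
proof -
  note h = poly_homD[OF assms]
  show "h (ev1 f s) = ev1 f (h s)"
    by (rule lin_eqI[of "\<lambda>f. h (ev1 f s)" "\<lambda>f. ev1 f (h s)"])
       (auto simp: ev_bvec h lin_comp[OF h(1) ev1_hom(1)] ev1_hom(1))
  show "h (ev2 g s t) = ev2 g (h s) (h t)"
    by (rule lin_eqI[of "\<lambda>f. h (ev2 f s t)" "\<lambda>f. ev2 f (h s) (h t)"])
       (auto simp: ev_bvec h lin_comp[OF h(1) ev2_hom(1)] ev2_hom(1))
  show "h (ev3 e s t r) = ev3 e (h s) (h t) (h r)"
    by (rule lin_eqI[of "\<lambda>f. h (ev3 f s t r)" "\<lambda>f. ev3 f (h s) (h t) (h r)"])
       (auto simp: ev_bvec h lin_comp[OF h(1) ev3_hom(1)] ev3_hom(1))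
qed

definition "X1 = (bvec 1 :: nat \<Rightarrow>\<^sub>0 'k::field)"
definition "X2 = (bvec (1, 0) :: nat \<times> nat \<Rightarrow>\<^sub>0 'k::field)"
definition "Y2 = (bvec (0, 1) :: nat \<times> nat \<Rightarrow>\<^sub>0 'k::field)"
definition "X3 = (bvec (1, 0, 0) :: nat \<times> nat \<times> nat \<Rightarrow>\<^sub>0 'k::field)"
definition "Y3 = (bvec (0, 1, 0) :: nat \<times> nat \<times> nat \<Rightarrow>\<^sub>0 'k::field)"
definition "Z3 = (bvec (0, 0, 1) :: nat \<times> nat \<times> nat \<Rightarrow>\<^sub>0 'k::field)"
definition "X4 = (bvec (1, 0, 0, 0) :: nat \<times> nat \<times> nat \<times> nat \<Rightarrow>\<^sub>0 'k::field)"
definition "Y4 = (bvec (0, 1, 0, 0) :: nat \<times> nat \<times> nat \<times> nat \<Rightarrow>\<^sub>0 'k::field)"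
definition "Z4 = (bvec (0, 0, 1, 0) :: nat \<times> nat \<times> nat \<times> nat \<Rightarrow>\<^sub>0 'k::field)"
definition "W4 = (bvec (0, 0, 0, 1) :: nat \<times> nat \<times> nat \<times> nat \<Rightarrow>\<^sub>0 'k::field)"

lemma ev_var [simp]:
  "ev1 X1 s = s"
  "ev2 X2 s t = s" "ev2 Y2 s t = t"
  "ev3 X3 s t r = s" "ev3 Y3 s t r = t" "ev3 Z3 s t r = r"
  by (simp_all add: X1_def X2_def Y2_def X3_def Y3_def Z3_def ev_bvec)

lemma bvec_power:
  "X1 ^ n = bvec n"
  "X2 ^ n = bvec (n, 0)" "Y2 ^ n = bvec (0, n)"
  "X3 ^ n = bvec (n, 0, 0)" "Y3 ^ n = bvec (0, n, 0)" "Z3 ^ n = bvec (0, 0, n)"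
  "X4 ^ n = bvec (n, 0, 0, 0)" "Y4 ^ n = bvec (0, n, 0, 0)" "Z4 ^ n = bvec (0, 0, n, 0)"
  "W4 ^ n = bvec (0, 0, 0, n)"
  by (induction n;
      simp add: X1_def X2_def Y2_def X3_def Y3_def Z3_def X4_def Y4_def Z4_def W4_def bvec_mult
        bvec_0[symmetric] zero_prod_def)+

lemma ev_self: "ev1 f X1 = f" "ev2 g X2 Y2 = g" "ev3 h X3 Y3 Z3 = h"
proof -
  have "(^) X1 = (bvec :: nat \<Rightarrow> nat \<Rightarrow>\<^sub>0 'a)" by (simp add: fun_eq_iff bvec_power)
  thus "ev1 f X1 = f" by (simp add: ev1_def lin_ext_id)
qed (simp_all add: ev2_def ev3_def bvec_power bvec_mult case_prod_beta lin_ext_id)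

lemma ev1_ev [simp]:
  "ev1 (ev1 f s) u = ev1 f (ev1 s u)" "ev1 (ev2 g s t) u = ev2 g (ev1 s u) (ev1 t u)"
  "ev1 (ev3 h s t r) u = ev3 h (ev1 s u) (ev1 t u) (ev1 r u)"
  by (rule hom_ev[OF poly_hom_ev(1)])+

lemma ev2_ev [simp]:
  "ev2 (ev1 f s) u v = ev1 f (ev2 s u v)" "ev2 (ev2 g s t) u v = ev2 g (ev2 s u v) (ev2 t u v)"
  "ev2 (ev3 h s t r) u v = ev3 h (ev2 s u v) (ev2 t u v) (ev2 r u v)"
  by (rule hom_ev[OF poly_hom_ev(2)])+

lemma ev3_ev [simp]:
  "ev3 (ev1 f s) u v w = ev1 f (ev3 s u v w)"
  "ev3 (ev2 g s t) u v w = ev2 g (ev3 s u v w) (ev3 t u v w)"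
  "ev3 (ev3 h s t r) u v w = ev3 h (ev3 s u v w) (ev3 t u v w) (ev3 r u v w)"
  by (rule hom_ev[OF poly_hom_ev(3)])+

section \<open>Tensor operations and the coproduct as substitutions\<close>

lemma lin_tmap [simp]: "lin (tmap f g)"
  by (simp add: tmap_def)

lemma tmap_bvec: "tmap f g (bvec (a, b)) = f (bvec a) \<boxtimes> g (bvec b)"
  by (simp add: tmap_def)

lemma tmap_tens:
  assumes "lin f" "lin g"
  shows "tmap f g (u \<boxtimes> v) = f u \<boxtimes> g v"
proof (rule lin_eqI[of "\<lambda>u. tmap f g (u \<boxtimes> v)" "\<lambda>u. f u \<boxtimes> g v"])
  fix a
  show "tmap f g (bvec a \<boxtimes> v) = f (bvec a) \<boxtimes> g v"
    by (rule lin_eqI[of "\<lambda>v. tmap f g (bvec a \<boxtimes> v)" "\<lambda>v. f (bvec a) \<boxtimes> g v"])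
       (simp_all add: tens_bvec tmap_bvec lin_comp[OF lin_tmap lin_tens(2)]
         lin_comp[OF lin_tens(2) assms(2)])
qed (simp_all add: lin_comp[OF lin_tmap lin_tens(1)] lin_comp[OF lin_tens(1) assms(1)])

lemma tens_1_1: "1 \<boxtimes> 1 = 1"
  by (simp add: bvec_0[symmetric] tens_bvec zero_prod_def)

lemma poly_hom_tmap:
  assumes "poly_hom f" "poly_hom g"
  shows "poly_hom (tmap f g)"
  unfolding tmap_def
  by (rule poly_hom_lin_ext)
     (auto simp: tens_mult bvec_mult[symmetric] poly_homD[OF assms(1)] poly_homD[OF assms(2)]
        zero_prod_def bvec_0 tens_1_1)

lemma poly_hom_reassoc: "poly_hom (reassoc :: (('a::comm_monoid_add \<times> 'b::comm_monoid_add) \<times> 'c::comm_monoid_add \<Rightarrow>\<^sub>0 'k::field) \<Rightarrow> _)"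
  unfolding reassoc_def
  by (rule poly_hom_lin_ext) (auto simp: bvec_mult zero_prod_def simp flip: bvec_0)

lemma poly_hom_id: "poly_hom id"
  by (simp add: poly_hom_def)

lemma poly_hom_comp: "poly_hom f \<Longrightarrow> poly_hom g \<Longrightarrow> poly_hom (\<lambda>v. f (g v))"
  by (simp add: poly_hom_def lin_comp)

lemma poly_hom_tens: "poly_hom (\<lambda>v. v \<boxtimes> 1)" "poly_hom (\<lambda>v. 1 \<boxtimes> v)"
  by (auto simp: poly_hom_def tens_mult tens_1_1)

definition Delta :: "(nat \<Rightarrow>\<^sub>0 'k::field) \<Rightarrow> (nat \<times> nat \<Rightarrow>\<^sub>0 'k)" where
  "Delta f = ev1 f (X2 + Y2)"

lemma poly_hom_Delta: "poly_hom Delta"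
  using poly_hom_ev(1) by (simp add: Delta_def[abs_def])

lemma Delta_X1: "Delta X1 = X2 + Y2"
  by (simp add: Delta_def)

lemma add_power_X2_Y2: "(X2 + Y2 :: nat \<times> nat \<Rightarrow>\<^sub>0 'k::field) ^ n = (\<Sum>i\<le>n. scl (of_nat (n choose i)) (bvec i \<boxtimes> bvec (n - i)))"
proof -
  have "of_nat m * (v :: nat \<times> nat \<Rightarrow>\<^sub>0 'k) = scl (of_nat m) v" for m v
    by (simp add: scl_def mult_map_scale_conv_mult)
  thus ?thesis
    by (simp add: binomial_ring bvec_power scl_mult_left bvec_mult tens_bvec)
qed

lemma comult_kalpha: "comult (kalpha p) = Delta"
  by (rule ext) (simp add: kalpha_def Delta_def ev1_def add_power_X2_Y2)

lemma coef_add_power: "coef ((X2 + Y2) ^ n) (i, j) = (if i + j = n then of_nat (n choose i) else 0)"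
proof -
  have "coef ((X2 + Y2) ^ n) (i, j) = (\<Sum>l\<le>n. if l = i then if i + j = n then of_nat (n choose i) else 0 else 0)"
    unfolding add_power_X2_Y2 lookup_sum
    by (intro sum.cong) (auto simp: lookup_scl coef_bvec)
  thus ?thesis by auto
qed

lemma var_tens:
  "X2 = X1 \<boxtimes> 1" "Y2 = 1 \<boxtimes> X1"
  "X3 = X1 \<boxtimes> 1" "Y3 = 1 \<boxtimes> X2" "Z3 = 1 \<boxtimes> Y2"
  "X4 = X1 \<boxtimes> 1" "Y4 = 1 \<boxtimes> X3" "Z4 = 1 \<boxtimes> Y3" "W4 = 1 \<boxtimes> Z3"
  by (simp_all add: X1_def X2_def Y2_def X3_def Y3_def Z3_def X4_def Y4_def Z4_def W4_def
      bvec_0[symmetric] tens_bvec zero_prod_def)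

lemma reassoc_bvec: "reassoc (bvec ((a, b), c)) = bvec (a, b, c)"
  by (simp add: reassoc_def)

lemma var_reassoc:
  "reassoc (X2 \<boxtimes> 1) = X3" "reassoc (Y2 \<boxtimes> 1) = Y3" "reassoc (1 \<boxtimes> X1) = Z3"
  "reassoc (X2 \<boxtimes> 1) = X4" "reassoc (Y2 \<boxtimes> 1) = Y4" "reassoc (1 \<boxtimes> X2) = Z4" "reassoc (1 \<boxtimes> Y2) = W4"
  "tmap id reassoc (reassoc (X3 \<boxtimes> 1)) = X4" "tmap id reassoc (reassoc (Y3 \<boxtimes> 1)) = Y4"
  "tmap id reassoc (reassoc (Z3 \<boxtimes> 1)) = Z4"
  by (simp_all add: X1_def X2_def Y2_def X3_def Y3_def Z3_def X4_def Y4_def Z4_def W4_def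
      bvec_0[symmetric] tens_bvec zero_prod_def reassoc_bvec tmap_bvec)

text \<open>Each left-hand side is an algebra homomorphism in \<open>f\<close>, so comparison on
  \<open>X2\<close> and \<open>Y2\<close> suffices. These are the four faces in the coboundary of a
  2-cochain.\<close>

lemma ev_tens_2:
  "1 \<boxtimes> f = ev2 f Y3 Z3" "reassoc (f \<boxtimes> 1) = ev2 f X3 Y3"
  "tmap id Delta f = ev2 f X3 (Y3 + Z3)" "reassoc (tmap Delta id f) = ev2 f (X3 + Y3) Z3"
proof -
  show "1 \<boxtimes> f = ev2 f Y3 Z3"
    using hom_ev(2)[OF poly_hom_tens(2), of f X2 Y2] by (simp add: ev_self var_tens(4,5))
  show "reassoc (f \<boxtimes> 1) = ev2 f X3 Y3"
    using hom_ev(2)[of "\<lambda>u. reassoc (u \<boxtimes> (1 :: nat \<Rightarrow>\<^sub>0 'a))" f X2 Y2,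
        OF poly_hom_comp[OF poly_hom_reassoc poly_hom_tens(1)]]
    by (simp add: ev_self var_reassoc)
  have "tmap id Delta X2 = (X3 :: _ \<Rightarrow>\<^sub>0 'a)" "tmap id Delta Y2 = (Y3 + Z3 :: _ \<Rightarrow>\<^sub>0 'a)"
    by (simp_all add: var_tens(1,2) tmap_tens poly_homD[OF poly_hom_Delta] Delta_X1,
        simp_all add: var_tens(3-5) flip: var_tens(1,2) add: poly_homD[OF poly_hom_tens(2)])
  thus "tmap id Delta f = ev2 f X3 (Y3 + Z3)"
    using hom_ev(2)[OF poly_hom_tmap[OF poly_hom_id poly_hom_Delta], of f X2 Y2] by (simp add: ev_self)
  have "reassoc (tmap Delta id X2) = (X3 + Y3 :: _ \<Rightarrow>\<^sub>0 'a)" "reassoc (tmap Delta id Y2) = (Z3 :: _ \<Rightarrow>\<^sub>0 'a)"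
    by (simp_all only: var_tens(1,2) tmap_tens poly_homD[OF poly_hom_Delta] lin_id Delta_X1 id_apply
        poly_homD[OF poly_hom_tens(1)] poly_homD[OF poly_hom_reassoc])
       (simp_all add: var_reassoc flip: var_tens(1,2))
  thus "reassoc (tmap Delta id f) = ev2 f (X3 + Y3) Z3"
    using hom_ev(2)[OF poly_hom_comp[OF poly_hom_reassoc poly_hom_tmap[OF poly_hom_Delta poly_hom_id]], of f X2 Y2]
    by (simp add: ev_self)
qed

text \<open>The five faces of the pentagon, again compared on the variables only.\<close>

lemma ev_tens_3:
  "1 \<boxtimes> f = ev3 f Y4 Z4 W4" "tmap id reassoc (reassoc (f \<boxtimes> 1)) = ev3 f X4 Y4 Z4"
  "tmap id (tmap id Delta) f = ev3 f X4 Y4 (Z4 + W4)"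
  "tmap id (\<lambda>u. reassoc (tmap Delta id u)) f = ev3 f X4 (Y4 + Z4) W4"
  "reassoc (tmap Delta id f) = ev3 f (X4 + Y4) Z4 W4"
proof -
  let ?D = "\<lambda>u :: nat \<times> nat \<Rightarrow>\<^sub>0 'a. reassoc (tmap Delta id u)"
  have D: "poly_hom ?D"
    by (intro poly_hom_comp[OF poly_hom_reassoc] poly_hom_tmap poly_hom_Delta poly_hom_id)
  have ID: "poly_hom (tmap id Delta :: (nat \<times> nat \<Rightarrow>\<^sub>0 'a) \<Rightarrow> _)"
    by (intro poly_hom_tmap poly_hom_Delta poly_hom_id)
  show "1 \<boxtimes> f = ev3 f Y4 Z4 W4"
    using hom_ev(3)[OF poly_hom_tens(2), of f X3 Y3 Z3] by (simp add: ev_self var_tens(7-9))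
  show "tmap id reassoc (reassoc (f \<boxtimes> 1)) = ev3 f X4 Y4 Z4"
    using hom_ev(3)[of "\<lambda>u. tmap id reassoc (reassoc (u \<boxtimes> (1 :: nat \<Rightarrow>\<^sub>0 'a)))" f X3 Y3 Z3,
        OF poly_hom_comp[OF poly_hom_tmap[OF poly_hom_id poly_hom_reassoc]
          poly_hom_comp[OF poly_hom_reassoc poly_hom_tens(1)]]]
    by (simp add: ev_self var_reassoc)
  have "tmap id (tmap id Delta) X3 = (X4 :: _ \<Rightarrow>\<^sub>0 'a)" "tmap id (tmap id Delta) Y3 = (Y4 :: _ \<Rightarrow>\<^sub>0 'a)"
    "tmap id (tmap id Delta) Z3 = (Z4 + W4 :: _ \<Rightarrow>\<^sub>0 'a)"
    by (simp_all only: var_tens(3-9) tmap_tens[OF lin_id(1) lin_tmap] poly_homD(3)[OF ID] id_apply)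
       (simp_all add: ev_tens_2(3) poly_homD[OF poly_hom_tens(2)] flip: var_tens(3-9))
  thus "tmap id (tmap id Delta) f = ev3 f X4 Y4 (Z4 + W4)"
    using hom_ev(3)[OF poly_hom_tmap[OF poly_hom_id ID], of f X3 Y3 Z3] by (simp add: ev_self)
  have "tmap id ?D X3 = X4" "tmap id ?D Y3 = Y4 + Z4" "tmap id ?D Z3 = W4"
    by (simp_all only: var_tens(3-9) tmap_tens[OF lin_id(1) poly_homD(1)[OF D]] poly_homD(3)[OF D] id_apply)
       (simp_all add: ev_tens_2(4) poly_homD[OF poly_hom_tens(2)] flip: var_tens(3-9))
  thus "tmap id ?D f = ev3 f X4 (Y4 + Z4) W4"
    using hom_ev(3)[OF poly_hom_tmap[OF poly_hom_id D], of f X3 Y3 Z3] by (simp add: ev_self)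
  have "reassoc (tmap Delta id X3) = (X4 + Y4 :: _ \<Rightarrow>\<^sub>0 'a)" "reassoc (tmap Delta id Y3) = (Z4 :: _ \<Rightarrow>\<^sub>0 'a)"
    "reassoc (tmap Delta id Z3) = (W4 :: _ \<Rightarrow>\<^sub>0 'a)"
    by (simp_all only: var_tens(3-5) tmap_tens poly_homD[OF poly_hom_Delta] lin_id Delta_X1 id_apply
        poly_homD[OF poly_hom_tens(1)] poly_homD[OF poly_hom_reassoc] var_reassoc)
  thus "reassoc (tmap Delta id f) = ev3 f (X4 + Y4) Z4 W4"
    using hom_ev(3)[OF poly_hom_comp[OF poly_hom_reassoc poly_hom_tmap[OF poly_hom_Delta poly_hom_id]], of f X3 Y3 Z3]
    by (simp add: ev_self)
qed

lemma coef_reassoc: "coef (reassoc u) (a, b, c) = coef u ((a, b), c)"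
  using coef_lin[of reassoc "(a, b, c)" "((a, b), c)" 1 u]
  by (auto simp: reassoc_def coef_bvec split: prod.splits if_splits)

lemma Delta_bvec: "Delta (bvec n) = (X2 + Y2) ^ n"
  by (simp add: Delta_def ev_bvec)

lemma coef_Delta: "coef (Delta f) (a, b) = of_nat (a + b choose a) * coef f (a + b)"
  by (rule coef_lin) (auto simp: poly_homD[OF poly_hom_Delta] Delta_bvec coef_add_power)

lemma coef_ev2:
  "coef (ev2 f Y3 Z3) (a, b, c) = (if a = 0 then coef f (b, c) else 0)"
  "coef (ev2 f X3 Y3) (a, b, c) = (if c = 0 then coef f (a, b) else 0)"
  "coef (ev2 f X3 (Y3 + Z3)) (a, b, c) = of_nat (b + c choose b) * coef f (a, b + c)"
  "coef (ev2 f (X3 + Y3) Z3) (a, b, c) = of_nat (a + b choose a) * coef f (a + b, c)"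
proof -
  show "coef (ev2 f Y3 Z3) (a, b, c) = (if a = 0 then coef f (b, c) else 0)"
    by (simp add: ev_tens_2(1)[symmetric] lookup_one when_def)
  show "coef (ev2 f X3 Y3) (a, b, c) = (if c = 0 then coef f (a, b) else 0)"
    by (simp add: ev_tens_2(2)[symmetric] coef_reassoc lookup_one when_def)
  show "coef (ev2 f X3 (Y3 + Z3)) (a, b, c) = of_nat (b + c choose b) * coef f (a, b + c)"
    unfolding ev_tens_2(3)[symmetric]
    by (rule coef_lin) (auto simp: tmap_bvec coef_bvec Delta_bvec coef_add_power split: if_splits)
  show "coef (ev2 f (X3 + Y3) Z3) (a, b, c) = of_nat (a + b choose a) * coef f (a + b, c)"
    unfolding ev_tens_2(4)[symmetric] coef_reassoc
    by (rule coef_lin) (auto simp: tmap_bvec coef_bvec Delta_bvec coef_add_power split: if_splits)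
qed

lemma coef_ev3:
  "coef (ev3 f Y4 Z4 W4) (a, b, c, d) = (if a = 0 then coef f (b, c, d) else 0)"
  "coef (ev3 f X4 Y4 Z4) (a, b, c, d) = (if d = 0 then coef f (a, b, c) else 0)"
  "coef (ev3 f X4 Y4 (Z4 + W4)) (a, b, c, d) = of_nat (c + d choose c) * coef f (a, b, c + d)"
  "coef (ev3 f X4 (Y4 + Z4) W4) (a, b, c, d) = of_nat (b + c choose b) * coef f (a, b + c, d)"
  "coef (ev3 f (X4 + Y4) Z4 W4) (a, b, c, d) = of_nat (a + b choose a) * coef f (a + b, c, d)"
proof -
  show "coef (ev3 f Y4 Z4 W4) (a, b, c, d) = (if a = 0 then coef f (b, c, d) else 0)"
    by (simp add: ev_tens_3(1)[symmetric] lookup_one when_def)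
  show "coef (ev3 f X4 Y4 Z4) (a, b, c, d) = (if d = 0 then coef f (a, b, c) else 0)"
  proof -
    have "coef (ev3 f X4 Y4 Z4) (a, b, c, d) = (if d = 0 then 1 else 0) * coef f (a, b, c)"
      by (rule coef_lin)
         (auto simp: ev3_hom ev_bvec bvec_power bvec_mult coef_bvec split: prod.splits if_splits)
    thus ?thesis by simp
  qed
  show "coef (ev3 f X4 Y4 (Z4 + W4)) (a, b, c, d) = of_nat (c + d choose c) * coef f (a, b, c + d)"
    unfolding ev_tens_3(3)[symmetric]
    by (rule coef_lin) (auto simp: tmap_bvec coef_bvec Delta_bvec coef_add_power split: prod.splits if_splits)
  show "coef (ev3 f X4 (Y4 + Z4) W4) (a, b, c, d) = of_nat (b + c choose b) * coef f (a, b + c, d)"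
    unfolding ev_tens_3(4)[symmetric]
    by (rule coef_lin)
       (auto simp: tmap_bvec coef_bvec Delta_bvec coef_add_power coef_reassoc split: prod.splits if_splits)
  show "coef (ev3 f (X4 + Y4) Z4 W4) (a, b, c, d) = of_nat (a + b choose a) * coef f (a + b, c, d)"
    unfolding ev_tens_3(5)[symmetric] coef_reassoc
    by (rule coef_lin) (auto simp: tmap_bvec coef_bvec Delta_bvec coef_add_power split: if_splits)
qed

section \<open>Multiplicative cocycles\<close>

locale char_p =
  fixes p :: nat and K :: "'k::field itself"
  assumes CHAR_p: "CHAR('k) = p" and p_pos: "0 < p"
begin

lemma prime_p: "prime p"
  using prime_CHAR_semidom[where ?'a = 'k] CHAR_p p_pos by simp

lemma of_nat_eq_0: "of_nat n = (0 :: 'k) \<longleftrightarrow> p dvd n"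
  by (simp add: of_nat_eq_0_iff_char_dvd CHAR_p)

lemma of_nat_neq_0: "0 < n \<Longrightarrow> n < p \<Longrightarrow> of_nat n \<noteq> (0 :: 'k)"
  by (auto simp: of_nat_eq_0 dest: dvd_imp_le)

lemma fact_neq_0: "n < p \<Longrightarrow> of_nat (fact n) \<noteq> (0 :: 'k)"
  by (simp add: of_nat_eq_0 prime_dvd_fact_iff[OF prime_p] del: of_nat_fact)

lemma of_nat_p [simp]: "of_nat p = (0 :: 'k)"
  by (simp add: of_nat_eq_0)

text \<open>The prime \<open>p\<close> divides (a+b)! but neither a! nor b!. This is what lets x ->
  x + y descend to truncated polynomials.\<close>

lemma binom_eq_0:
  assumes "a < p" "b < p" "p \<le> a + b"
  shows "of_nat (a + b choose a) = (0 :: 'k)"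
proof -
  have "fact a * fact b * (a + b choose a) = (fact (a + b) :: nat)"
    using binomial_fact_lemma[of a "a + b"] by simp
  hence "p dvd fact a * fact b * (a + b choose a)"
    using assms prime_dvd_fact_iff[OF prime_p] by simp
  thus ?thesis
    using assms prime_dvd_fact_iff[OF prime_p] by (auto simp: of_nat_eq_0 prime_dvd_mult_iff[OF prime_p])
qed

text \<open>A coefficient inside the box of the substituted polynomial is a binomial times one
  coefficient of \<open>f\<close>. Either that coefficient lies inside the box too, or the binomial
  vanishes; total degree is preserved, so the degree filtration is respected as well.\<close>

lemma eqm_ev2:
  fixes f g :: "nat \<times> nat \<Rightarrow>\<^sub>0 'k"
  assumes "eqm S f g" and "S = out p \<and> T = out p \<or> S = hi p d \<and> T = hi p d"
  shows "eqm T (ev2 f Y3 Z3) (ev2 g Y3 Z3)" "eqm T (ev2 f X3 Y3) (ev2 g X3 Y3)"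
    "eqm T (ev2 f X3 (Y3 + Z3)) (ev2 g X3 (Y3 + Z3))"
    "eqm T (ev2 f (X3 + Y3) Z3) (ev2 g (X3 + Y3) Z3)"
proof -
  have *: "a + b < p" if "of_nat (a + b choose a) \<noteq> (0 :: 'k)" "a < p" "b < p" for a b
    using binom_eq_0[OF that(2,3)] that(1) by linarith
  show "eqm T (ev2 f Y3 Z3) (ev2 g Y3 Z3)" "eqm T (ev2 f X3 Y3) (ev2 g X3 Y3)"
    using assms by (auto simp: eqm_def coef_ev2 box_def hi_def not_le)
  show "eqm T (ev2 f X3 (Y3 + Z3)) (ev2 g X3 (Y3 + Z3))"
    "eqm T (ev2 f (X3 + Y3) Z3) (ev2 g (X3 + Y3) Z3)"
    using assms by (auto simp: eqm_def coef_ev2 box_def hi_def not_le add.assoc dest!: *)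
qed

lemma eqm_ev3:
  fixes f g :: "nat \<times> nat \<times> nat \<Rightarrow>\<^sub>0 'k"
  assumes "eqm S f g" and "S = out p \<and> T = out p \<or> S = hi p d \<and> T = hi p d"
  shows "eqm T (ev3 f Y4 Z4 W4) (ev3 g Y4 Z4 W4)" "eqm T (ev3 f X4 Y4 Z4) (ev3 g X4 Y4 Z4)"
    "eqm T (ev3 f X4 Y4 (Z4 + W4)) (ev3 g X4 Y4 (Z4 + W4))"
    "eqm T (ev3 f X4 (Y4 + Z4) W4) (ev3 g X4 (Y4 + Z4) W4)"
    "eqm T (ev3 f (X4 + Y4) Z4 W4) (ev3 g (X4 + Y4) Z4 W4)"
proof -
  have *: "a + b < p" if "of_nat (a + b choose a) \<noteq> (0 :: 'k)" "a < p" "b < p" for a b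
    using binom_eq_0[OF that(2,3)] that(1) by linarith
  show "eqm T (ev3 f Y4 Z4 W4) (ev3 g Y4 Z4 W4)" "eqm T (ev3 f X4 Y4 Z4) (ev3 g X4 Y4 Z4)"
    using assms by (auto simp: eqm_def coef_ev3 box_def hi_def not_le)
  show "eqm T (ev3 f X4 Y4 (Z4 + W4)) (ev3 g X4 Y4 (Z4 + W4))"
    "eqm T (ev3 f X4 (Y4 + Z4) W4) (ev3 g X4 (Y4 + Z4) W4)"
    "eqm T (ev3 f (X4 + Y4) Z4 W4) (ev3 g (X4 + Y4) Z4 W4)"
    using assms by (auto simp: eqm_def coef_ev3 box_def hi_def not_le add.assoc dest!: *)
qed

lemmas eqm_ev2_hi = eqm_ev2[of "hi p d" _ _ "hi p d" d for d, simplified]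
lemmas eqm_ev2_out = eqm_ev2[of "out p" _ _ "out p", simplified]
lemmas eqm_ev3_hi = eqm_ev3[of "hi p d" _ _ "hi p d" d for d, simplified]
lemmas eqm_ev3_out = eqm_ev3[of "out p" _ _ "out p", simplified]

text \<open>\<open>J\<close> twists \<open>\<Phi>\<close> into \<open>\<Psi>\<close> iff \<open>cobL J \<Psi> = cobR J \<Phi>\<close> in the truncated algebra.\<close>

definition cobL :: "(nat \<times> nat \<Rightarrow>\<^sub>0 'k) \<Rightarrow> (nat \<times> nat \<times> nat \<Rightarrow>\<^sub>0 'k) \<Rightarrow> (nat \<times> nat \<times> nat \<Rightarrow>\<^sub>0 'k)" where
  "cobL J \<Phi> = ev2 J Y3 Z3 * ev2 J X3 (Y3 + Z3) * \<Phi>"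

definition cobR :: "(nat \<times> nat \<Rightarrow>\<^sub>0 'k) \<Rightarrow> (nat \<times> nat \<times> nat \<Rightarrow>\<^sub>0 'k) \<Rightarrow> (nat \<times> nat \<times> nat \<Rightarrow>\<^sub>0 'k)" where
  "cobR J \<Phi> = \<Phi> * ev2 J (X3 + Y3) Z3 * ev2 J X3 Y3"

section \<open>Normalized cocycles and the invariance of the class\<close>

definition pent :: "(nat \<times> nat \<times> nat \<Rightarrow>\<^sub>0 'k) \<Rightarrow> bool" where
  "pent \<Phi> \<longleftrightarrow> eqm (out p) (ev3 \<Phi> X4 Y4 (Z4 + W4) * ev3 \<Phi> (X4 + Y4) Z4 W4)
     (ev3 \<Phi> Y4 Z4 W4 * ev3 \<Phi> X4 (Y4 + Z4) W4 * ev3 \<Phi> X4 Y4 Z4)"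

definition normalized2 :: "(nat \<times> nat \<Rightarrow>\<^sub>0 'k) \<Rightarrow> bool" where
  "normalized2 J \<longleftrightarrow> (\<forall>a. coef J (a, 0) = (if a = 0 then 1 else 0) \<and> coef J (0, a) = (if a = 0 then 1 else 0))"

definition normalized3 :: "(nat \<times> nat \<times> nat \<Rightarrow>\<^sub>0 'k) \<Rightarrow> bool" where
  "normalized3 \<Phi> \<longleftrightarrow> (\<forall>a b. coef \<Phi> (0, a, b) = (if a = 0 \<and> b = 0 then 1 else 0) \<and>
     coef \<Phi> (a, 0, b) = (if a = 0 \<and> b = 0 then 1 else 0) \<and>
     coef \<Phi> (a, b, 0) = (if a = 0 \<and> b = 0 then 1 else 0))"

text \<open>Setting one variable to 0 is a ring homomorphism, and the hypothesis says that
  \<open>g\<close> becomes 1 under it.\<close>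

lemma coef_times_unit:
  fixes f g :: "nat \<times> nat \<times> nat \<Rightarrow>\<^sub>0 'k"
  shows "(\<And>j l. coef g (0, j, l) = (if j = 0 \<and> l = 0 then 1 else 0)) \<Longrightarrow> coef (f * g) (0, b, c) = coef f (0, b, c)"
    "(\<And>j l. coef g (j, 0, l) = (if j = 0 \<and> l = 0 then 1 else 0)) \<Longrightarrow> coef (f * g) (a, 0, c) = coef f (a, 0, c)"
    "(\<And>j l. coef g (j, l, 0) = (if j = 0 \<and> l = 0 then 1 else 0)) \<Longrightarrow> coef (f * g) (a, b, 0) = coef f (a, b, 0)"
proof -
  have *: "(\<Sum>i\<le>m. \<Sum>j\<le>n. F i j * (if m - i = 0 \<and> n - j = 0 then 1 else 0)) = F m n"
    for m n :: nat and F :: "nat \<Rightarrow> nat \<Rightarrow> 'k"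
  proof -
    have "(\<Sum>i\<le>m. \<Sum>j\<le>n. F i j * (if m - i = 0 \<and> n - j = 0 then 1 else 0)) =
          (\<Sum>i\<le>m. \<Sum>j\<le>n. if j = n then if i = m then F i j else 0 else 0)"
      by (intro sum.cong) auto
    thus ?thesis by simp
  qed
  show "(\<And>j l. coef g (0, j, l) = (if j = 0 \<and> l = 0 then 1 else 0)) \<Longrightarrow> coef (f * g) (0, b, c) = coef f (0, b, c)"
    "(\<And>j l. coef g (j, 0, l) = (if j = 0 \<and> l = 0 then 1 else 0)) \<Longrightarrow> coef (f * g) (a, 0, c) = coef f (a, 0, c)"
    "(\<And>j l. coef g (j, l, 0) = (if j = 0 \<and> l = 0 then 1 else 0)) \<Longrightarrow> coef (f * g) (a, b, 0) = coef f (a, b, 0)"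
    by (simp_all only: coef_times_triple * atMost_0 sum.insert sum.empty finite.emptyI empty_iff
        diff_zero add_0_right not_False_eq_True)
qed

text \<open>On each face two of the three factors on either side become 1 and the surviving ones
  agree. Hence the error \<open>cobL J \<Psi> - cobR J \<Phi>\<close> involves only monomials with
  all three exponents positive.\<close>

lemma cob_boundary:
  assumes "normalized2 J" "normalized3 \<Phi>" "normalized3 \<Psi>"
  shows "coef (cobL J \<Psi>) (0, b, c) = coef (cobR J \<Phi>) (0, b, c)"
    "coef (cobL J \<Psi>) (a, 0, c) = coef (cobR J \<Phi>) (a, 0, c)"
    "coef (cobL J \<Psi>) (a, b, 0) = coef (cobR J \<Phi>) (a, b, 0)"
proof -
  note [simp] = coef_ev2
  have n: "coef J (a, 0) = (if a = 0 then 1 else 0)" "coef J (0, a) = (if a = 0 then 1 else 0)"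
    "coef \<Phi> (0, a, b) = (if a = 0 \<and> b = 0 then 1 else 0)"
    "coef \<Phi> (a, 0, b) = (if a = 0 \<and> b = 0 then 1 else 0)"
    "coef \<Phi> (a, b, 0) = (if a = 0 \<and> b = 0 then 1 else 0)"
    "coef \<Psi> (0, a, b) = (if a = 0 \<and> b = 0 then 1 else 0)"
    "coef \<Psi> (a, 0, b) = (if a = 0 \<and> b = 0 then 1 else 0)"
    "coef \<Psi> (a, b, 0) = (if a = 0 \<and> b = 0 then 1 else 0)" for a b
    using assms by (auto simp: normalized2_def normalized3_def)
  \<comment> \<open>\<open>coef_times_unit\<close> strips right-hand factors, so the products are
    reordered to put those that are trivial on the face in question last.\<close>
  have L: "cobL J \<Psi> = ev2 J X3 (Y3 + Z3) * ev2 J Y3 Z3 * \<Psi>" by (simp add: cobL_def mult_ac)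
  have R: "cobR J \<Phi> = ev2 J (X3 + Y3) Z3 * ev2 J X3 Y3 * \<Phi>" by (simp add: cobR_def mult_ac)
  have R': "cobR J \<Phi> = ev2 J X3 Y3 * ev2 J (X3 + Y3) Z3 * \<Phi>" by (simp add: cobR_def mult_ac)
  have u: "coef (ev2 J X3 (Y3 + Z3)) (0, j, l) = (if j = 0 \<and> l = 0 then 1 else 0)"
    "coef (ev2 J X3 Y3) (0, j, l) = (if j = 0 \<and> l = 0 then 1 else 0)"
    "coef (ev2 J Y3 Z3) (j, 0, l) = (if j = 0 \<and> l = 0 then 1 else 0)"
    "coef (ev2 J X3 Y3) (j, 0, l) = (if j = 0 \<and> l = 0 then 1 else 0)"
    "coef (ev2 J Y3 Z3) (j, l, 0) = (if j = 0 \<and> l = 0 then 1 else 0)"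
    "coef (ev2 J (X3 + Y3) Z3) (j, l, 0) = (if j = 0 \<and> l = 0 then 1 else 0)" for j l
    by (auto simp: n)
  show "coef (cobL J \<Psi>) (0, b, c) = coef (cobR J \<Phi>) (0, b, c)"
    unfolding cobL_def R
    by (simp only: coef_times_unit(1)[OF n(3)] coef_times_unit(1)[OF n(6)] coef_times_unit(1)[OF u(1)]
        coef_times_unit(1)[OF u(2)]) simp
  show "coef (cobL J \<Psi>) (a, 0, c) = coef (cobR J \<Phi>) (a, 0, c)"
    unfolding L R
    by (simp only: coef_times_unit(2)[OF n(4)] coef_times_unit(2)[OF n(7)] coef_times_unit(2)[OF u(3)]
        coef_times_unit(2)[OF u(4)]) simp
  show "coef (cobL J \<Psi>) (a, b, 0) = coef (cobR J \<Phi>) (a, b, 0)"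
    unfolding L R'
    by (simp only: coef_times_unit(3)[OF n(5)] coef_times_unit(3)[OF n(8)] coef_times_unit(3)[OF u(5)]
        coef_times_unit(3)[OF u(6)]) simp
qed

lemma coef_times_1n1:
  fixes f g :: "nat \<times> nat \<times> nat \<Rightarrow>\<^sub>0 'k"
  shows "coef (f * g) (1, n, 1) =
    (\<Sum>j\<le>n. coef f (0, j, 0) * coef g (1, n - j, 1)) + (\<Sum>j\<le>n. coef f (0, j, 1) * coef g (1, n - j, 0)) +
    (\<Sum>j\<le>n. coef f (1, j, 0) * coef g (0, n - j, 1)) + (\<Sum>j\<le>n. coef f (1, j, 1) * coef g (0, n - j, 0))"
  by (simp add: coef_times_triple sum.distrib atMost_Suc)

text \<open>At exponents (1, m, 1) the terms quadratic in \<open>J\<close> are the same on both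
  sides. What remains of \<open>J\<close> is m + 1 times a coefficient, which vanishes for m = p - 1
  even if \<open>J\<close> is not truncated.\<close>

lemma cob_invariant:
  assumes "normalized2 J" "normalized3 \<Phi>" "normalized3 \<Psi>"
  shows "coef (cobL J \<Psi>) (1, p - 1, 1) - coef (cobR J \<Phi>) (1, p - 1, 1) =
    coef \<Psi> (1, p - 1, 1) - coef \<Phi> (1, p - 1, 1)"
proof -
  note [simp] = coef_ev2 
  have n: "coef J (a, 0) = (if a = 0 then 1 else 0)" "coef J (0, a) = (if a = 0 then 1 else 0)"
    "coef \<Phi> (0, a, b) = (if a = 0 \<and> b = 0 then 1 else 0)"
    "coef \<Phi> (a, 0, b) = (if a = 0 \<and> b = 0 then 1 else 0)"
    "coef \<Phi> (a, b, 0) = (if a = 0 \<and> b = 0 then 1 else 0)"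
    "coef \<Psi> (0, a, b) = (if a = 0 \<and> b = 0 then 1 else 0)"
    "coef \<Psi> (a, 0, b) = (if a = 0 \<and> b = 0 then 1 else 0)"
    "coef \<Psi> (a, b, 0) = (if a = 0 \<and> b = 0 then 1 else 0)" for a b
    using assms by (auto simp: normalized2_def normalized3_def)
  have s1: "(\<Sum>j\<le>m. F j * (if m = j then 1 else 0)) = F m" for m :: nat and F :: "nat \<Rightarrow> 'k"
  proof -
    have "(\<Sum>j\<le>m. F j * (if m = j then 1 else 0)) = (\<Sum>j\<le>m. if j = m then F j else 0)"
      by (intro sum.cong) auto
    thus ?thesis by simp
  qed
  have s2: "(\<Sum>j\<le>m. (if j = 0 then 1 else 0) * F j) = F 0" for m :: nat and F :: "nat \<Rightarrow> 'k"
  proof -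
    have "(\<Sum>j\<le>m. (if j = 0 then 1 else 0) * F j) = (\<Sum>j\<le>m. if j = 0 then F 0 else 0)"
      by (intro sum.cong) auto
    thus ?thesis by simp
  qed
  define AB where "AB = ev2 J Y3 Z3 * ev2 J X3 (Y3 + Z3)"
  define CD where "CD = ev2 J (X3 + Y3) Z3 * ev2 J X3 Y3"
  have unit: "coef (f * g) (0, j, 0) = (if j = 0 then 1 else 0)"
    if "\<And>j. coef f (0, j, 0) = (if j = 0 then 1 else 0)" "\<And>j. coef g (0, j, 0) = (if j = 0 then 1 else 0)"
    for f g :: "nat \<times> nat \<times> nat \<Rightarrow>\<^sub>0 'k" and j
    by (simp add: coef_times_triple that(1) s2) (simp add: that(2))
  have AB0: "coef AB (0, j, 0) = (if j = 0 then 1 else 0)" for j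
    unfolding AB_def by (rule unit) (auto simp: n)
  have CD0: "coef CD (0, j, 0) = (if j = 0 then 1 else 0)" for j
    unfolding CD_def by (rule unit) (auto simp: n)
  have AB: "coef AB (1, m, 1) = of_nat (m + 1) * coef J (1, m + 1) + (\<Sum>j\<le>m. coef J (j, 1) * coef J (1, m - j))" for m
    unfolding AB_def coef_times_1n1 by (simp add: n s2)
  have CD: "coef CD (1, m, 1) = of_nat (m + 1) * coef J (m + 1, 1) + (\<Sum>j\<le>m. coef J (j, 1) * coef J (1, m - j))" for m
    unfolding CD_def coef_times_1n1 by (simp add: n s1)
  have "coef (cobL J \<Psi>) (1, m, 1) = coef AB (1, m, 1) + coef \<Psi> (1, m, 1)" for m
    unfolding cobL_def AB_def[symmetric] coef_times_1n1 by (simp add: n AB0 s1 s2)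
  moreover have "coef (cobR J \<Phi>) (1, m, 1) = coef CD (1, m, 1) + coef \<Phi> (1, m, 1)" for m
    unfolding cobR_def mult.assoc CD_def[symmetric] coef_times_1n1 by (simp add: n CD0 s1 s2)
  ultimately show ?thesis using p_pos by (simp only: AB CD) simp
qed


section \<open>Leading-degree calculus and the cocycle equation for the error\<close>

lemma eqm_absorb:
  fixes e m :: "'a::monomial \<Rightarrow>\<^sub>0 'k"
  assumes "eqm (hi p d) e 0" "eqm (hi p 1) m 1"
  shows "eqm (hi p (Suc d)) (e * m) e"
  using eqm_hi_0_mult[OF assms(1), of 1 "m - 1"] assms(2)
  by (subst eqm_iff_diff) (simp add: eqm_iff_diff[of _ m] algebra_simps)

lemma eqm_one_mult:
  fixes u v :: "'a::monomial \<Rightarrow>\<^sub>0 'k"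
  shows "eqm (hi p 1) u 1 \<Longrightarrow> eqm (hi p 1) v 1 \<Longrightarrow> eqm (hi p 1) (u * v) 1"
  using eqm_hi_mult[of p 1 u 1 v 1] by simp

text \<open>Telescoping writes the difference of products as a sum of single differences times
  cofactors; the cofactors have constant term 1 and are absorbed in leading degree. The common
  factor \<open>m\<close> will hold the leftover values of \<open>J\<close>.\<close>

lemma eqm_lead_2:
  fixes u1 u2 v1 v2 m :: "'a::monomial \<Rightarrow>\<^sub>0 'k"
  assumes "eqm (hi p d) u1 v1" "eqm (hi p d) u2 v2"
    and "eqm (hi p 1) u2 1" "eqm (hi p 1) v1 1" "eqm (hi p 1) m 1"
  shows "eqm (hi p (Suc d)) (u1 * u2 * m - v1 * v2 * m) ((u1 - v1) + (u2 - v2))"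
proof -
  have "eqm (hi p (Suc d)) ((u1 - v1) * (u2 * m) + (u2 - v2) * (v1 * m)) ((u1 - v1) + (u2 - v2))"
    by (intro eqm_add eqm_absorb eqm_one_mult) (use assms in \<open>simp_all add: eqm_iff_diff[symmetric]\<close>)
  thus ?thesis by (simp add: algebra_simps)
qed

lemma eqm_lead_3:
  fixes u1 u2 u3 v1 v2 v3 m :: "'a::monomial \<Rightarrow>\<^sub>0 'k"
  assumes "eqm (hi p d) u1 v1" "eqm (hi p d) u2 v2" "eqm (hi p d) u3 v3"
    and "eqm (hi p 1) u2 1" "eqm (hi p 1) u3 1" "eqm (hi p 1) v1 1" "eqm (hi p 1) v2 1" "eqm (hi p 1) m 1"
  shows "eqm (hi p (Suc d)) (u1 * u2 * u3 * m - v1 * v2 * v3 * m) ((u1 - v1) + (u2 - v2) + (u3 - v3))"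
proof -
  have "eqm (hi p (Suc d)) ((u1 - v1) * (u2 * u3 * m) + (u2 - v2) * (v1 * u3 * m) + (u3 - v3) * (v1 * v2 * m))
     ((u1 - v1) + (u2 - v2) + (u3 - v3))"
    by (intro eqm_add eqm_absorb eqm_one_mult) (use assms in \<open>simp_all add: eqm_iff_diff[symmetric]\<close>)
  thus ?thesis by (simp add: algebra_simps)
qed

text \<open>A coboundary is a cocycle, stated without inverses: each of the two halves of the
  coboundary alone breaks the pentagon by factors of \<open>J\<close>. These factors are the same
  for \<open>cobL\<close> and \<open>cobR\<close>, which is what makes the two comparable.\<close>

lemma cob_pent:
  fixes J :: "nat \<times> nat \<Rightarrow>\<^sub>0 'k"
  assumes "pent \<Phi>" and U: "U \<in> {cobL J \<Phi>, cobR J \<Phi>}"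
  shows "eqm (out p)
    (ev3 U X4 Y4 (Z4 + W4) * ev3 U (X4 + Y4) Z4 W4 *
       (ev2 J (Y4 + Z4) W4 * ev2 J Y4 Z4 * ev2 J X4 (Y4 + Z4)))
    (ev3 U Y4 Z4 W4 * ev3 U X4 (Y4 + Z4) W4 * ev3 U X4 Y4 Z4 * ev2 J (X4 + Y4) (Z4 + W4))"
proof -
  let ?l = "ev3 \<Phi> X4 Y4 (Z4 + W4) * ev3 \<Phi> (X4 + Y4) Z4 W4"
  let ?r = "ev3 \<Phi> Y4 Z4 W4 * ev3 \<Phi> X4 (Y4 + Z4) W4 * ev3 \<Phi> X4 Y4 Z4"
  have *: "eqm (out p) (?l * q) (?r * q)" for q
    by (rule eqm_mult[OF assms(1)[unfolded pent_def] eqm_refl])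
  from U show ?thesis
  proof (elim insertE emptyE)
    assume [simp]: "U = cobL J \<Phi>"
    \<comment> \<open>The values of \<open>J\<close> contributed by the two factors on the left,
      times the correction factor there; the right side collects to the same seven values.\<close>
    let ?q = "ev2 J Y4 (Z4 + W4) * ev2 J X4 (Y4 + (Z4 + W4)) * ev2 J Z4 W4 * ev2 J (X4 + Y4) (Z4 + W4) *
      ev2 J (Y4 + Z4) W4 * ev2 J Y4 Z4 * ev2 J X4 (Y4 + Z4)"
    from *[of ?q] show ?thesis
      by (simp add: cobL_def ev3_hom add.assoc) (simp add: mult_ac)
  next
    assume [simp]: "U = cobR J \<Phi>"
    let ?q = "ev2 J (X4 + Y4) (Z4 + W4) * ev2 J X4 Y4 * ev2 J (X4 + (Y4 + Z4)) W4 * ev2 J (X4 + Y4) Z4 *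
      ev2 J (Y4 + Z4) W4 * ev2 J Y4 Z4 * ev2 J X4 (Y4 + Z4)"
    from *[of ?q] show ?thesis
      by (simp add: cobR_def ev3_hom add.assoc) (simp add: mult_ac)
  qed
qed

lemma cob_one:
  assumes "normalized2 J" "normalized3 \<Phi>"
  shows "eqm (hi p 1) (cobL J \<Phi>) 1" "eqm (hi p 1) (cobR J \<Phi>) 1"
proof -
  have J: "eqm (hi p 1) J 1" and P: "eqm (hi p 1) \<Phi> 1"
    using assms by (auto simp: eqm_hi_1 normalized2_def normalized3_def zero_prod_def lookup_one)
  show "eqm (hi p 1) (cobL J \<Phi>) 1" "eqm (hi p 1) (cobR J \<Phi>) 1"
    unfolding cobL_def cobR_def
    by (intro eqm_one_mult P; insert eqm_ev2_hi[OF J]; simp add: ev2_hom)+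
qed

text \<open>Both halves satisfy the pentagon with identical correction factors. Subtracting the two
  identities and keeping the lowest degree removes these factors and leaves the additive 3-cocycle
  condition.\<close>

lemma cocycle_lead:
  assumes "normalized2 J" "normalized3 \<Phi>" "normalized3 \<Psi>" "pent \<Phi>" "pent \<Psi>" and "eqm (hi p d) (cobL J \<Psi>) (cobR J \<Phi>)"
  defines "e \<equiv> cobL J \<Psi> - cobR J \<Phi>"
  shows "eqm (hi p (Suc d)) (ev3 e X4 Y4 (Z4 + W4) + ev3 e (X4 + Y4) Z4 W4)
     (ev3 e Y4 Z4 W4 + ev3 e X4 (Y4 + Z4) W4 + ev3 e X4 Y4 Z4)"
proof -
  let ?U = "cobL J \<Psi>" and ?V = "cobR J \<Phi>"
  let ?m = "ev2 J (Y4 + Z4) W4 * ev2 J Y4 Z4 * ev2 J X4 (Y4 + Z4)" and ?n = "ev2 J (X4 + Y4) (Z4 + W4)"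
  have one: "eqm (hi p 1) ?U 1" "eqm (hi p 1) ?V 1"
    using cob_one assms by blast+
  note U1 = eqm_ev3_hi[OF one(1), unfolded ev3_hom(3)] and V1 = eqm_ev3_hi[OF one(2), unfolded ev3_hom(3)]
  note UV = eqm_ev3_hi[OF assms(6)]
  have J1: "eqm (hi p 1) J 1" using assms(1) by (auto simp: eqm_hi_1 normalized2_def zero_prod_def lookup_one)
  have mn: "eqm (hi p 1) ?m 1" "eqm (hi p 1) ?n 1"
  proof -
    note J3 = eqm_ev2_hi[OF J1, unfolded ev2_hom(3)]
    have "eqm (hi p 1) (ev2 J Y4 Z4) 1"
      using eqm_ev3_hi(1)[OF J3(2)] by (simp add: ev3_hom)
    moreover have "eqm (hi p 1) (ev2 J (Y4 + Z4) W4) 1"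
      using eqm_ev3_hi(1)[OF J3(4)] by (simp add: ev3_hom)
    moreover have "eqm (hi p 1) (ev2 J X4 (Y4 + Z4)) 1"
      using eqm_ev3_hi(2)[OF J3(3)] by (simp add: ev3_hom)
    ultimately show "eqm (hi p 1) ?m 1" by (intro eqm_one_mult)
    show "eqm (hi p 1) ?n 1"
      using eqm_ev3_hi(3)[OF J3(4)] by (simp add: ev3_hom)
  qed
  have *: "eqm (hi p (Suc d)) u v" if "eqm (out p) u v" for u v :: "nat \<times> nat \<times> nat \<times> nat \<Rightarrow>\<^sub>0 'k"
    using that out_subset_hi by (rule eqm_mono)
  have "eqm (hi p (Suc d)) (ev3 e X4 Y4 (Z4 + W4) + ev3 e (X4 + Y4) Z4 W4)
     (ev3 ?U X4 Y4 (Z4 + W4) * ev3 ?U (X4 + Y4) Z4 W4 * ?m - ev3 ?V X4 Y4 (Z4 + W4) * ev3 ?V (X4 + Y4) Z4 W4 * ?m)"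
    unfolding e_def ev3_hom(6)
    by (rule eqm_sym, rule eqm_lead_2) (use UV U1 V1 mn in auto)
  also have "eqm (hi p (Suc d)) \<dots>
     (ev3 ?U Y4 Z4 W4 * ev3 ?U X4 (Y4 + Z4) W4 * ev3 ?U X4 Y4 Z4 * ?n -
      ev3 ?V Y4 Z4 W4 * ev3 ?V X4 (Y4 + Z4) W4 * ev3 ?V X4 Y4 Z4 * ?n)"
    by (intro eqm_diff * cob_pent[OF assms(5)] cob_pent[OF assms(4)]) auto
  also have "eqm (hi p (Suc d)) \<dots> (ev3 e Y4 Z4 W4 + ev3 e X4 (Y4 + Z4) W4 + ev3 e X4 Y4 Z4)"
    unfolding e_def ev3_hom(6)
    by (rule eqm_lead_3) (use UV U1 V1 mn in auto)
  finally show ?thesis .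
qed

text \<open>Linearization: adding \<open>h\<close> of order \<open>d\<close> to \<open>J\<close>
  acts to leading order as the additive coboundary of \<open>h\<close>. Positivity of
  \<open>d\<close> keeps the constant term of \<open>J + h\<close> equal to 1.\<close>

lemma cob_perturb:
  assumes "normalized2 J" "normalized3 \<Phi>" "eqm (hi p d) h 0" "0 < d"
  shows "eqm (hi p (Suc d)) (cobL (J + h) \<Phi>) (cobL J \<Phi> + (ev2 h Y3 Z3 + ev2 h X3 (Y3 + Z3)))"
    "eqm (hi p (Suc d)) (cobR (J + h) \<Phi>) (cobR J \<Phi> + (ev2 h (X3 + Y3) Z3 + ev2 h X3 Y3))"
proof -
  have J: "eqm (hi p 1) J 1" and P: "eqm (hi p 1) \<Phi> 1"
    using assms by (auto simp: eqm_hi_1 normalized2_def normalized3_def zero_prod_def lookup_one)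
  have "eqm (hi p 1) h 0"
    using assms(3,4) by (rule_tac eqm_mono) (auto simp: hi_def)
  hence Jh: "eqm (hi p 1) (J + h) 1" using eqm_add[OF J] by fastforce
  note J3 = eqm_ev2_hi[OF J, unfolded ev2_hom(3)] and Jh3 = eqm_ev2_hi[OF Jh, unfolded ev2_hom(3)]
  have d: "eqm (hi p d) (J + h) J" using eqm_add[OF eqm_refl assms(3)] by fastforce
  note d3 = eqm_ev2_hi[OF d]
  have *: "eqm S u (v + w)" if "eqm S (u - v) w" for S and u v w :: "nat \<times> nat \<times> nat \<Rightarrow>\<^sub>0 'k"
    using that by (auto simp: eqm_def lookup_minus lookup_add algebra_simps)
  show "eqm (hi p (Suc d)) (cobL (J + h) \<Phi>) (cobL J \<Phi> + (ev2 h Y3 Z3 + ev2 h X3 (Y3 + Z3)))"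
    by (rule *) (use eqm_lead_2[OF d3(1,3) Jh3(3) J3(1) P] in \<open>simp add: cobL_def ev2_hom\<close>)
  show "eqm (hi p (Suc d)) (cobR (J + h) \<Phi>) (cobR J \<Phi> + (ev2 h (X3 + Y3) Z3 + ev2 h X3 Y3))"
    by (rule *) (use eqm_lead_2[OF d3(4,2) Jh3(2) J3(4) P] in \<open>simp add: cobR_def ev2_hom mult_ac\<close>)
qed

text \<open>It suffices to solve a linear equation expressing the degree \<open>d\<close> part of
  the error as an additive coboundary. Equality of the invariants enters only through the
  coefficient \<open>E 1 (p - 1) 1\<close>.\<close>

lemma cob_step:
  assumes nrm: "normalized2 J" "normalized3 \<Phi>" "normalized3 \<Psi>" and "pent \<Phi>" "pent \<Psi>"
    and c: "coef \<Phi> (1, p - 1, 1) = coef \<Psi> (1, p - 1, 1)"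
    and eq: "eqm (hi p d) (cobL J \<Psi>) (cobR J \<Phi>)" and d: "0 < d"
  obtains J' where "normalized2 J'" "eqm (hi p (Suc d)) (cobL J' \<Psi>) (cobR J' \<Phi>)"
proof -
  define e where "e = cobL J \<Psi> - cobR J \<Phi>"
  define E where "E a b c = coef e (a, b, c)" for a b c
  have e_0: "eqm (hi p d) e 0" using eq by (simp add: e_def eqm_iff_diff[symmetric])
  have E_0: "E a b c = 0" if "a < p" "b < p" "c < p" "a + b + c < d" for a b c
    using e_0 that by (auto simp: E_def eqm_def hi_def)
  have bd: "E 0 b c = 0" "E a 0 c = 0" "E a b 0 = 0" for a b c
    using cob_boundary[OF nrm] by (simp_all add: E_def e_def lookup_minus)
  \<comment> \<open>The additive cocycle condition at exponents (1, a', b, c). The two outer faces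
    contribute nothing because 1 and \<open>c\<close> are positive; \<open>Suc a'\<close> is the
    binomial from splitting \<open>Suc a'\<close> as 1 + a'.\<close>
  have cocycle: "of_nat (a' + b choose a') * E 1 (a' + b) c =
      of_nat (b + c choose b) * E 1 a' (b + c) + of_nat (Suc a') * E (Suc a') b c"
    if "0 < a'" "0 < b" "0 < c" "a' < p" "b < p" "c < p" "Suc (a' + b + c) = d" for a' b c
  proof -
    have "(1 :: nat, a', b, c) \<notin> hi p (Suc d)" using that prime_gt_1_nat[OF prime_p] by (auto simp: hi_def)
    with cocycle_lead[OF assms(1-5,7)] that show ?thesis
      unfolding eqm_def e_def[symmetric] by (force simp: lookup_add coef_ev3 E_def)
  qed
  \<comment> \<open>These coefficients could only be cancelled by a monomial of \<open>h\<close>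
    divisible by x^p, so they must vanish already. For \<open>c > 1\<close> the cocycle condition at
    (1, p-1, 1, c-1) leaves only \<open>c * E 1 (p - 1) c = 0\<close>, and \<open>c\<close> is
    invertible.\<close>
  have E_p: "E 1 (p - 1) c = 0" if "0 < c" "c < p" "1 + (p - 1) + c = d" for c
  proof (cases "c = 1")
    case True
    thus ?thesis using cob_invariant[OF nrm] c by (simp add: E_def e_def lookup_minus)
  next
    case False
    with that have c': "0 < c - 1" by simp
    have p1: "0 < p - 1" using prime_gt_1_nat[OF prime_p] by simp
    have "of_nat (p - 1 + 1 choose (p - 1)) * E 1 (p - 1 + 1) (c - 1) =
      of_nat (1 + (c - 1) choose 1) * E 1 (p - 1) (1 + (c - 1)) + of_nat (Suc (p - 1)) * E (Suc (p - 1)) 1 (c - 1)"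
      by (rule cocycle) (use that c' p1 in auto)
    moreover have "of_nat (p - 1 + 1 choose (p - 1)) = (0 :: 'k)"
      by (rule binom_eq_0) (use p1 in auto)
    moreover have "of_nat (Suc (p - 1)) = (0 :: 'k)" using p_pos by simp
    ultimately have "of_nat c * E 1 (p - 1) c = 0" using c' by simp
    thus ?thesis using of_nat_neq_0[OF that(1,2)] by simp
  qed
  \<comment> \<open>With the choice \<open>H 1 x = 0\<close>, the equation to be solved at first
    exponent 1 reads \<open>E 1 b c = (b + 1) * H (b + 1) c\<close>, which dictates this formula.
    Denominators stay in 2..p-1 and are invertible.\<close>
  define H where "H a c = (if 2 \<le> a \<and> a < p \<and> 1 \<le> c \<and> c < p \<and> a + c = d then E 1 (a - 1) c / of_nat a else 0)" for a c
  define h where "h = (\<Sum>(a, c)\<in>{2..<p} \<times> {1..<p}. scl (H a c) (bvec (a, c)))"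
  have h: "coef h (a, c) = H a c" for a c
  proof -
    have "coef h (a, c) = (\<Sum>x\<in>{2..<p} \<times> {1..<p}. if x = (a, c) then H a c else 0)"
      unfolding h_def lookup_sum by (intro sum.cong) (auto simp: lookup_scl coef_bvec split: if_splits)
    also have "\<dots> = H a c" by (subst sum.delta) (auto simp: H_def)
    finally show ?thesis .
  qed
  have H_0: "H 0 c = 0" "H a 0 = 0" for a c by (auto simp: H_def)
  have h_0: "eqm (hi p d) h 0" by (auto simp: eqm_def hi_def h H_def)
  note h3 = eqm_ev2_hi[OF h_0, unfolded ev2_hom(8)]
  have main: "E a b c + of_nat (b + c choose b) * H a (b + c) = of_nat (a + b choose a) * H (a + b) c"
    if abc: "0 < a" "0 < b" "0 < c" "a < p" "b < p" "c < p" "a + b + c = d" for a b c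
  proof (cases "a = 1")
    case True
    have [simp]: "H 1 x = 0" for x by (simp add: H_def)
    show ?thesis
    proof (cases "b + 1 < p")
      case True
      thus ?thesis using abc \<open>a = 1\<close> of_nat_neq_0[of "Suc b"] by (simp add: H_def)
    next
      case False
      hence b: "b = p - 1" using abc by simp
      have "E 1 (p - 1) c = 0" by (rule E_p) (use abc \<open>a = 1\<close> b in auto)
      thus ?thesis using \<open>a = 1\<close> b p_pos by (simp add: H_def)
    qed
  next
    case False
    \<comment> \<open>For first exponent above 1 nothing is left to choose. After multiplication by
      \<open>a\<close>, the absorption identity a binom(a+b, a) = (a+b) binom(a+b-1, a-1) cancels
      the denominators of \<open>H\<close> and the equation becomes \<open>coc\<close>.\<close>
    define a' where "a' = a - 1"
    have a': "0 < a'" "a = Suc a'" using False abc by (auto simp: a'_def)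
    have a0: "of_nat a \<noteq> (0 :: 'k)" using of_nat_neq_0[of a] abc by simp
    have coc: "of_nat (a' + b choose a') * E 1 (a' + b) c = of_nat (b + c choose b) * E 1 a' (b + c) + of_nat a * E a b c"
      using cocycle[of a' b c] abc a' by simp
    have 1: "of_nat (b + c choose b) * (of_nat a * H a (b + c)) = of_nat (b + c choose b) * E 1 a' (b + c)"
    proof (cases "b + c < p")
      case True
      hence "of_nat a * H a (b + c) = E 1 a' (b + c)" using abc a' a0 by (simp add: H_def)
      thus ?thesis by simp
    next
      case False thus ?thesis using binom_eq_0[of b c] abc by simp
    qed
    have 2: "of_nat a * (of_nat (a + b choose a) * H (a + b) c) = of_nat (a' + b choose a') * E 1 (a' + b) c"
    proof (cases "a + b < p")
      case True
      have "of_nat a * of_nat (a + b choose a) = (of_nat (a * (a + b choose a)) :: 'k)" by simp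
      also have "a * (a + b choose a) = (a + b) * (a' + b choose a')"
        using binomial_absorption[of a' "a + b"] a' by simp
      finally have "of_nat a * (of_nat (a + b choose a) * H (a + b) c) =
          of_nat (a' + b choose a') * (of_nat (a + b) * H (a + b) c)"
        by (metis (no_types, lifting) mult.assoc mult.commute of_nat_mult)
      also have "of_nat (a + b) * H (a + b) c = E 1 (a' + b) c"
        using True abc a' of_nat_neq_0[of "a + b"] by (simp add: H_def)
      finally show ?thesis .
    next
      case False
      hence 0: "of_nat (a + b choose a) = (0 :: 'k)" using binom_eq_0[of a b] abc by simp
      have "of_nat (a' + b choose a') * E 1 (a' + b) c = 0"
      proof (cases "a' + b = p - 1")
        case True
        have "E 1 (p - 1) c = 0" by (rule E_p) (use abc a' True in auto)
        thus ?thesis using True by simp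
      next
        case False
        thus ?thesis using binom_eq_0[of a' b] abc a' \<open>\<not> a + b < p\<close> by simp
      qed
      thus ?thesis using 0 by simp
    qed
    have "of_nat a * (E a b c + of_nat (b + c choose b) * H a (b + c)) = of_nat a * (of_nat (a + b choose a) * H (a + b) c)"
      using coc 1 2 by (simp add: algebra_simps)
    thus ?thesis using a0 by simp
  qed
  have lead: "eqm (hi p (Suc d)) (cobL J \<Psi> + (ev2 h Y3 Z3 + ev2 h X3 (Y3 + Z3)))
      (cobR J \<Phi> + (ev2 h (X3 + Y3) Z3 + ev2 h X3 Y3))"
  proof -
    have "coef (e + ev2 h Y3 Z3 + ev2 h X3 (Y3 + Z3)) (a, b, c) = coef (ev2 h (X3 + Y3) Z3 + ev2 h X3 Y3) (a, b, c)"
      if abc: "a < p" "b < p" "c < p" "a + b + c < Suc d" for a b c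
    proof (cases "a + b + c < d")
      case True
      hence "(a, b, c) \<notin> hi p d" using abc by (auto simp: hi_def)
      thus ?thesis using h3 e_0 by (simp add: eqm_def lookup_add)
    next
      case False
      hence "a + b + c = d" using abc by simp
      thus ?thesis using main[of a b c] abc bd H_0
        by (cases "a = 0"; cases "b = 0"; cases "c = 0")
           (auto simp: lookup_add coef_ev2 h simp flip: E_def)
    qed
    hence "eqm (hi p (Suc d)) (e + ev2 h Y3 Z3 + ev2 h X3 (Y3 + Z3)) (ev2 h (X3 + Y3) Z3 + ev2 h X3 Y3)"
      by (auto simp: eqm_def hi_def)
    thus ?thesis by (auto simp: eqm_def e_def lookup_add lookup_minus algebra_simps)
  qed
  show thesis
  proof
    show "normalized2 (J + h)" using nrm(1) by (simp add: normalized2_def lookup_add h H_0)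
    show "eqm (hi p (Suc d)) (cobL (J + h) \<Psi>) (cobR (J + h) \<Phi>)"
      using cob_perturb(1)[OF nrm(1,3) h_0 d] lead eqm_sym[OF cob_perturb(2)[OF nrm(1,2) h_0 d]]
      by (blast intro: eqm_trans)
  qed
qed

theorem cohomologous:
  assumes nrm: "normalized3 \<Phi>" "normalized3 \<Psi>" and "pent \<Phi>" "pent \<Psi>"
    and c: "coef \<Phi> (1, p - 1, 1) = coef \<Psi> (1, p - 1, 1)"
  obtains J where "normalized2 J" "J \<in> free_space (box p)" "eqm (out p) (cobL J \<Psi>) (cobR J \<Phi>)"
proof -
  have one: "normalized2 1"
    by (auto simp: normalized2_def lookup_one zero_prod_def when_def)
  have ex: "\<exists>J. normalized2 J \<and> eqm (hi p (Suc d)) (cobL J \<Psi>) (cobR J \<Phi>)" for d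
  proof (induction d)
    case 0
    have "eqm (hi p 1) (cobL 1 \<Psi>) (cobR 1 \<Phi>)"
      using cob_one(1)[OF one nrm(2)] eqm_sym[OF cob_one(2)[OF one nrm(1)]] by (rule eqm_trans)
    thus ?case using one by auto
  next
    case (Suc d)
    thus ?case by (metis assms cob_step zero_less_Suc)
  qed
  obtain N where "\<forall>d\<ge>N. hi p d = (out p :: (nat \<times> nat \<times> nat) set)" using hi_large[of p] by blast
  hence "hi p (Suc N) = (out p :: (nat \<times> nat \<times> nat) set)" by simp
  with ex[of N] obtain J where J: "normalized2 J" "eqm (out p) (cobL J \<Psi>) (cobR J \<Phi>)" by auto
  \<comment> \<open>Membership in the box is not tracked during the induction; truncating at the end
    does not affect the congruence.\<close>
  have t: "eqm (out p) (trunc p J) J" by (rule trunc_eqm)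
  show thesis
  proof
    show "normalized2 (trunc p J)"
      using J(1) p_pos by (auto simp: normalized2_def coef_trunc)
    have "eqm (out p) (cobL (trunc p J) \<Psi>) (cobL J \<Psi>)"
      unfolding cobL_def by (intro eqm_mult eqm_refl eqm_ev2_out[OF t])
    moreover have "eqm (out p) (cobR J \<Phi>) (cobR (trunc p J) \<Phi>)"
      unfolding cobR_def by (rule eqm_sym) (intro eqm_mult eqm_refl eqm_ev2_out[OF t])
    ultimately show "eqm (out p) (cobL (trunc p J) \<Psi>) (cobR (trunc p J) \<Phi>)"
      using J(2) by (blast intro: eqm_trans)
  qed simp
qed

end

section \<open>The associators \<open>1 + c x \<sigma>(y, z)\<close>\<close>

context char_p
begin

text \<open>Coefficients of divided powers. For n >= p the factorial is zero in \<open>'k\<close>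
  and the value is the default 0 of division by zero.\<close>

definition ifact :: "nat \<Rightarrow> 'k" where
  "ifact n = 1 / of_nat (fact n)"

text \<open>Since \<open>(p-1)! \<sigma>(y, z) = ((y+z)\<^sup>p - y\<^sup>p - z\<^sup>p) / p\<close> over the integers, this is the standard
  generator of the second additive cohomology of \<open>\<alpha>\<^sub>p\<close>.\<close>

definition sigma :: "nat \<times> nat \<Rightarrow>\<^sub>0 'k" where
  "sigma = (\<Sum>i = 1..p - 1. scl (ifact i * ifact (p - i)) (bvec (i, p - i)))"

text \<open>A one-parameter family, so that \<open>Phi p\<close>, its rescalings, its inverse and
  the trivial associator are treated together.\<close>

definition PhiC :: "'k \<Rightarrow> nat \<times> nat \<times> nat \<Rightarrow>\<^sub>0 'k" where
  "PhiC c = 1 + scl c (X3 * ev2 sigma Y3 Z3)"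

lemma ifact_0 [simp]: "ifact 0 = 1"
  by (simp add: ifact_def)

lemma coef_sigma: "coef sigma (a, b) = (if a + b = p \<and> 0 < a \<and> 0 < b then ifact a * ifact b else 0)"
proof -
  have "coef sigma (a, b) = (\<Sum>i = 1..p - 1. if i = a then if a + b = p then ifact a * ifact b else 0 else 0)"
    unfolding sigma_def lookup_sum by (intro sum.cong) (auto simp: lookup_scl coef_bvec)
  thus ?thesis by auto
qed

lemma binom_ifact:
  assumes "a + b < p"
  shows "of_nat (a + b choose a) * ifact (a + b) = ifact a * ifact b"
proof -
  have "fact a * fact b * (a + b choose a) = (fact (a + b) :: nat)"
    using binomial_fact_lemma[of a "a + b"] by simp
  hence "of_nat (fact a) * of_nat (fact b) * of_nat (a + b choose a) = (of_nat (fact (a + b)) :: 'k)"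
    by (metis of_nat_mult)
  thus ?thesis
    using fact_neq_0[of a] fact_neq_0[of b] fact_neq_0[of "a + b"] assms
    by (simp add: ifact_def field_simps)
qed

lemma ifact_binom:
  assumes "n < p" "j \<le> n"
  shows "ifact j * ifact (n - j) = ifact n * of_nat (n choose j)"
  using binom_ifact[of j "n - j"] assms by (simp add: mult.commute)

text \<open>In Vandermonde's sum every binom(p, k) with 0 < k <= r < p vanishes mod p.\<close>

lemma binom_p_add:
  assumes "r < p"
  shows "of_nat (p + r choose r) = (1 :: 'k)"
proof -
  have "of_nat (p + r choose r) = (\<Sum>k\<le>r. of_nat (p choose k) * of_nat (r choose (r - k)) :: 'k)"
    unfolding vandermonde[symmetric, of p r r] by simp
  also have "\<dots> = (\<Sum>k\<le>r. if k = 0 then 1 else 0)"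
  proof (rule sum.cong)
    fix k assume "k \<in> {..r}"
    thus "of_nat (p choose k) * of_nat (r choose (r - k)) = (if k = 0 then 1 else 0 :: 'k)"
      using binom_eq_0[of k "p - k"] assms by auto
  qed simp
  also have "\<dots> = 1" by simp
  finally show ?thesis .
qed

text \<open>Both factors are homogeneous of degree p, hence the condition 2p. There, pulling out the
  inverse factorials turns the sum into Vandermonde's sum for binom(b+c, r) = binom(p+r, r), which
  is 1. The value is symmetric in a, b, c, which the quadratic relation exploits.\<close>

lemma sigma_convolution:
  assumes "a < p" "b < p" "c < p"
  shows "(\<Sum>j\<le>b. \<Sum>l\<le>c. (if a + j + l = p then ifact a * ifact j * ifact l else 0) * coef sigma (b - j, c - l)) =
    (if a + b + c = 2 * p then ifact a * ifact b * ifact c else 0)"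
proof (cases "a + b + c = 2 * p")
  case False
  have "(\<Sum>j\<le>b. \<Sum>l\<le>c. (if a + j + l = p then ifact a * ifact j * ifact l else 0) * coef sigma (b - j, c - l)) = 0"
    using False by (intro sum.neutral ballI) (auto simp: coef_sigma)
  thus ?thesis using False by simp
next
  case True
  \<comment> \<open>The first factor forces j + l = p - a; the condition on \<open>sigma\<close> is
    then automatic from b + c = p + r, and r < b, r < c keeps its exponents positive.\<close>
  define r where "r = p - a"
  have r: "0 < r" "r < p" "a + r = p" "b + c = p + r" using assms True by (auto simp: r_def)
  have "(\<Sum>j\<le>b. \<Sum>l\<le>c. (if a + j + l = p then ifact a * ifact j * ifact l else 0) * coef sigma (b - j, c - l)) =
        (\<Sum>j\<le>b. \<Sum>l\<le>c. if l = r - j then if j \<le> r then ifact a * ifact b * ifact c * (of_nat (b choose j) * of_nat (c choose (r - j))) else 0 else 0)"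
  proof (intro sum.cong refl)
    fix j l assume jl: "j \<in> {..b}" "l \<in> {..c}"
    show "(if a + j + l = p then ifact a * ifact j * ifact l else 0) * coef sigma (b - j, c - l) =
      (if l = r - j then if j \<le> r then ifact a * ifact b * ifact c * (of_nat (b choose j) * of_nat (c choose (r - j))) else 0 else 0)"
    proof (cases "j \<le> r \<and> l = r - j")
      case True
      hence "a + j + l = p" "b - j + (c - l) = p" "0 < b - j" "0 < c - l" using jl r assms by auto
      moreover have "ifact j * ifact (b - j) = ifact b * of_nat (b choose j)"
        "ifact l * ifact (c - l) = ifact c * of_nat (c choose l)"
        using ifact_binom jl assms by auto
      ultimately show ?thesis using True by (simp add: coef_sigma) (metis mult.assoc mult.left_commute)
    qed (use r in auto)
  qed
  also have "\<dots> = (\<Sum>j\<le>b. if j \<le> r then ifact a * ifact b * ifact c * (of_nat (b choose j) * of_nat (c choose (r - j))) else 0)"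
    by (intro sum.cong) (auto simp: not_le binomial_eq_0)
  also have "\<dots> = (\<Sum>j\<le>r. ifact a * ifact b * ifact c * (of_nat (b choose j) * of_nat (c choose (r - j))))"
    by (rule sum.mono_neutral_cong) (auto simp: not_le binomial_eq_0)
  also have "\<dots> = ifact a * ifact b * ifact c * of_nat (\<Sum>j\<le>r. (b choose j) * (c choose (r - j)))"
    by (simp add: sum_distrib_left)
  also have "\<dots> = ifact a * ifact b * ifact c"
    by (simp only: vandermonde r(4) binom_p_add[OF r(2)] mult_1_right)
  finally show ?thesis using True by simp
qed

text \<open>Formally both sides are ((x+y+z)^p - x^p - y^p - z^p) / p!, whose coefficients are
  products of inverse factorials. Computing each against this common value yields the additive
  2-cocycle identity.\<close>

lemma sigma_cocycle:
  assumes "a < p" "b < p" "c < p"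
  shows "coef (ev2 sigma X3 (Y3 + Z3) + ev2 sigma Y3 Z3) (a, b, c) =
      (if a + b + c = p then ifact a * ifact b * ifact c else 0)" (is ?L)
    and "coef (ev2 sigma (X3 + Y3) Z3 + ev2 sigma X3 Y3) (a, b, c) =
      (if a + b + c = p then ifact a * ifact b * ifact c else 0)" (is ?R)
proof -
  have 1: "of_nat (a + b choose a) * (ifact (a + b) * x) = ifact a * (ifact b * x)" if "a + b < p" for a b x
    using binom_ifact[OF that] by (metis mult.assoc)
  show ?L using assms 1[of b c "ifact a"] 
    by (cases "a = 0") (auto simp: lookup_add coef_ev2 coef_sigma mult_ac)
  show ?R using assms 1[of a b "ifact c"]
    by (cases "c = 0") (auto simp: lookup_add coef_ev2 coef_sigma mult_ac)
qed

lemma sigma_hi: "eqm (hi p p) sigma 0"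
  by (auto simp: eqm_def hi_def coef_sigma)

text \<open>Total degree 2p in two variables forces an exponent of at least
  \<open>p\<close>.\<close>

lemma sigma_square: "eqm (out p) (sigma * sigma) 0"
  by (rule eqm_mono[OF eqm_hi_0_mult[OF sigma_hi sigma_hi]]) (auto simp: hi_def box_def le_max_iff_disj)

text \<open>Put t = s1 + s2, which equals s3 + s4 after truncation. As s2 and s4 square to zero, s1
  s2 = t s2 and s3 s4 = t s4, and these agree by the symmetry of the convolution. A triple product
  has degree 3p in three variables and vanishes.\<close>

lemma sigma_relations:
  defines "s1 \<equiv> ev2 sigma X3 (Y3 + Z3)" and "s2 \<equiv> ev2 sigma Y3 Z3"
    and "s3 \<equiv> ev2 sigma (X3 + Y3) Z3" and "s4 \<equiv> ev2 sigma X3 Y3"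
  shows "eqm (out p) (s1 + s2 - s3 - s4) 0" "eqm (out p) (s1 * s2 - s3 * s4) 0"
    "eqm (out p) (s2 * s2) 0" "eqm (out p) (s2 * s3 * s4) 0"
proof -
  show *: "eqm (out p) (s1 + s2 - s3 - s4) 0"
    using sigma_cocycle by (auto simp: eqm_def box_def s1_def s2_def s3_def s4_def lookup_minus lookup_add diff_diff_eq)
  show s2: "eqm (out p) (s2 * s2) 0"
    using eqm_ev2_out(1)[OF sigma_square] by (simp add: s2_def ev2_hom)
  have s4: "eqm (out p) (s4 * s4) 0"
    using eqm_ev2_out(2)[OF sigma_square] by (simp add: s4_def ev2_hom)
  have "eqm (hi p (p + p + p)) (s2 * s3 * s4) 0"
    unfolding s2_def s3_def s4_def
    by (intro eqm_hi_0_mult) (use eqm_ev2_hi[OF sigma_hi] in \<open>auto simp: ev2_hom\<close>)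
  thus "eqm (out p) (s2 * s3 * s4) 0"
    by (rule eqm_mono) (auto simp: hi_def box_def le_max_iff_disj)
  have t: "coef (s1 + s2) (a, b, c) = (if a + b + c = p then ifact a * ifact b * ifact c else 0)"
    if "a < p" "b < p" "c < p" for a b c
    using sigma_cocycle(1)[OF that] by (simp add: s1_def s2_def)
  have c2: "coef s2 (a, b, c) = (if a = 0 then coef sigma (b, c) else 0)" for a b c
    by (simp add: s2_def coef_ev2)
  have "eqm (out p) ((s1 + s2) * s2) ((s1 + s2) * s4)"
  proof -
    have "coef ((s1 + s2) * s2) (a, b, c) = (if a + b + c = 2 * p then ifact a * ifact b * ifact c else 0)"
      "coef ((s1 + s2) * s4) (a, b, c) = (if a + b + c = 2 * p then ifact a * ifact b * ifact c else 0)"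
      if abc: "a < p" "b < p" "c < p" for a b c
    proof -
      have "coef ((s1 + s2) * s2) (a, b, c) =
        (\<Sum>i\<le>a. if i = a then \<Sum>j\<le>b. \<Sum>l\<le>c. (if i + j + l = p then ifact i * ifact j * ifact l else 0) * coef sigma (b - j, c - l) else 0)"
        unfolding coef_times_triple
        by (rule sum.cong) (use abc in \<open>auto simp: t c2 intro!: sum.cong\<close>)
      thus "coef ((s1 + s2) * s2) (a, b, c) = (if a + b + c = 2 * p then ifact a * ifact b * ifact c else 0)"
        by (simp add: sigma_convolution[OF abc])
      \<comment> \<open>Here \<open>sigma\<close> sits in the first two variables; rotating (a, b,
        c) to (c, a, b) makes \<open>sigma_convolution\<close> applicable.\<close>
      have "coef ((s1 + s2) * s4) (a, b, c) =
        (\<Sum>i\<le>a. \<Sum>j\<le>b. \<Sum>l\<le>c. if l = c then (if c + i + j = p then ifact c * ifact i * ifact j else 0) * coef sigma (a - i, b - j) else 0)"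
        unfolding coef_times_triple
        by (intro sum.cong) (use abc in \<open>auto simp: t s4_def coef_ev2 ac_simps\<close>)
      also have "\<dots> = (if c + a + b = 2 * p then ifact c * ifact a * ifact b else 0)"
        using sigma_convolution[of c a b] abc by simp
      finally show "coef ((s1 + s2) * s4) (a, b, c) = (if a + b + c = 2 * p then ifact a * ifact b * ifact c else 0)"
        by (simp add: ac_simps)
    qed
    thus ?thesis by (auto simp: eqm_def box_def)
  qed
  hence "eqm (out p) ((s1 + s2) * s2 - (s1 + s2) * s4) 0"
    by (simp add: eqm_iff_diff[symmetric])
  moreover have "eqm (out p) ((s1 + s2 - s3 - s4) * s4) 0"
    by (rule eqm_0_mult_left[OF * out_upper])
  ultimately have "eqm (out p) (((s1 + s2) * s2 - (s1 + s2) * s4) + ((s1 + s2 - s3 - s4) * s4) - s2 * s2 + s4 * s4) (0 + 0 - 0 + 0)"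
    by (intro eqm_add eqm_diff s2 s4)
  thus "eqm (out p) (s1 * s2 - s3 * s4) 0"
    by (simp add: algebra_simps)
qed

lemma pent_PhiC: "pent (PhiC c)"
proof -
  define S1 :: "nat \<times> nat \<times> nat \<times> nat \<Rightarrow>\<^sub>0 'k" where "S1 = ev2 sigma Y4 (Z4 + W4)"
  define S2 :: "nat \<times> nat \<times> nat \<times> nat \<Rightarrow>\<^sub>0 'k" where "S2 = ev2 sigma Z4 W4"
  define S3 :: "nat \<times> nat \<times> nat \<times> nat \<Rightarrow>\<^sub>0 'k" where "S3 = ev2 sigma (Y4 + Z4) W4"
  define S4 :: "nat \<times> nat \<times> nat \<times> nat \<Rightarrow>\<^sub>0 'k" where "S4 = ev2 sigma Y4 Z4"
  \<comment> \<open>The scalar \<open>c\<close> as a constant polynomial, so that the expansion is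
    pure ring arithmetic.\<close>
  define C :: "nat \<times> nat \<times> nat \<times> nat \<Rightarrow>\<^sub>0 'k" where "C = scl c 1"
  have C: "scl c v = C * v" for v by (simp add: C_def scl_mult_left)
  note lift = sigma_relations[THEN eqm_ev3_out(1), unfolded ev3_hom(8)]
  have R: "eqm (out p) (S1 + S2 - S3 - S4) 0" "eqm (out p) (S1 * S2 - S3 * S4) 0"
    "eqm (out p) (S2 * S2) 0" "eqm (out p) (S2 * S3 * S4) 0"
    using lift by (simp_all add: ev3_hom S1_def S2_def S3_def S4_def)
  \<comment> \<open>The difference of the two sides of the pentagon, sorted by powers of
    \<open>C\<close>, \<open>X4\<close> and \<open>Y4\<close>. The mixed quadratic part S1 S2 - S2
    S3 - S2 S4 is rewritten as (S1 + S2 - S3 - S4) S2 - S2 S2.\<close>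
  have "eqm (out p) ((S1 + S2 - S3 - S4) * (C * X4) + (S1 * S2 - S3 * S4) * (C * C * X4 * X4) +
      ((S1 + S2 - S3 - S4) * (S2 * C * C * X4 * Y4) - (S2 * S2) * (C * C * X4 * Y4)) -
      (S2 * S3 * S4) * (C * C * C * X4 * X4 * Y4)) (0 + 0 + (0 - 0) - 0)"
    by (intro eqm_add eqm_diff eqm_0_mult_left R out_upper)
  hence "eqm (out p) ((1 + C * (X4 * S1)) * (1 + C * ((X4 + Y4) * S2)) -
      (1 + C * (Y4 * S2)) * (1 + C * (X4 * S3)) * (1 + C * (X4 * S4))) 0"
    by (simp add: algebra_simps)
  thus ?thesis
    unfolding pent_def PhiC_def
    by (subst eqm_iff_diff) (simp add: ev3_hom C S1_def S2_def S3_def S4_def)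
qed

lemma coef_PhiC: "coef (PhiC c) (a, b, d) =
  (if a = 0 \<and> b = 0 \<and> d = 0 then 1 else 0) + (if a = 1 then c * coef sigma (b, d) else 0)"
proof -
  have "X3 * ev2 sigma Y3 Z3 = X1 \<boxtimes> sigma"
    using tens_mult[of X1 1 1 sigma] by (simp add: var_tens(3) ev_tens_2(1))
  thus ?thesis
    by (auto simp: PhiC_def lookup_add lookup_scl X1_def coef_bvec lookup_one zero_prod_def)
qed

lemma normalized3_PhiC: "normalized3 (PhiC c)"
  by (auto simp: normalized3_def coef_PhiC coef_sigma)

lemma PhiC_in_box: "PhiC c \<in> free_space (box p)"
  using prime_gt_1_nat[OF prime_p]
  by (auto simp: free_space_def box_def in_keys_iff coef_PhiC coef_sigma split: if_splits)

text \<open>Since i! = i (i-1)!, the coefficient (1/i) binom(p-1, i-1) equals (p-1)! / (i!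
  (p-i)!).\<close>

lemma Phi_eq: "Phi p = PhiC (of_nat (fact (p - 1)))"
proof (rule poly_mapping_eqI)
  fix k :: "nat \<times> nat \<times> nat"
  obtain a b d where k: "k = (a, b, d)" by (cases k)
  have "coef (Phi p) (a, b, d) = (if a = 0 \<and> b = 0 \<and> d = 0 then 1 else 0) +
      (\<Sum>i = 1..p - 1. if i = b then if a = 1 \<and> b + d = p then 1 / of_nat b * of_nat (p - 1 choose (b - 1)) else 0 else (0 :: 'k))"
    unfolding Phi_def lookup_add lookup_sum
    by (intro arg_cong2[of _ _ _ _ plus] sum.cong) (auto simp: lookup_scl coef_bvec)
  moreover have "1 / of_nat b * of_nat (p - 1 choose (b - 1)) = of_nat (fact (p - 1)) * (ifact b * ifact (p - b))"
    if "0 < b" "b < p"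
  proof -
    have "fact (b - 1) * fact (p - b) * (p - 1 choose (b - 1)) = (fact (p - 1) :: nat)"
      using binomial_fact_lemma[of "b - 1" "p - 1"] that by simp
    hence "(of_nat (fact (b - 1)) * of_nat (fact (p - b)) * of_nat (p - 1 choose (b - 1)) :: 'k) = of_nat (fact (p - 1))"
      by (metis of_nat_mult)
    moreover have "(of_nat (fact b) :: 'k) = of_nat b * of_nat (fact (b - 1))"
      using that by (metis fact_reduce of_nat_mult of_nat_id)
    ultimately show ?thesis
      using fact_neq_0[of "b - 1"] fact_neq_0[of "p - b"] of_nat_neq_0[of b] that
      by (simp add: ifact_def field_simps)
  qed
  ultimately show "coef (Phi p) k = coef (PhiC (of_nat (fact (p - 1)))) k"
    unfolding k coef_PhiC coef_sigma by auto
qed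

end

section \<open>Truncated polynomial algebras\<close>

text \<open>A property stable under tensor products, so that the powers two to four of the group
  algebra share every lemma on units, inverses and locality.\<close>

definition trunc_alg :: "nat \<Rightarrow> ('a::monomial, 'k::field, 'z) based_alg_scheme \<Rightarrow> bool" where
  "trunc_alg p A \<longleftrightarrow> basis A = box p \<and> amult A = (\<lambda>u v. trunc p (u * v)) \<and> aone A = 1"

lemma free_space_add: "u \<in> free_space B \<Longrightarrow> v \<in> free_space B \<Longrightarrow> u + v \<in> free_space B"
  using keys_add[of u v] by (auto simp: free_space_def)

lemma free_space_0 [simp]: "0 \<in> free_space B"
  by (simp add: free_space_def)

lemma free_space_minus: "u \<in> free_space B \<Longrightarrow> - u \<in> free_space B"
  by (auto simp: free_space_def in_keys_iff)

lemma free_space_scl: "u \<in> free_space B \<Longrightarrow> scl c u \<in> free_space B"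
  by (auto simp: free_space_def in_keys_iff lookup_scl)

lemma free_space_1: "0 < p \<Longrightarrow> 1 \<in> free_space (box p)"
  by (auto simp: free_space_def box_def mx_0)

lemma trunc_1: "0 < p \<Longrightarrow> trunc p 1 = 1"
  by (simp add: trunc_id free_space_1)

lemma trunc_alg_tensor:
  assumes "trunc_alg p A" "trunc_alg p C"
  shows "trunc_alg p (tensor_alg A C)"
proof -
  have t: "trunc p u \<boxtimes> trunc p v = trunc p (u \<boxtimes> v)"
    for u :: "'a \<Rightarrow>\<^sub>0 'b" and v :: "'d \<Rightarrow>\<^sub>0 'b"
    by (rule poly_mapping_eqI) (auto simp: coef_trunc split: prod.splits)
  have "amult (tensor_alg A C) u v = trunc p (u * v)" for u v
    unfolding tensor_alg_def using assms
    by (auto intro!: bil_ext_eqI simp: trunc_alg_def bvec_mult t tens_bvec split: prod.splits)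
  thus ?thesis
    using assms by (auto simp: trunc_alg_def tensor_alg_def box_Times tens_1_1)
qed

context
  fixes A :: "('a::monomial, 'k::field, 'z) based_alg_scheme" and p :: nat
  assumes A: "trunc_alg p A" and p: "0 < p"
begin

lemma carrier_alg_ring: "carrier (alg_ring A) = free_space (box p)"
  and mult_alg_ring: "u \<otimes>\<^bsub>alg_ring A\<^esub> v = trunc p (u * v)"
  and one_alg_ring: "\<one>\<^bsub>alg_ring A\<^esub> = 1"
  and add_alg_ring: "u \<oplus>\<^bsub>alg_ring A\<^esub> v = u + v"
  and zero_alg_ring: "\<zero>\<^bsub>alg_ring A\<^esub> = 0"
  using A by (simp_all add: alg_ring_def trunc_alg_def)

lemmas alg_ring_simps = carrier_alg_ring mult_alg_ring one_alg_ring add_alg_ring zero_alg_ring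

lemma cring_alg_ring: "cring (alg_ring A)"
proof (rule cringI)
  show "abelian_group (alg_ring A)"
    by (rule abelian_groupI)
       (auto simp: alg_ring_simps free_space_add add.assoc add.commute
         intro!: bexI[of _ "- x" for x] free_space_minus)
  show "comm_monoid (alg_ring A)"
    by (rule comm_monoidI)
       (auto simp: alg_ring_simps trunc_mult trunc_id free_space_1 p mult_ac)
qed (simp add: alg_ring_simps distrib_right lin_add)

lemma k_algebra_trunc_alg: "k_algebra A"
  unfolding k_algebra_def using cring.axioms(1)[OF cring_alg_ring] A
  by (auto simp: trunc_alg_def scl_mult_left scl_mult_right lin_scl)

lemma ainv_eqI: "u \<in> free_space (box p) \<Longrightarrow> v \<in> free_space (box p) \<Longrightarrow> trunc p (u * v) = 1 \<Longrightarrow> ainv A u = v"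
  using comm_monoid.comm_inv_char[OF cring.axioms(2)[OF cring_alg_ring]] by (simp add: alg_ring_simps)

lemma Units_alg_ring_iff:
  "u \<in> Units (alg_ring A) \<longleftrightarrow> u \<in> free_space (box p) \<and> (\<exists>v\<in>free_space (box p). trunc p (u * v) = 1)"
  unfolding Units_def by (auto simp: alg_ring_simps mult.commute)

lemma UnitsI: "u \<in> free_space (box p) \<Longrightarrow> coef u 0 \<noteq> 0 \<Longrightarrow> u \<in> Units (alg_ring A)"
  unfolding Units_alg_ring_iff using eqm_inverse[of u p]
  by (metis eqm_out_iff trunc_1[OF p])

lemma ainv_props:
  assumes "u \<in> Units (alg_ring A)"
  shows "ainv A u \<in> free_space (box p)" "eqm (out p) (u * ainv A u) 1" "eqm (out p) (ainv A u * u) 1"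
proof -
  obtain v where v: "v \<in> free_space (box p)" "trunc p (u * v) = 1" "u \<in> free_space (box p)"
    using assms by (auto simp: Units_alg_ring_iff)
  hence "ainv A u = v" by (intro ainv_eqI)
  thus "ainv A u \<in> free_space (box p)" "eqm (out p) (u * ainv A u) 1" "eqm (out p) (ainv A u * u) 1"
    using v by (auto simp: eqm_out_iff trunc_1[OF p] mult.commute)
qed

text \<open>An element with nonzero constant term is a unit, so every proper left ideal lies in the
  ideal \<open>?I\<close> of elements with constant term 0.\<close>

lemma local_trunc_alg: "local_algebra A"
proof -
  let ?R = "alg_ring A" and ?I = "{u \<in> free_space (box p) :: ('a \<Rightarrow>\<^sub>0 'k) set. coef u 0 = 0}"
  interpret cring ?R by (rule cring_alg_ring)
  have coef_mult: "coef (trunc p (u * v)) 0 = coef u 0 * coef v 0" for u v :: "'a \<Rightarrow>\<^sub>0 'k"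
  proof -
    have "eqm (hi p 1) u (scl (coef u 0) 1)" "eqm (hi p 1) v (scl (coef v 0) 1)"
      by (auto simp: eqm_hi_1 lookup_scl)
    from eqm_mult_gen[OF this hi_upper] show ?thesis
      using p by (simp add: eqm_hi_1 coef_trunc mx_0 lookup_scl scl_mult_left)
  qed
  have I: "left_ideal ?I ?R"
    unfolding left_ideal_def
  proof
    show "additive_subgroup ?I ?R"
    proof (rule additive_subgroupI, rule add.subgroupI)
      show "?I \<noteq> {}" using free_space_0 by (auto intro!: exI[of _ 0])
      fix a assume a: "a \<in> ?I"
      hence "\<ominus>\<^bsub>?R\<^esub> a = - a"
        by (intro minus_equality) (auto simp: alg_ring_simps free_space_minus)
      thus "\<ominus>\<^bsub>?R\<^esub> a \<in> ?I" using a by (simp add: free_space_minus)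
    qed (auto simp: alg_ring_simps free_space_add lookup_add)
  qed (simp add: alg_ring_simps coef_mult)
  have one: "1 \<notin> ?I" by simp
  have sub: "L \<subseteq> ?I" if L: "left_ideal L ?R" "L \<noteq> carrier ?R" for L
  proof
    interpret L: additive_subgroup L ?R using L(1) by (simp add: left_ideal_def)
    fix u assume u: "u \<in> L"
    hence uf: "u \<in> free_space (box p)" using L.a_subset by (auto simp: carrier_alg_ring)
    have "coef u 0 = 0"
    proof (rule ccontr)
      assume "coef u 0 \<noteq> 0"
      then obtain v where v: "v \<in> free_space (box p)" "trunc p (u * v) = 1"
        using UnitsI[OF uf] by (auto simp: Units_alg_ring_iff)
      have "trunc p (v * u) \<in> L"
        using L(1) u v(1) unfolding left_ideal_def by (simp add: alg_ring_simps)
      hence "1 \<in> L" using v(2) by (simp add: mult.commute)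
      hence "w \<in> L" if "w \<in> free_space (box p)" for w
        using L(1) that trunc_id[OF that] unfolding left_ideal_def alg_ring_simps
        by (metis mult_1_right)
      thus False using L(2) L.a_subset by (auto simp: carrier_alg_ring)
    qed
    thus "u \<in> ?I" using uf by simp
  qed
  have ne: "?I \<noteq> carrier ?R"
    using one free_space_1[OF p] unfolding carrier_alg_ring by blast
  show ?thesis
    unfolding local_algebra_def
  proof (rule ex1I[of _ ?I])
    show "maximal_left_ideal ?I ?R"
      unfolding maximal_left_ideal_def using I ne sub by blast
    fix L assume "maximal_left_ideal L ?R"
    thus "L = ?I" unfolding maximal_left_ideal_def using I ne sub by blast
  qed
qed

lemma commutative_trunc_alg: "commutative_alg A"
  using A by (simp add: commutative_alg_def trunc_alg_def mult.commute)

end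

lemma dim_free_space:
  assumes "finite B"
  shows "vector_space.dim scl (free_space B :: ('b \<Rightarrow>\<^sub>0 'k::field) set) = card B"
proof -
  interpret vector_space "scl :: 'k \<Rightarrow> ('b \<Rightarrow>\<^sub>0 'k) \<Rightarrow> _" by (rule vector_space_scl)
  have inj: "inj_on (bvec :: 'b \<Rightarrow> 'b \<Rightarrow>\<^sub>0 'k) B" 
    by (rule inj_onI, drule arg_cong[of _ _ Poly_Mapping.keys]) (simp add: bvec_def)
  show ?thesis
  proof (rule dim_unique)
    show "bvec ` B \<subseteq> (free_space B :: ('b \<Rightarrow>\<^sub>0 'k) set)" by (auto simp: free_space_def bvec_def)
    show "(free_space B :: ('b \<Rightarrow>\<^sub>0 'k) set) \<subseteq> span (bvec ` B)"
    proof
      fix v :: "'b \<Rightarrow>\<^sub>0 'k" assume "v \<in> free_space B"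
      hence "(\<Sum>b\<in>Poly_Mapping.keys v. scl (coef v b) (bvec b)) \<in> span (bvec ` B)"
        by (intro span_sum span_scale span_base) (auto simp: free_space_def)
      thus "v \<in> span (bvec ` B)" using expand_bvec[of v] by simp
    qed
    show "independent (bvec ` B :: ('b \<Rightarrow>\<^sub>0 'k) set)"
    proof (rule independent_if_scalars_zero)
      fix f :: "('b \<Rightarrow>\<^sub>0 'k) \<Rightarrow> 'k" and x :: "'b \<Rightarrow>\<^sub>0 'k"
      assume 0: "(\<Sum>x\<in>bvec ` B. scl (f x) x) = 0" and "x \<in> bvec ` B"
      then obtain b where b: "b \<in> B" "x = bvec b" by auto
      have "0 = coef (\<Sum>x\<in>bvec ` B. scl (f x) x) b" using 0 by simp
      also have "\<dots> = (\<Sum>c\<in>B. if c = b then f (bvec b) else 0)"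
        unfolding lookup_sum
        by (subst sum.reindex[OF inj], intro sum.cong) (auto simp: lookup_scl coef_bvec)
      also have "\<dots> = f x" using b assms by simp
      finally show "f x = 0" by simp
    qed (use assms in auto)
    show "card (bvec ` B :: ('b \<Rightarrow>\<^sub>0 'k) set) = card B" by (rule card_image[OF inj])
  qed
qed

section \<open>The group algebra of \<open>\<alpha>\<^sub>p\<close>\<close>

text \<open>The endomorphism x -> l x. Nonzero \<open>l\<close> gives the automorphisms that move
  the class of an associator; \<open>l = -1\<close> gives the antipode.\<close>

definition scal :: "'k::field \<Rightarrow> (nat \<Rightarrow>\<^sub>0 'k) \<Rightarrow> (nat \<Rightarrow>\<^sub>0 'k)" where
  "scal l f = ev1 f (scl l X1)"

lemma poly_hom_scal: "poly_hom (scal l)"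
  using poly_hom_ev(1) by (simp add: scal_def[abs_def])

lemma scl_power: "scl l (v :: 'b::comm_monoid_add \<Rightarrow>\<^sub>0 'k::field) ^ n = scl (l ^ n) (v ^ n)"
  by (induction n) (auto simp: scl_mult_left scl_mult_right scl_scl mult.commute)

lemma scal_bvec: "scal l (bvec n) = scl (l ^ n) (bvec n)"
  by (simp add: scal_def ev_bvec scl_power bvec_power)

lemma coef_scal: "coef (scal l f) n = l ^ n * coef f n"
  by (rule coef_lin) (auto simp: poly_homD[OF poly_hom_scal] scal_bvec lookup_scl coef_bvec)

lemma scal_trunc: "scal l (trunc p f) = trunc p (scal l f)"
  by (rule poly_mapping_eqI) (auto simp: coef_scal coef_trunc)

lemma scal_in_box: "f \<in> free_space (box p) \<Longrightarrow> scal l f \<in> free_space (box p)"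
  by (metis scal_trunc trunc_id trunc_in_free_space)

lemma scal_scal: "scal l (scal m f) = scal (l * m) f"
  by (rule poly_mapping_eqI) (auto simp: coef_scal power_mult_distrib)

lemma scal_1: "scal 1 f = f"
  by (rule poly_mapping_eqI) (auto simp: coef_scal)

lemma bij_scal: "l \<noteq> 0 \<Longrightarrow> bij_betw (scal l) (free_space (box p)) (free_space (box p))"
  by (rule bij_betwI[of _ _ _ "scal (1 / l)"]) (auto simp: scal_in_box scal_scal scal_1)

lemma Delta_scal: "Delta (scal l f) = tmap (scal l) (scal l) (Delta f)"
proof -
  note h = poly_hom_tmap[OF poly_hom_scal[of l] poly_hom_scal[of l]]
  have "tmap (scal l) (scal l) X2 = scl l X2" "tmap (scal l) (scal l) Y2 = scl l Y2"
    by (simp_all add: X2_def Y2_def tmap_bvec scal_bvec tens_bvec lin_scl[OF lin_tens(1)] lin_scl[OF lin_tens(2)])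
  hence "tmap (scal l) (scal l) (Delta f) = ev1 f (scl l (X2 + Y2))"
    by (simp add: Delta_def hom_ev[OF h] poly_homD[OF h] scl_add)
  thus ?thesis by (simp add: scal_def Delta_def ev1_hom)
qed

lemma counit_kalpha: "counit (kalpha p) = (\<lambda>v. coef v 0)"
  by (simp add: kalpha_def)

lemma lin_contr [simp]: "lin (contr_left e)" "lin (contr_right e)"
  by (simp_all add: contr_left_def contr_right_def)

lemma coef_contr_left: "coef (contr_left (\<lambda>v. coef v 0) u) b = coef u (0, b)"
  using coef_lin[of "contr_left (\<lambda>v. coef v 0)" b "(0, b)" 1 u]
  by (auto simp: contr_left_def lookup_scl coef_bvec split: prod.splits if_splits)

lemma coef_contr_right: "coef (contr_right (\<lambda>v. coef v 0) u) a = coef u (a, 0)"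
  using coef_lin[of "contr_right (\<lambda>v. coef v 0)" a "(a, 0)" 1 u]
  by (auto simp: contr_right_def lookup_scl coef_bvec split: prod.splits if_splits)

lemma coef_tmap_contr:
  "coef (tmap id (contr_left (\<lambda>v. coef v 0)) u) (a, c) = coef u (a, 0, c)"
  "coef (tmap id (contr_right (\<lambda>v. coef v 0)) u) (a, c) = coef u (a, c, 0)"
proof -
  show "coef (tmap id (contr_left (\<lambda>v. coef v 0)) u) (a, c) = coef u (a, 0, c)"
    using coef_lin[of "tmap id (contr_left (\<lambda>v. coef v 0))" "(a, c)" "(a, 0, c)" 1 u]
    by (auto simp: tmap_bvec coef_bvec coef_contr_left split: if_splits)
  show "coef (tmap id (contr_right (\<lambda>v. coef v 0)) u) (a, c) = coef u (a, c, 0)"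
    using coef_lin[of "tmap id (contr_right (\<lambda>v. coef v 0))" "(a, c)" "(a, c, 0)" 1 u]
    by (auto simp: tmap_bvec coef_bvec coef_contr_right split: if_splits)
qed

lemma ev1_0: "ev1 h 0 = scl (coef h 0) (1 :: 'c::comm_monoid_add \<Rightarrow>\<^sub>0 'k::field)"
proof -
  have "lin (\<lambda>h. scl (coef h 0) (1 :: 'c \<Rightarrow>\<^sub>0 'k))"
    by (auto simp: lin_def lookup_add lookup_scl scl_add_left scl_scl)
  from ev1_hom(1) this show ?thesis
    by (rule lin_eqI[of "\<lambda>h. ev1 h 0" "\<lambda>h. scl (coef h 0) 1"])
       (auto simp: ev_bvec coef_bvec power_0_left)
qed

text \<open>An isomorphism from an arbitrary Hopf algebra is constrained only on
  \<open>free_space B\<close>, so the lemmas on globally linear maps do not apply to it.\<close>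

lemma linear_between_expand:
  assumes "linear_between B C f" "u \<in> free_space B"
  shows "f u = lin_ext (\<lambda>b. f (bvec b)) u"
proof -
  have f: "f (v + w) = f v + f w" "f (scl c v) = scl c (f v)"
    if "v \<in> free_space B" "w \<in> free_space B" for v w c
    using assms(1) that by (auto simp: linear_between_def)
  have b: "bvec b \<in> free_space B" if "b \<in> B" for b
    using that by (simp add: free_space_def bvec_def)
  have f0: "f 0 = 0" using f(2)[of 0 0 0] by simp
  have "f (\<Sum>b\<in>A. scl (coef u b) (bvec b)) = (\<Sum>b\<in>A. scl (coef u b) (f (bvec b))) \<and>
        (\<Sum>b\<in>A. scl (coef u b) (bvec b)) \<in> free_space B" if "finite A" "A \<subseteq> B" for A
    using that by (induction A rule: finite_induct) (auto simp: f0 f b free_space_add free_space_scl)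
  from this[of "Poly_Mapping.keys u"] show ?thesis
    using assms(2) expand_bvec[of u] by (simp add: lin_ext_def free_space_def)
qed

text \<open>\<open>tmap\<close> sees only the values on basis vectors, so \<open>f\<close> and
  \<open>g\<close> may be replaced by linear extensions.\<close>

lemma tmap_tens_on:
  assumes "linear_between B C f" "u \<in> free_space B" "g v = lin_ext (\<lambda>b. g (bvec b)) v"
  shows "tmap f g (u \<boxtimes> v) = f u \<boxtimes> g v"
proof -
  have "tmap f g = tmap (lin_ext (\<lambda>b. f (bvec b))) (lin_ext (\<lambda>b. g (bvec b)))"
    by (simp add: tmap_def)
  thus ?thesis
    using tmap_tens[of "lin_ext (\<lambda>b. f (bvec b))" "lin_ext (\<lambda>b. g (bvec b))" u v]
      linear_between_expand[OF assms(1,2)] assms(3) by simp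
qed

text \<open>Reads the basis sums of the antipode axioms as substitutions.\<close>

lemma lin_ext_trunc_ev:
  "lin_ext (\<lambda>(a, b). trunc p (s ^ a * t ^ b)) f = trunc p (ev2 f s t)"
  "lin_ext (\<lambda>(a, b, c). trunc p (s ^ a * t ^ b * r ^ c)) g = trunc p (ev3 g s t r)"
proof -
  show "lin_ext (\<lambda>(a, b). trunc p (s ^ a * t ^ b)) f = trunc p (ev2 f s t)"
    by (rule lin_eqI[OF lin_lin_ext lin_comp[OF lin_trunc ev2_hom(1)]]) (auto simp: ev_bvec)
  show "lin_ext (\<lambda>(a, b, c). trunc p (s ^ a * t ^ b * r ^ c)) g = trunc p (ev3 g s t r)"
    by (rule lin_eqI[OF lin_lin_ext lin_comp[OF lin_trunc ev3_hom(1)]]) (auto simp: ev_bvec)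
qed

context char_p
begin

section \<open>The quasi-Hopf structure attached to an associator\<close>

abbreviation kalpha_with :: "(nat \<times> nat \<times> nat \<Rightarrow>\<^sub>0 'k) \<Rightarrow> (nat, 'k) quasi_alg" where
  "kalpha_with \<Phi> \<equiv> with_associator (kalpha p) \<Phi>"

lemma kalpha_eq: "kalpha p = kalpha_with 1"
  by (simp add: kalpha_def with_associator_def bvec_0 tens_1_1)

lemma trunc_alg_kalpha_with: "trunc_alg p (kalpha_with \<Phi>)"
proof -
  have "bil_ext (\<lambda>i j. if i + j < p then bvec (i + j) else 0) u v = trunc p (u * v)"
    for u v :: "nat \<Rightarrow>\<^sub>0 'k"
    by (rule bil_ext_eqI) (auto simp: trunc_bvec)
  thus ?thesis by (auto simp: trunc_alg_def with_associator_def kalpha_def box_nat bvec_0)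
qed

lemmas trunc_alg2 = trunc_alg_tensor[OF trunc_alg_kalpha_with trunc_alg_kalpha_with]
lemmas trunc_alg3 = trunc_alg_tensor[OF trunc_alg_kalpha_with trunc_alg2]
lemmas trunc_alg4 = trunc_alg_tensor[OF trunc_alg_kalpha_with trunc_alg3]

lemma kalpha_with_simps:
  "comult (kalpha_with \<Phi>) = Delta" "counit (kalpha_with \<Phi>) = (\<lambda>v. coef v 0)" "assoc_elt (kalpha_with \<Phi>) = \<Phi>"
  "comult_id (kalpha_with \<Phi>) u = reassoc (tmap Delta id u)"
  "basis (kalpha_with \<Phi>) = box p" "amult (kalpha_with \<Phi>) u' v' = trunc p (u' * v')" "aone (kalpha_with \<Phi>) = 1"
  using trunc_alg_kalpha_with[of \<Phi>]
  by (auto simp: with_associator_def comult_kalpha counit_kalpha comult_id_def trunc_alg_def)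

lemma alg_kalpha_with_simps:
  "amult (alg2 (kalpha_with \<Phi>)) u2 v2 = trunc p (u2 * v2)" "aone (alg2 (kalpha_with \<Phi>)) = 1" "basis (alg2 (kalpha_with \<Phi>)) = box p"
  "amult (alg3 (kalpha_with \<Phi>)) u3 v3 = trunc p (u3 * v3)" "aone (alg3 (kalpha_with \<Phi>)) = 1" "basis (alg3 (kalpha_with \<Phi>)) = box p"
  "amult (alg4 (kalpha_with \<Phi>)) u4 v4 = trunc p (u4 * v4)" "aone (alg4 (kalpha_with \<Phi>)) = 1" "basis (alg4 (kalpha_with \<Phi>)) = box p"
  using trunc_alg2[of \<Phi> \<Phi>] trunc_alg3[of \<Phi> \<Phi> \<Phi>] trunc_alg4[of \<Phi> \<Phi> \<Phi> \<Phi>]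
  by (auto simp: trunc_alg_def)

lemma pentagon_iff: "pentagon (kalpha_with \<Phi>) \<Psi> \<longleftrightarrow> pent \<Psi>"
proof -
  have *: "comult_id (kalpha_with \<Phi>) = (\<lambda>u. reassoc (tmap Delta id u))" by (rule ext) (simp add: kalpha_with_simps)
  show ?thesis
    unfolding pentagon_def pent_def eqm_out_iff *
    by (simp only: kalpha_with_simps alg_kalpha_with_simps trunc_mult ev_tens_3)
qed

lemma associatorD:
  assumes "associator (kalpha p) \<Phi>"
  shows "\<Phi> \<in> free_space (box p)" "pent \<Phi>" "normalized3 \<Phi>"
proof -
  have "associator (kalpha_with 1) \<Phi>" using assms by (simp only: kalpha_eq[symmetric])
  note a = this[unfolded associator_def pentagon_iff kalpha_with_simps alg_kalpha_with_simps]
  show "pent \<Phi>" using a by simp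
  show "\<Phi> \<in> free_space (box p)"
    using a Units_alg_ring_iff[OF trunc_alg3 p_pos] by blast
  have 1: "coef (1 :: nat \<times> nat \<Rightarrow>\<^sub>0 'k) (a, b) = (if a = 0 \<and> b = 0 then 1 else 0)" for a b
    by (simp add: lookup_one zero_prod_def)
  have c: "contr_left (\<lambda>v. coef v 0) \<Phi> = 1" "tmap id (contr_left (\<lambda>v. coef v 0)) \<Phi> = 1"
    "tmap id (contr_right (\<lambda>v. coef v 0)) \<Phi> = 1"
    using a by blast+
  show "normalized3 \<Phi>"
    unfolding normalized3_def 1[symmetric] coef_contr_left[of \<Phi>, symmetric] coef_tmap_contr[of \<Phi>, symmetric] c
    by simp
qed

lemma Delta_trunc: "Delta (trunc p f) = trunc p (Delta f :: _ \<Rightarrow>\<^sub>0 'k)"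
proof -
  have "coef (Delta (trunc p f)) (a, b) = coef (trunc p (Delta f)) (a, b)" for a b
    using binom_eq_0[of a b] by (cases "a + b < p") (auto simp: coef_Delta coef_trunc)
  thus ?thesis by (auto intro: poly_mapping_eqI)
qed

lemma Delta_in_box: "f \<in> free_space (box p) \<Longrightarrow> Delta f \<in> free_space (box p :: (nat \<times> nat) set)" for f :: "nat \<Rightarrow>\<^sub>0 'k"
  using Delta_trunc[of f] trunc_id[of f] trunc_in_free_space by metis

lemma coassoc: "tmap id Delta (Delta f) = reassoc (tmap Delta id (Delta f))"
  by (simp add: ev_tens_2(3,4)) (simp add: Delta_def ev2_hom add.assoc)

lemma quasi_bialgebra_kalpha_with:
  assumes "\<Phi> \<in> free_space (box p)" "pent \<Phi>" "normalized3 \<Phi>"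
  shows "quasi_bialgebra (kalpha_with \<Phi>)"
proof -
  have U: "\<Phi> \<in> Units (alg_ring (alg3 (kalpha_with \<Phi>)))"
    using assms by (intro UnitsI[OF trunc_alg3 p_pos]) (auto simp: normalized3_def zero_prod_def)
  have "alg_hom (kalpha_with \<Phi>) (alg2 (kalpha_with \<Phi>)) Delta"
    unfolding alg_hom_def linear_between_def ring_hom_def
    by (auto simp: kalpha_with_simps alg_kalpha_with_simps alg_ring_simps[OF trunc_alg_kalpha_with p_pos] alg_ring_simps[OF trunc_alg2 p_pos]
        Delta_in_box poly_homD[OF poly_hom_Delta] Delta_trunc)
  moreover have "alg_character (kalpha_with \<Phi>) (\<lambda>v. coef v 0)"
    using p_pos by (auto simp: alg_character_def kalpha_with_simps lookup_add lookup_scl coef_trunc coef_times_nat)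
  moreover have "contr_left (\<lambda>v. coef v 0) (Delta h) = h" "contr_right (\<lambda>v. coef v 0) (Delta h) = h"
    for h :: "nat \<Rightarrow>\<^sub>0 'k"
    by (rule poly_mapping_eqI; simp add: coef_contr_left coef_contr_right coef_Delta)+
  \<comment> \<open>Conjugation by \<Phi> is trivial in a commutative algebra, so this is
    coassociativity; the outer truncation is harmless because \<open>?d\<close> lies in the
    box.\<close>
  moreover have "tmap id Delta (Delta h) = trunc p (trunc p (\<Phi> * reassoc (tmap Delta id (Delta h))) * ainv (alg3 (kalpha_with \<Phi>)) \<Phi>)"
    if "h \<in> free_space (box p)" for h
  proof -
    let ?d = "tmap id Delta (Delta h)" and ?I = "ainv (alg3 (kalpha_with \<Phi>)) \<Phi>"
    have d: "?d \<in> free_space (box p)"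
    proof -
      have "a < p \<and> b < p \<and> c < p" if "coef ?d (a, b, c) \<noteq> 0" for a b c
      proof -
        have "coef h (a + (b + c)) \<noteq> 0" using that by (auto simp: ev_tens_2(3) coef_ev2 coef_Delta)
        hence "a + (b + c) < p" using \<open>h \<in> free_space (box p)\<close> by (auto simp: free_space_def box_nat in_keys_iff)
        thus ?thesis by simp
      qed
      thus ?thesis by (auto simp: free_space_def box_def in_keys_iff)
    qed
    have "trunc p (\<Phi> * ?d * ?I) = trunc p (?d * (\<Phi> * ?I))" by (simp add: mult_ac)
    also have "\<dots> = trunc p (?d * 1)"
      unfolding eqm_out_iff[symmetric]
      by (intro eqm_mult eqm_refl ainv_props(2)[OF trunc_alg3 p_pos U])
    also have "\<dots> = ?d" using d by (simp add: trunc_id)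
    finally show ?thesis by (simp only: coassoc trunc_mult)
  qed
  moreover have "tmap id (contr_left (\<lambda>v. coef v 0)) \<Phi> = 1"
  proof -
    have "coef (tmap id (contr_left (\<lambda>v. coef v 0)) \<Phi>) (a, b) = coef 1 (a, b)" for a b
      using assms(3) unfolding normalized3_def by (simp add: coef_tmap_contr lookup_one zero_prod_def)
    thus ?thesis by (auto intro: poly_mapping_eqI)
  qed
  ultimately show ?thesis
    unfolding quasi_bialgebra_def
    using U k_algebra_trunc_alg[OF trunc_alg_kalpha_with p_pos] assms(2)
    by (simp only: kalpha_with_simps alg_kalpha_with_simps pentagon_iff) auto
qed

lemma linear_between_scal: "linear_between (box p) (box p) (scal l)"
  by (auto simp: linear_between_def scal_in_box poly_homD[OF poly_hom_scal])

lemma scl_1_trunc: "trunc p (scl c 1 :: nat \<Rightarrow>\<^sub>0 'k) = scl c 1"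
  by (intro trunc_id free_space_scl free_space_1 p_pos)

lemma scal_neg_bvec: "scal (- 1) (bvec n) = (scl (- 1) X1 :: nat \<Rightarrow>\<^sub>0 'k) ^ n"
  by (simp add: scal_def ev_bvec)

text \<open>Applying the antipode on one side of the coproduct and multiplying evaluates h(x + y) at
  (-x, x) or (x, -x), which gives the constant term h(0).\<close>

lemma antipode:
  "lin_ext (\<lambda>(a, b). trunc p (scal (- 1) (bvec a) * bvec b)) (Delta h) = scl (coef h 0) (1 :: nat \<Rightarrow>\<^sub>0 'k)"
  "lin_ext (\<lambda>(a, b). trunc p (bvec a * scal (- 1) (bvec b))) (Delta h) = scl (coef h 0) (1 :: nat \<Rightarrow>\<^sub>0 'k)"
proof -
  have 0: "scl (- 1) X1 + X1 = 0" "X1 + scl (- 1) X1 = 0"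
    by (auto intro!: poly_mapping_eqI simp: lookup_add lookup_scl)
  show "lin_ext (\<lambda>(a, b). trunc p (scal (- 1) (bvec a) * bvec b)) (Delta h) = scl (coef h 0) (1 :: nat \<Rightarrow>\<^sub>0 'k)"
    unfolding scal_neg_bvec unfolding bvec_power(1)[symmetric] lin_ext_trunc_ev
    by (simp add: Delta_def ev2_hom 0 ev1_0 scl_1_trunc)
  show "lin_ext (\<lambda>(a, b). trunc p (bvec a * scal (- 1) (bvec b))) (Delta h) = scl (coef h 0) (1 :: nat \<Rightarrow>\<^sub>0 'k)"
    unfolding scal_neg_bvec unfolding bvec_power(1)[symmetric] lin_ext_trunc_ev
    by (simp add: Delta_def ev2_hom 0 ev1_0 scl_1_trunc)
qed

lemma PhiC_0: "PhiC 0 = 1"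
  by (simp add: PhiC_def)

lemma hopf_algebra_kalpha: "hopf_algebra (kalpha_with 1)"
  unfolding hopf_algebra_def
proof (intro conjI exI[of _ "scal (- 1)"])
  show "quasi_bialgebra (kalpha_with 1)"
    unfolding PhiC_0[symmetric] by (intro quasi_bialgebra_kalpha_with PhiC_in_box pent_PhiC normalized3_PhiC)
qed (simp_all add: kalpha_with_simps alg_kalpha_with_simps linear_between_scal antipode)

text \<open>The linear terms cancel and the quadratic one contains sigma(y, z)^2, which vanishes
  after truncation.\<close>

lemma PhiC_inverse: "ainv (alg3 (kalpha_with \<Phi>)) (PhiC c) = PhiC (- c)"
proof (rule ainv_eqI[OF trunc_alg3 p_pos PhiC_in_box PhiC_in_box])
  let ?s = "ev2 sigma Y3 Z3 :: _ \<Rightarrow>\<^sub>0 'k"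
  define C :: "nat \<times> nat \<times> nat \<Rightarrow>\<^sub>0 'k" where "C = scl c 1"
  have "scl c v = C * v" "scl (- c) v = - (C * v)" for v
    by (auto simp: C_def scl_mult_left intro!: poly_mapping_eqI simp: lookup_scl)
  hence "PhiC c * PhiC (- c) = 1 - (?s * ?s) * (C * C * X3 * X3)"
    by (simp add: PhiC_def algebra_simps)
  moreover have "eqm (out p) \<dots> (1 - 0)"
    by (intro eqm_diff eqm_0_mult_left sigma_relations(3) out_upper eqm_refl)
  ultimately show "trunc p (PhiC c * PhiC (- c)) = 1"
    by (simp add: eqm_out_iff trunc_1[OF p_pos])
qed

text \<open>Substituting multiples of a single variable turns \<open>sigma\<close>, homogeneous of
  degree p, into a multiple of x^p = 0. Hence the antipode works with \<open>\<alpha>\<close> and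
  \<open>\<beta>\<close> both equal to 1.\<close>

lemma trunc_ev3_PhiC: "trunc p (ev3 (PhiC c) (scl l X1) (scl m X1) (scl n X1)) = 1"
proof -
  have "trunc p (ev2 sigma (scl m X1) (scl n X1)) = 0"
    unfolding sigma_def
    by (simp add: lin_sum[OF ev2_hom(1)] ev2_hom lin_sum[OF lin_trunc] lin_scl[OF lin_trunc] ev_bvec
        scl_power scl_mult_left scl_mult_right bvec_power bvec_mult trunc_bvec)
       (auto intro!: sum.neutral)
  hence "trunc p (scl l X1 * ev2 sigma (scl m X1) (scl n X1)) = 0"
    by (metis lin_0 lin_trunc mult_zero_right trunc_mult(2))
  thus ?thesis
    by (simp add: PhiC_def ev3_hom lin_add[OF lin_trunc] lin_scl[OF lin_trunc] trunc_1[OF p_pos])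
qed

lemma quasi_hopf_PhiC: "quasi_hopf_algebra (kalpha_with (PhiC c))"
proof -
  \<comment> \<open>Writing \<open>X1\<close> as \<open>scl 1 X1\<close> brings the factors without
    antipode into the shape required by \<open>trunc_ev3_PhiC\<close>.\<close>
  have X1: "bvec n = (scl 1 X1 :: nat \<Rightarrow>\<^sub>0 'k) ^ n" for n by (simp add: bvec_power)
  have "quasi_antipode (kalpha_with (PhiC c)) (scal (- 1)) 1 1"
    unfolding quasi_antipode_def kalpha_with_simps PhiC_inverse
  proof (intro conjI ballI)
    show "scal (- 1) (trunc p (u * v)) = trunc p (scal (- 1) v * scal (- 1) u)" for u v
      by (simp add: scal_trunc poly_homD[OF poly_hom_scal] mult.commute)
    show "lin_ext (\<lambda>(a, b, c). trunc p (trunc p (trunc p (trunc p (bvec a * 1) * scal (- 1) (bvec b)) * 1) * bvec c)) (PhiC c) = 1"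
      unfolding mult_1_right trunc_mult scal_neg_bvec unfolding X1 lin_ext_trunc_ev
      by (rule trunc_ev3_PhiC)
    show "lin_ext (\<lambda>(a, b, c). trunc p (trunc p (trunc p (trunc p (scal (- 1) (bvec a) * 1) * bvec b) * 1) * scal (- 1) (bvec c))) (PhiC (- c)) = 1"
      unfolding mult_1_right trunc_mult scal_neg_bvec unfolding X1 lin_ext_trunc_ev
      by (rule trunc_ev3_PhiC)
  qed (simp_all add: linear_between_scal poly_homD[OF poly_hom_scal]
        free_space_1[OF p_pos] trunc_mult antipode)
  moreover have "quasi_bialgebra (kalpha_with (PhiC c))"
    by (intro quasi_bialgebra_kalpha_with PhiC_in_box pent_PhiC normalized3_PhiC)
  ultimately show ?thesis
    unfolding quasi_hopf_algebra_def kalpha_with_simps using bij_scal[of "- 1 :: 'k" p] by auto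
qed

lemma cocommutative_kalpha_with: "cocommutative (kalpha_with \<Phi>)"
proof -
  have "coef (flip u) (a, b) = coef u (b, a)" for u :: "nat \<times> nat \<Rightarrow>\<^sub>0 'k" and a b
    using coef_lin[of flip "(a, b)" "(b, a)" 1 u]
    by (auto simp: flip_def coef_bvec split: prod.splits if_splits)
  moreover have "coef (Delta h) (b, a) = coef (Delta h :: _ \<Rightarrow>\<^sub>0 'k) (a, b)" for h a b
    using binomial_symmetric[of a "a + b"] by (simp add: coef_Delta add.commute[of b a])
  ultimately have "flip (Delta h) = (Delta h :: _ \<Rightarrow>\<^sub>0 'k)" for h
    by (intro poly_mapping_eqI) auto
  thus ?thesis by (simp add: cocommutative_def kalpha_with_simps)
qed

section \<open>Pseudotwists, equivalence and the classification\<close>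

lemma pseudotwist_iff: "pseudotwist (kalpha_with \<Phi>) J \<longleftrightarrow> J \<in> free_space (box p) \<and> normalized2 J"
proof -
  have n: "contr_left (\<lambda>v. coef v 0) J = 1 \<and> contr_right (\<lambda>v. coef v 0) J = 1 \<longleftrightarrow> normalized2 J"
    by (auto simp: poly_mapping_eq_iff fun_eq_iff coef_contr_left coef_contr_right normalized2_def lookup_one when_def)
  have "J \<in> Units (alg_ring (alg2 (kalpha_with \<Phi>)))" if "J \<in> free_space (box p)" "normalized2 J"
    using that by (intro UnitsI[OF trunc_alg2 p_pos]) (auto simp: normalized2_def zero_prod_def)
  thus ?thesis
    unfolding pseudotwist_def kalpha_with_simps n using Units_alg_ring_iff[OF trunc_alg2 p_pos] by blast
qed

text \<open>Substitution is multiplicative and compatible with truncation, so the factor built from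
  the inverse of \<open>J\<close> is inverse to the one built from \<open>J\<close>; multiplying by
  either passes between the two forms.\<close>

lemma twist_assoc_iff:
  assumes "J \<in> Units (alg_ring (alg2 (kalpha_with \<Phi>)))" "\<Psi> \<in> free_space (box p)"
  shows "assoc_elt (twist (kalpha_with \<Phi>) J) = \<Psi> \<longleftrightarrow> eqm (out p) (cobL J \<Psi>) (cobR J \<Phi>)"
proof -
  define J' where "J' = ainv (alg2 (kalpha_with \<Phi>)) J"
  define I where "I = ev2 J' Y3 Z3 * ev2 J' X3 (Y3 + Z3)"
  define M where "M = ev2 J Y3 Z3 * ev2 J X3 (Y3 + Z3)"
  have a: "assoc_elt (twist (kalpha_with \<Phi>) J) = trunc p (I * cobR J \<Phi>)"
    unfolding twist_def Let_def J'_def[symmetric]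
    by (simp add: kalpha_with_simps alg_kalpha_with_simps trunc_mult ev_tens_2 I_def cobR_def mult.assoc)
  have JJ: "eqm (out p) (J' * J) 1" unfolding J'_def by (rule ainv_props[OF trunc_alg2 p_pos assms(1)])
  have IM: "eqm (out p) (I * M) (1 * 1)"
  proof -
    have "I * M = ev2 (J' * J) Y3 Z3 * ev2 (J' * J) X3 (Y3 + Z3)"
      by (simp add: I_def M_def ev2_hom mult_ac)
    thus ?thesis using eqm_mult[OF eqm_ev2_out(1)[OF JJ] eqm_ev2_out(3)[OF JJ]] by (simp add: ev2_hom)
  qed
  have L: "cobL J \<Psi> = M * \<Psi>" by (simp add: cobL_def M_def)
  show ?thesis
  proof
    assume "assoc_elt (twist (kalpha_with \<Phi>) J) = \<Psi>"
    hence "eqm (out p) \<Psi> (I * cobR J \<Phi>)" unfolding a using trunc_eqm by blast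
    hence "eqm (out p) (M * \<Psi>) (M * (I * cobR J \<Phi>))" by (intro eqm_mult eqm_refl)
    also have "M * (I * cobR J \<Phi>) = (I * M) * cobR J \<Phi>" by (simp add: mult_ac)
    also have "eqm (out p) \<dots> (1 * 1 * cobR J \<Phi>)" by (intro eqm_mult IM eqm_refl)
    finally show "eqm (out p) (cobL J \<Psi>) (cobR J \<Phi>)" by (simp add: L)
  next
    assume "eqm (out p) (cobL J \<Psi>) (cobR J \<Phi>)"
    hence "eqm (out p) (I * (M * \<Psi>)) (I * cobR J \<Phi>)" unfolding L by (intro eqm_mult eqm_refl)
    moreover have "eqm (out p) (I * M * \<Psi>) (1 * 1 * \<Psi>)" by (intro eqm_mult IM eqm_refl)
    ultimately have "trunc p (I * cobR J \<Phi>) = trunc p \<Psi>"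
      by (simp add: eqm_out_iff mult.assoc)
    thus "assoc_elt (twist (kalpha_with \<Phi>) J) = \<Psi>" using trunc_id[OF assms(2)] a by simp
  qed
qed

lemma coef_scal_3: "coef (tmap (scal l) (tmap (scal l) (scal l)) f) (a, b, c) = l ^ (a + b + c) * coef f (a, b, c)"
  by (rule coef_lin) (auto simp: tmap_bvec scal_bvec lookup_scl coef_bvec power_add split: prod.splits if_splits)

lemma twist_simps:
  "basis (twist (kalpha_with \<Phi>) J) = box p" "alg_ring (twist (kalpha_with \<Phi>) J) = alg_ring (kalpha_with \<Phi>)"
  "counit (twist (kalpha_with \<Phi>) J) = (\<lambda>v. coef v 0)"
  by (simp_all add: twist_def Let_def kalpha_with_simps alg_ring_def)

text \<open>Conjugation by \<open>J\<close> is trivial in a commutative algebra, so twisting affects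
  only the associator.\<close>

lemma twist_comult:
  assumes "J \<in> Units (alg_ring (alg2 (kalpha_with \<Phi>)))" "h \<in> free_space (box p)"
  shows "comult (twist (kalpha_with \<Phi>) J) h = Delta h"
proof -
  let ?I = "ainv (alg2 (kalpha_with \<Phi>)) J"
  have "comult (twist (kalpha_with \<Phi>) J) h = trunc p ((?I * J) * Delta h)"
    by (simp add: twist_def Let_def kalpha_with_simps alg_kalpha_with_simps trunc_mult mult_ac)
  also have "\<dots> = trunc p (1 * Delta h)"
    unfolding eqm_out_iff[symmetric] by (intro eqm_mult eqm_refl ainv_props[OF trunc_alg2 p_pos assms(1)])
  also have "\<dots> = Delta h" using Delta_in_box[OF assms(2)] by (simp add: trunc_id)
  finally show ?thesis .
qed

lemma equivalentI:
  assumes "l \<noteq> 0" and J: "normalized2 J" "J \<in> free_space (box p)" and "\<Psi> \<in> free_space (box p)"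
    and "eqm (out p) (cobL J (tmap (scal l) (tmap (scal l) (scal l)) \<Psi>)) (cobR J \<Phi>)"
  shows "pseudotwist_equivalent (kalpha_with \<Phi>) (kalpha_with \<Psi>)"
  unfolding pseudotwist_equivalent_def
proof (intro exI conjI)
  show P: "pseudotwist (kalpha_with \<Phi>) J" using J by (simp add: pseudotwist_iff)
  hence U: "J \<in> Units (alg_ring (alg2 (kalpha_with \<Phi>)))" by (simp add: pseudotwist_def)
  let ?\<Psi> = "tmap (scal l) (tmap (scal l) (scal l)) \<Psi>"
  have "?\<Psi> \<in> free_space (box p)"
  proof -
    have "coef ?\<Psi> k = 0" if "coef \<Psi> k = 0" for k
      using that coef_scal_3[of l \<Psi>] by (cases k) simp
    hence "Poly_Mapping.keys ?\<Psi> \<subseteq> Poly_Mapping.keys \<Psi>" by (metis in_keys_iff subsetI)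
    thus ?thesis using assms(4) unfolding free_space_def by blast
  qed
  with assms(5) U have "assoc_elt (twist (kalpha_with \<Phi>) J) = ?\<Psi>" by (simp add: twist_assoc_iff)
  thus "quasi_hopf_iso (kalpha_with \<Psi>) (twist (kalpha_with \<Phi>) J) (scal l)"
    unfolding quasi_hopf_iso_def alg_hom_def ring_hom_def
    using linear_between_scal[of l] bij_scal[OF assms(1), of p]
    by (auto simp: twist_simps kalpha_with_simps alg_ring_simps[OF trunc_alg_kalpha_with p_pos] scal_in_box scal_trunc
        poly_homD[OF poly_hom_scal] twist_comult[OF U] Delta_scal coef_scal)
qed

text \<open>In terms of \<open>PhiC\<close> this is (p-1)! / ((p-1)! 1!).\<close>

lemma coef_Phi_invariant: "coef (Phi p) (1, p - 1, 1) = (1 :: 'k)"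
proof -
  have p: "1 < p" using prime_gt_1_nat[OF prime_p] .
  have "fact (p - 1) = (p - 1) * fact (p - 2)"
    using p by (simp add: fact_reduce numeral_2_eq_2)
  thus ?thesis
    unfolding Phi_eq coef_PhiC coef_sigma using p fact_neq_0[of "p - 1"] by (simp add: ifact_def)
qed

text \<open>An isomorphism preserves units, hence carries the associator of \<open>L\<close> to 1.
  The twist by \<open>J\<close> would then trivialize \<open>Phi p\<close>, but the invariants are 1
  and 0.\<close>

lemma not_equivalent_hopf:
  assumes "hopf_algebra (L :: ('b, 'k) quasi_alg)"
  shows "\<not> pseudotwist_equivalent (kalpha_with (Phi p)) L"
proof
  assume "pseudotwist_equivalent (kalpha_with (Phi p)) L"
  then obtain J f where J: "pseudotwist (kalpha_with (Phi p)) J" and f: "quasi_hopf_iso L (twist (kalpha_with (Phi p)) J) f"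
    by (auto simp: pseudotwist_equivalent_def)
  have U: "J \<in> Units (alg_ring (alg2 (kalpha_with (Phi p))))" using J by (simp add: pseudotwist_def)
  have K: "ring (alg_ring L)" "assoc_elt L = aone L \<boxtimes> aone L \<boxtimes> aone L"
    using assms by (auto simp: hopf_algebra_def quasi_bialgebra_def k_algebra_def tensor_alg_def)
  have one: "aone L \<in> free_space (basis L)"
    using ring.ring_simprules(6)[OF K(1)] by (simp add: alg_ring_def)
  have fl: "linear_between (basis L) (box p) f" and f1: "f (aone L) = 1"
    using f by (auto simp: quasi_hopf_iso_def alg_hom_def twist_simps ring_hom_def
        one_alg_ring[OF trunc_alg_kalpha_with p_pos]) (simp add: alg_ring_def)
  have "tmap f (tmap f f) (assoc_elt L) = 1"
    unfolding K(2)
    by (simp add: tmap_tens_on[OF fl one] linear_between_expand[OF fl one, symmetric]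
        lin_expand[OF lin_tmap, symmetric] f1 tens_1_1)
  hence "assoc_elt (twist (kalpha_with (Phi p)) J) = 1" using f by (simp add: quasi_hopf_iso_def)
  hence eq: "eqm (out p) (cobL J 1) (cobR J (Phi p))"
    using U by (simp add: twist_assoc_iff free_space_1 p_pos)
  have nrm: "normalized2 J" "normalized3 (Phi p)" "normalized3 1"
    using J normalized3_PhiC[of 0] by (auto simp: pseudotwist_iff Phi_eq normalized3_PhiC PhiC_0)
  have p: "1 < p" using prime_gt_1_nat[OF prime_p] .
  have "coef (cobL J 1) (1, p - 1, 1) = coef (cobR J (Phi p)) (1, p - 1, 1)"
    using eq p by (auto simp: eqm_def box_def)
  with cob_invariant[OF nrm] coef_Phi_invariant show False
    by (simp add: lookup_one zero_prod_def)
qed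

lemma equivalent_if_nontrivial:
  assumes "\<And>c::'k. \<exists>l. l ^ (p + 1) = c"
    and "associator (kalpha p) \<Phi>" "\<not> trivial_associator (kalpha p) \<Phi>"
  shows "pseudotwist_equivalent (kalpha_with \<Phi>) (kalpha_with (Phi p))"
proof -
  note \<Phi> = associatorD[OF assms(2)]
  \<comment> \<open>The monomial x y^(p-1) z has degree p + 1 and coefficient 1 in
    \<open>Phi p\<close>, so rescaling by \<open>l\<close> gives exactly the invariant of
    \<Phi>.\<close>
  obtain l where l: "l ^ (p + 1) = coef \<Phi> (1, p - 1, 1)" using assms(1) by blast
  define c where "c = of_nat (fact (p - 1)) * l ^ (p + 1)"
  have sc: "tmap (scal l) (tmap (scal l) (scal l)) (Phi p) = PhiC c"
  proof -
    have "coef (tmap (scal l) (tmap (scal l) (scal l)) (Phi p)) (a, b, d) = coef (PhiC c) (a, b, d)" for a b d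
      by (auto simp: coef_scal_3 Phi_eq coef_PhiC coef_sigma c_def)
    thus ?thesis by (auto intro: poly_mapping_eqI)
  qed
  have "coef (PhiC c) (1, p - 1, 1) = coef \<Phi> (1, p - 1, 1)"
    unfolding sc[symmetric] coef_scal_3 coef_Phi_invariant l[symmetric] using p_pos by simp
  then obtain J where J: "normalized2 J" "J \<in> free_space (box p)" "eqm (out p) (cobL J (PhiC c)) (cobR J \<Phi>)"
    using cohomologous[OF \<Phi>(3) normalized3_PhiC \<Phi>(2) pent_PhiC] by metis
  show ?thesis
  proof (cases "l = 0")
    case False
    thus ?thesis using J PhiC_in_box[of "of_nat (fact (p - 1))", folded Phi_eq]
      by (intro equivalentI[of l J]) (simp_all add: sc)
  next
    \<comment> \<open>If \<open>l = 0\<close>, then \<Phi> has invariant 0 and is cohomologous to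
      \<open>PhiC 0 = 1\<close>, contrary to non-triviality.\<close>
    case True
    hence "PhiC c = 1" by (simp add: c_def PhiC_0)
    moreover have "tmap (scal 1) (tmap (scal 1) (scal 1)) (1 :: nat \<times> nat \<times> nat \<Rightarrow>\<^sub>0 'k) = 1"
      by (intro poly_homD(3) poly_hom_tmap poly_hom_scal)
    ultimately have "pseudotwist_equivalent (kalpha_with \<Phi>) (kalpha_with 1)"
      using J by (intro equivalentI[of 1 J]) (auto simp: free_space_1 p_pos)
    hence "trivial_associator (kalpha p) \<Phi>"
      unfolding trivial_associator_def using hopf_algebra_kalpha by blast
    with assms(3) show ?thesis by blast
  qed
qed

end

theorem theorem5p17:
  fixes p :: nat
  assumes "CHAR('k::alg_closed_field) = p" and "p > 0"
  shows
    "(\<forall>\<Phi>'. associator (kalpha p :: (nat, 'k) quasi_alg) \<Phi>' \<and>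
         \<not> trivial_associator (kalpha p :: (nat, 'k) quasi_alg) \<Phi>' \<longrightarrow>
         pseudotwist_equivalent (with_associator (kalpha p) \<Phi>')
           (with_associator (kalpha p :: (nat, 'k) quasi_alg) (Phi p))) \<and>
     quasi_hopf_algebra (with_associator (kalpha p :: (nat, 'k) quasi_alg) (Phi p)) \<and>
     local_algebra (with_associator (kalpha p :: (nat, 'k) quasi_alg) (Phi p)) \<and>
     cocommutative (with_associator (kalpha p :: (nat, 'k) quasi_alg) (Phi p)) \<and>
     commutative_alg (with_associator (kalpha p :: (nat, 'k) quasi_alg) (Phi p)) \<and>
     alg_dim (with_associator (kalpha p :: (nat, 'k) quasi_alg) (Phi p)) = p \<and>
     (\<forall>K :: ('b, 'k) quasi_alg. hopf_algebra K \<longrightarrow>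
         \<not> pseudotwist_equivalent (with_associator (kalpha p :: (nat, 'k) quasi_alg) (Phi p)) K)"
proof -
  interpret char_p p "TYPE('k)"
    by unfold_locales (use assms in auto)
  have root: "\<exists>l::'k. l ^ (p + 1) = c" for c
    by (metis add_is_0 nth_root_exists one_neq_zero zero_less_iff_neq_zero)
  show ?thesis
  proof (intro conjI allI impI)
    show "quasi_hopf_algebra (with_associator (kalpha p :: (nat, 'k) quasi_alg) (Phi p))"
      unfolding Phi_eq by (rule quasi_hopf_PhiC)
    show "local_algebra (with_associator (kalpha p :: (nat, 'k) quasi_alg) (Phi p))"
      by (rule local_trunc_alg[OF trunc_alg_kalpha_with p_pos])
    show "alg_dim (with_associator (kalpha p :: (nat, 'k) quasi_alg) (Phi p)) = p"
      by (simp add: alg_dim_def kalpha_with_simps box_nat dim_free_space)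
  qed (use equivalent_if_nontrivial[OF root] not_equivalent_hopf cocommutative_kalpha_with
      commutative_trunc_alg[OF trunc_alg_kalpha_with p_pos] in auto)
qed

end
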